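(* Let $\mathbf{A}\in\mathbb{R}^{d\times d}$ be symmetric, $f:\mathbb{R}\to\mathbb{R}$, and let $b,q,m,n\ge 1$ be integers. Consider the two randomized procedures "Simple" and "Krylov-aware" described in the context, run with inputs $(\mathbf{A},f,b,q,m,n)$, and assume that $\mathbf{A},f,b,q,n$ are such that both procedures terminate successfully with probability one. For the Simple procedure set $\hat{\mathbf{Q}}:=\mathbf{Q}$, $\hat b:=b$ and $\hat{\mathbf{T}}:=\mathbf{T}_n$ (the block tridiagonal matrix produced by $n$ steps of block-Lanczos started from $\mathbf{Q}$). For the Krylov-aware procedure set $\hat{\mathbf{Q}}:=\bar{\mathbf{Q}}_{q+1}$, $\hat b:=(q+1)b$ and $\hat{\mathbf{T}}:=\mathbf{T}_{q+n}$ (the block tridiagonal matrix produced by $q+n$ steps of block-Lanczos started from $\mathbf{\Omega}$). In either case let $\mathbf{y}_i=(\mathbf{I}-\hat{\mathbf{Q}}\hat{\mathbf{Q}}^{\mathsf T})\boldsymbol{\psi}_i$ and $\mathbf{T}_n^{(i)}$, $i=1,\dots,m$, be as in the procedure, and define the random variables $$\Delta_0:=\frac{\big\|\hat{\mathbf{Q}}^{\mathsf T}f(\mathbf{A})\hat{\mathbf{Q}}-[f(\hat{\mathbf{T}})]_{1:\hat b,1:\hat b}\big\|_2}{\|\hat{\mathbf{Q}}\|_2^2},\qquad \Delta_i:=\frac{\big|\mathbf{y}_i^{\mathsf T}f(\mathbf{A})\mathbf{y}_i-\|\mathbf{y}_i\|_2^2\,[f(\mathbf{T}_n^{(i)})]_{1,1}\big|}{\|\mathbf{y}_i\|_2^2}\quad(1\le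 i\le m),$$ $$\Delta:=\max\{\Delta_0,\Delta_1,\dots,\Delta_m\}.$$ Then, for each of the two procedures, the output $t_{\mathrm{defl}}+t_{\mathrm{rem}}$ satisfies $$\big|\operatorname{tr}(f(\mathbf{A}))-\mathbb{E}[t_{\mathrm{defl}}+t_{\mathrm{rem}}]\big|\le d\,\mathbb{E}[\Delta],\qquad \mathbb{V}[t_{\mathrm{defl}}+t_{\mathrm{rem}}]\le\Big(\sqrt{V}+d\sqrt{\mathbb{E}[\Delta^2]}\Big)^2,$$ where, with $\mathbf{F}:=(\mathbf{I}-\hat{\mathbf{Q}}\hat{\mathbf{Q}}^{\mathsf T})f(\mathbf{A})(\mathbf{I}-\hat{\mathbf{Q}}\hat{\mathbf{Q}}^{\mathsf T})$, $$V:=\frac{2}{m}\left(\frac{d-\hat b}{d-\hat b+2}\right)\left(\mathbb{E}\big[\|\mathbf{F}\|_{\mathsf F}^2\big]-\frac{\mathbb{E}\big[\operatorname{tr}(\mathbf{F})^2\big]}{d-\hat b}\right).$$ Moreover, writing $\mathbf{P}_{\hat{\mathbf{Q}}}:=\mathbf{I}-\hat{\mathbf{Q}}\hat{\mathbf{Q}}^{\mathsf T}$, if the same matrix $\mathbf{\Omega}$ is used in both procedures, then $$\|\mathbf{P}_{\bar{\mathbf{Q}}_{q+1}}f(\mathbf{A})\mathbf{P}_{\bar{\mathbf{Q}}_{q+1}}\|_{\mathsf F}^2\le\|\mathbf{P}_{\mathbf{Q}}f(\mathbf{A})\mathbf{P}_{\mathbf{Q}}\|_{\mathsf F}^2,$$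 where $\mathbf{Q}$ is the matrix from the Simple procedure and $\bar{\mathbf{Q}}_{q+1}$ the matrix from the Krylov-aware procedure, and so $$\mathbb{E}\big[\|\mathbf{P}_{\bar{\mathbf{Q}}_{q+1}}f(\mathbf{A})\mathbf{P}_{\bar{\mathbf{Q}}_{q+1}}\|_{\mathsf F}^2\big]\le\mathbb{E}\big[\|\mathbf{P}_{\mathbf{Q}}f(\mathbf{A})\mathbf{P}_{\mathbf{Q}}\|_{\mathsf F}^2\big].$$
   Context: All computations are in exact arithmetic. For a symmetric matrix $\mathbf{S}=\mathbf{U}\mathbf{\Lambda}\mathbf{U}^{\mathsf T}$ (eigendecomposition), $f(\mathbf{S})=\mathbf{U}f(\mathbf{\Lambda})\mathbf{U}^{\mathsf T}$ with $f$ applied to the diagonal entries. $[\mathbf{B}]_{r:r',c:c'}$ is the submatrix of rows $r$ to $r'$ and columns $c$ to $c'$; a lone colon means all rows or columns. $\|\cdot\|_2$ is the Euclidean/operator norm, $\|\cdot\|_{\mathsf F}$ the Frobenius norm, $\mathbb{V}$ is variance. Expectations and variances are over all the randomness of the procedure ($\mathbf{\Omega}$ and $\mathbf{\Psi}$), and the expectations and variances appearing are understood to be well defined. $\textsc{orth}(\mathbf{B})$ denotes a matrix whose columns form an orthonormal basis of the column space of $\mathbf{B}$. Block Krylov subspace: for $\mathbf{Z}\in\mathbb{R}^{d\times b}$, $\mathcal{K}_s(\mathbf{A},\mathbf{Z})$ is the span of all columns of $\mathbf{Z},\mathbf{A}\mathbf{Z},\dots,\mathbf{A}^{s-1}\mathbf{Z}$.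 Block-Lanczos ($s$ steps, started from $\mathbf{Z}\in\mathbb{R}^{d\times b}$): take a QR factorization $\mathbf{Z}=\mathbf{Q}_1\mathbf{R}_1$ ($\mathbf{Q}_1\in\mathbb{R}^{d\times b}$ with orthonormal columns, $\mathbf{R}_1\in\mathbb{R}^{b\times b}$ upper triangular; if $\mathbf{Z}$ already has orthonormal columns, take $\mathbf{Q}_1=\mathbf{Z}$, $\mathbf{R}_1=\mathbf{I}$). For $k=1,\dots,s$: put $\mathbf{W}_k=\mathbf{A}\mathbf{Q}_k-\mathbf{Q}_{k-1}\mathbf{R}_k^{\mathsf T}$ (with the second term absent for $k=1$), $\mathbf{M}_k=\mathbf{Q}_k^{\mathsf T}\mathbf{W}_k$, and, for $k<s$, take a QR factorization $\mathbf{W}_k-\mathbf{Q}_k\mathbf{M}_k=\mathbf{Q}_{k+1}\mathbf{R}_{k+1}$. Write $\bar{\mathbf{Q}}_j=[\mathbf{Q}_1,\dots,\mathbf{Q}_j]$ and let $\mathbf{T}_s\in\mathbb{R}^{sb\times sb}$ be the symmetric block tridiagonal matrix with diagonal blocks $\mathbf{M}_1,\dots,\mathbf{M}_s$, subdiagonal blocks $\mathbf{R}_2,\dots,\mathbf{R}_s$ and superdiagonal blocks $\mathbf{R}_2^{\mathsf T},\dots,\mathbf{R}_s^{\mathsf T}$. The run is successful if $\mathcal{K}_s(\mathbf{A},\mathbf{Z})$ has dimension $sb$ (no rank-deficient blocks); then $\bar{\mathbf{Q}}_j$ has orthonormal columns spanning $\mathcal{K}_j(\mathbf{A},\mathbf{Z})$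 for $j\le s$. In both procedures $\mathbf{\Omega}\in\mathbb{R}^{d\times b}$ and $\mathbf{\Psi}=[\boldsymbol{\psi}_1,\dots,\boldsymbol{\psi}_m]\in\mathbb{R}^{d\times m}$ are independent, with i.i.d. standard Gaussian entries. Simple procedure: (1) run $q$ steps of block-Lanczos from $\mathbf{\Omega}$, obtaining $\mathbf{T}_q,\bar{\mathbf{Q}}_q,\mathbf{R}_1$; (2) $\mathbf{Q}=\textsc{orth}(\bar{\mathbf{Q}}_q[f(\mathbf{T}_q)]_{:,1:b}\mathbf{R}_1)\in\mathbb{R}^{d\times b}$; (3) run $n$ steps of block-Lanczos from $\mathbf{Q}$, obtaining $\mathbf{T}_n$, and set $t_{\mathrm{defl}}=\operatorname{tr}([f(\mathbf{T}_n)]_{1:b,1:b})$; (4) for $i=1,\dots,m$ set $\mathbf{y}_i=(\mathbf{I}-\mathbf{Q}\mathbf{Q}^{\mathsf T})\boldsymbol{\psi}_i$ and let $\mathbf{T}_n^{(i)}\in\mathbb{R}^{n\times n}$ be the tridiagonal matrix from $n$ steps of (block size one) Lanczos from $\mathbf{y}_i$; set $t_{\mathrm{rem}}=\frac{d-b}{m}\sum_{i=1}^m[f(\mathbf{T}_n^{(i)})]_{1,1}$; (5) output $t_{\mathrm{defl}}+t_{\mathrm{rem}}$. Krylov-aware procedure: (1) run $q+n$ steps of block-Lanczos from $\mathbf{\Omega}$, obtaining $\mathbf{T}_{q+n}$ and $\bar{\mathbf{Q}}_{q+1}\in\mathbb{R}^{d\times(q+1)b}$; (2) $t_{\mathrm{defl}}=\operatorname{tr}([f(\mathbf{T}_{q+n})]_{1:(q+1)b,1:(q+1)b})$;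 (3) for $i=1,\dots,m$ set $\mathbf{y}_i=(\mathbf{I}-\bar{\mathbf{Q}}_{q+1}\bar{\mathbf{Q}}_{q+1}^{\mathsf T})\boldsymbol{\psi}_i$ and let $\mathbf{T}_n^{(i)}$ be the tridiagonal matrix from $n$ steps of (block size one) Lanczos from $\mathbf{y}_i$; set $t_{\mathrm{rem}}=\frac{d-(q+1)b}{m}\sum_{i=1}^m[f(\mathbf{T}_n^{(i)})]_{1,1}$; (4) output $t_{\mathrm{defl}}+t_{\mathrm{rem}}$. A procedure terminates successfully if all its block-Lanczos runs are successful (and, for the Simple procedure, $\mathbf{Q}$ has $b$ columns). In particular all $\mathbf{y}_i$ are then nonzero and $\hat b<d$. *)

theory Defs
  imports "HOL-Probability.Probability" "Jordan_Normal_Form.DL_Rank"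
begin

hide_const (open) Determinants.trace

text \<open>
  Rows, columns and sample vectors are indexed from \<open>0\<close>, as in the matrix library; Lanczos blocks
  keep their usual numbering \<open>1, \<dots>, s\<close>.
\<close>

text \<open>
  \<open>f(S) = U f(\<Lambda>) U\<^sup>T\<close> for symmetric \<open>S = U \<Lambda> U\<^sup>T\<close> with \<open>U\<close> orthogonal. The result does not depend
  on the eigendecomposition chosen, so the choice operator picks the only candidate.
\<close>
definition mat_fun :: "(real \<Rightarrow> real) \<Rightarrow> real mat \<Rightarrow> real mat" where
  "mat_fun f S = (SOME F. \<exists>U l. U \<in> carrier_mat (dim_row S) (dim_row S)
     \<and> U\<^sup>T * U = 1\<^sub>m (dim_row S)
     \<and> S = U * mat_diag (dim_row S) l * U\<^sup>T
     \<and> F = U * mat_diag (dim_row S) (\<lambda>i. f (l i)) * U\<^sup>T)"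

definition leading :: "nat \<Rightarrow> nat \<Rightarrow> real mat \<Rightarrow> real mat" where
  "leading r c B = mat r c (\<lambda>(i, j). B $$ (i, j))"

definition trace :: "real mat \<Rightarrow> real" where
  "trace B = (\<Sum>i<dim_row B. B $$ (i, i))"

definition frob_norm :: "real mat \<Rightarrow> real" where
  "frob_norm B = sqrt (\<Sum>i<dim_row B. \<Sum>j<dim_col B. (B $$ (i, j))\<^sup>2)"

definition vec_norm :: "real vec \<Rightarrow> real" where
  "vec_norm v = sqrt (v \<bullet> v)"

definition op_norm :: "real mat \<Rightarrow> real" where
  "op_norm B = Sup {vec_norm (B *\<^sub>v v) | v. v \<in> carrier_vec (dim_col B) \<and> vec_norm v \<le> 1}"

definition orthonormal_cols :: "real mat \<Rightarrow> bool" where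
  "orthonormal_cols Q \<longleftrightarrow> Q\<^sup>T * Q = 1\<^sub>m (dim_col Q)"

definition proj_compl :: "real mat \<Rightarrow> real mat" where
  "proj_compl Q = 1\<^sub>m (dim_row Q) - Q * Q\<^sup>T"

text \<open>
  Neither the QR factorization nor an orthonormal basis of the column space is unique. Both are
  modelled by an arbitrary routine that meets its specification.
\<close>

definition is_qr :: "real mat \<Rightarrow> real mat \<times> real mat \<Rightarrow> bool" where
  "is_qr Z = (\<lambda>(Q, R). Q \<in> carrier_mat (dim_row Z) (dim_col Z) \<and> orthonormal_cols Q
     \<and> R \<in> carrier_mat (dim_col Z) (dim_col Z) \<and> upper_triangular R \<and> Z = Q * R)"

definition qr_routine :: "(real mat \<Rightarrow> real mat \<times> real mat) \<Rightarrow> bool" where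
  "qr_routine qr \<longleftrightarrow> (\<forall>Z. dim_col Z \<le> dim_row Z \<longrightarrow> is_qr Z (qr Z))"

definition is_orth :: "real mat \<Rightarrow> real mat \<Rightarrow> bool" where
  "is_orth B Q \<longleftrightarrow> dim_row Q = dim_row B \<and> orthonormal_cols Q
     \<and> vec_space.col_space (dim_row B) Q = vec_space.col_space (dim_row B) B"

definition orth_routine :: "(real mat \<Rightarrow> real mat) \<Rightarrow> bool" where
  "orth_routine orth \<longleftrightarrow> (\<forall>B. is_orth B (orth B))"

definition krylov_space :: "nat \<Rightarrow> real mat \<Rightarrow> real mat \<Rightarrow> real vec set" where
  "krylov_space s A Z =
     LinearCombinations.module.span class_ring (module_vec TYPE(real) (dim_row A))
       (\<Union>i<s. set (cols (A ^\<^sub>m i * Z)))"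

definition krylov_dim :: "nat \<Rightarrow> real mat \<Rightarrow> real mat \<Rightarrow> nat" where
  "krylov_dim s A Z = vectorspace.dim class_ring
     (module_vec TYPE(real) (dim_row A)\<lparr>carrier := krylov_space s A Z\<rparr>)"

text \<open>
  \<open>lanczos qr A Z k\<close> is the pair \<open>(Q\<^sub>k, R\<^sub>k)\<close>. The entry for \<open>k = 0\<close> sets \<open>Q\<^sub>0 = 0\<close>, which makes
  the term \<open>Q\<^sub>k\<^sub>-\<^sub>1 R\<^sub>k\<^sup>T\<close> vanish for \<open>k = 1\<close>. The pairs do not depend on the total number \<open>s\<close> of steps,
  which only determines how many of them are used.
\<close>
fun lanczos :: "(real mat \<Rightarrow> real mat \<times> real mat) \<Rightarrow> real mat \<Rightarrow> real mat \<Rightarrow> nat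
    \<Rightarrow> real mat \<times> real mat" where
  "lanczos qr A Z 0 = (0\<^sub>m (dim_row Z) (dim_col Z), 0\<^sub>m (dim_col Z) (dim_col Z))"
| "lanczos qr A Z (Suc 0) = (if orthonormal_cols Z then (Z, 1\<^sub>m (dim_col Z)) else qr Z)"
| "lanczos qr A Z (Suc (Suc k)) =
     (let (Q, R) = lanczos qr A Z (Suc k);
          W = A * Q - fst (lanczos qr A Z k) * R\<^sup>T;
          M = Q\<^sup>T * W
      in qr (W - Q * M))"

definition lanczos_Q where
  "lanczos_Q qr A Z k = fst (lanczos qr A Z k)"

definition lanczos_R where
  "lanczos_R qr A Z k = snd (lanczos qr A Z k)"

definition lanczos_M where
  "lanczos_M qr A Z k = (lanczos_Q qr A Z k)\<^sup>T *
     (A * lanczos_Q qr A Z k - lanczos_Q qr A Z (k - 1) * (lanczos_R qr A Z k)\<^sup>T)"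

definition lanczos_Qbar where
  "lanczos_Qbar qr A Z j = mat (dim_row Z) (j * dim_col Z)
     (\<lambda>(i, c). lanczos_Q qr A Z (Suc (c div dim_col Z)) $$ (i, c mod dim_col Z))"

definition lanczos_T where
  "lanczos_T qr A Z s = (let b = dim_col Z in mat (s * b) (s * b) (\<lambda>(i, j).
     let k = Suc (i div b); l = Suc (j div b); r = i mod b; c = j mod b in
       if k = l then lanczos_M qr A Z k $$ (r, c)
       else if k = Suc l then lanczos_R qr A Z k $$ (r, c)
       else if l = Suc k then lanczos_R qr A Z l $$ (c, r)
       else 0))"

definition lanczos_success :: "real mat \<Rightarrow> real mat \<Rightarrow> nat \<Rightarrow> bool" where
  "lanczos_success A Z s \<longleftrightarrow> krylov_dim s A Z = s * dim_col Z"

datatype procedure = Simple | Krylov_Aware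

fun b_hat :: "procedure \<Rightarrow> nat \<Rightarrow> nat \<Rightarrow> nat" where
  "b_hat Simple b q = b"
| "b_hat Krylov_Aware b q = (q + 1) * b"

fun Q_hat :: "procedure \<Rightarrow> (real mat \<Rightarrow> real mat \<times> real mat) \<Rightarrow> (real mat \<Rightarrow> real mat)
    \<Rightarrow> (real \<Rightarrow> real) \<Rightarrow> real mat \<Rightarrow> nat \<Rightarrow> real mat \<Rightarrow> real mat" where
  "Q_hat Simple qr orth f A q Om =
     orth (lanczos_Qbar qr A Om q
           * leading (q * dim_col Om) (dim_col Om) (mat_fun f (lanczos_T qr A Om q))
           * lanczos_R qr A Om 1)"
| "Q_hat Krylov_Aware qr orth f A q Om = lanczos_Qbar qr A Om (q + 1)"

fun T_hat :: "procedure \<Rightarrow> (real mat \<Rightarrow> real mat \<times> real mat) \<Rightarrow> (real mat \<Rightarrow> real mat)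
    \<Rightarrow> (real \<Rightarrow> real) \<Rightarrow> real mat \<Rightarrow> nat \<Rightarrow> nat \<Rightarrow> real mat \<Rightarrow> real mat" where
  "T_hat Simple qr orth f A q n Om = lanczos_T qr A (Q_hat Simple qr orth f A q Om) n"
| "T_hat Krylov_Aware qr orth f A q n Om = lanczos_T qr A Om (q + n)"

text \<open>\<open>y\<^sub>i = (I - Q Q\<^sup>T) \<psi>\<^sub>i\<close>, where \<open>\<psi>\<^sub>i\<close> is column \<open>i\<close> of \<open>Ps\<close>.\<close>
definition y_vec :: "real mat \<Rightarrow> real mat \<Rightarrow> nat \<Rightarrow> real vec" where
  "y_vec Q Ps i = proj_compl Q *\<^sub>v col Ps i"

definition y_mat :: "real mat \<Rightarrow> real mat \<Rightarrow> nat \<Rightarrow> real mat" where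
  "y_mat Q Ps i = mat_of_cols (dim_row Q) [y_vec Q Ps i]"

definition y_lanczos_entry where
  "y_lanczos_entry qr f A Q n Ps i = mat_fun f (lanczos_T qr A (y_mat Q Ps i) n) $$ (0, 0)"

definition t_defl where
  "t_defl p qr orth f A q n Om =
     (let bh = b_hat p (dim_col Om) q in
      trace (leading bh bh (mat_fun f (T_hat p qr orth f A q n Om))))"

definition t_rem where
  "t_rem p qr orth f A q n Om Ps =
     (real (dim_row A) - real (b_hat p (dim_col Om) q)) / real (dim_col Ps) *
     (\<Sum>i<dim_col Ps. y_lanczos_entry qr f A (Q_hat p qr orth f A q Om) n Ps i)"

definition t_out where
  "t_out p qr orth f A q n Om Ps = t_defl p qr orth f A q n Om + t_rem p qr orth f A q n Om Ps"

fun terminates :: "procedure \<Rightarrow> (real mat \<Rightarrow> real mat \<times> real mat) \<Rightarrow> (real mat \<Rightarrow> real mat)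
    \<Rightarrow> (real \<Rightarrow> real) \<Rightarrow> real mat \<Rightarrow> nat \<Rightarrow> nat \<Rightarrow> real mat \<Rightarrow> real mat \<Rightarrow> bool" where
  "terminates Simple qr orth f A q n Om Ps \<longleftrightarrow>
     (let Q = Q_hat Simple qr orth f A q Om in
       lanczos_success A Om q \<and> dim_col Q = dim_col Om \<and> lanczos_success A Q n
       \<and> (\<forall>i<dim_col Ps. lanczos_success A (y_mat Q Ps i) n))"
| "terminates Krylov_Aware qr orth f A q n Om Ps \<longleftrightarrow>
     (let Q = Q_hat Krylov_Aware qr orth f A q Om in
       lanczos_success A Om (q + n)
       \<and> (\<forall>i<dim_col Ps. lanczos_success A (y_mat Q Ps i) n))"

definition Delta_defl where
  "Delta_defl p qr orth f A q n Om =
     (let Q = Q_hat p qr orth f A q Om; bh = b_hat p (dim_col Om) q in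
      op_norm (Q\<^sup>T * mat_fun f A * Q - leading bh bh (mat_fun f (T_hat p qr orth f A q n Om)))
      / (op_norm Q)\<^sup>2)"

definition Delta_rem where
  "Delta_rem p qr orth f A q n Om Ps i =
     (let Q = Q_hat p qr orth f A q Om; y = y_vec Q Ps i in
      \<bar>y \<bullet> (mat_fun f A *\<^sub>v y) - (vec_norm y)\<^sup>2 * y_lanczos_entry qr f A Q n Ps i\<bar>
      / (vec_norm y)\<^sup>2)"

definition Delta where
  "Delta p qr orth f A q n Om Ps =
     Max (insert (Delta_defl p qr orth f A q n Om)
            (Delta_rem p qr orth f A q n Om Ps ` {..<dim_col Ps}))"

definition residual where
  "residual p qr orth f A q Om =
     (let P = proj_compl (Q_hat p qr orth f A q Om) in P * mat_fun f A * P)"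

text \<open>
  The joint law of the entries of two independent standard Gaussian matrices of sizes
  \<open>d \<times> b\<close> and \<open>d \<times> m\<close>. It is completed because the quantities above are only meaningful up to the
  null set on which a procedure fails; with the completion, integrability is insensitive to their
  values there.
\<close>
definition gauss_entries :: "nat \<Rightarrow> nat \<Rightarrow> (nat \<times> nat \<Rightarrow> real) measure" where
  "gauss_entries r c =
     PiM ({..<r} \<times> {..<c}) (\<lambda>_. density lborel (\<lambda>x. ennreal (std_normal_density x)))"

definition sample_space ::
    "nat \<Rightarrow> nat \<Rightarrow> nat \<Rightarrow> ((nat \<times> nat \<Rightarrow> real) \<times> (nat \<times> nat \<Rightarrow> real)) measure" where
  "sample_space d b m = completion (gauss_entries d b \<Otimes>\<^sub>M gauss_entries d m)"

definition Omega where
  "Omega d b w = (mat d b (fst w) :: real mat)"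

definition Psi where
  "Psi d m w = (mat d m (snd w) :: real mat)"

end

theory Submission
  imports Defs "Jordan_Normal_Form.Schur_Decomposition" "Jordan_Normal_Form.Spectral_Radius"
begin

text \<open>
  Condition on \<open>\<Omega>\<close>. Replacing every Lanczos quantity by the quadratic form of \<open>f(A)\<close> that it
  approximates changes the output by at most \<open>d \<Delta>\<close>, because the deflated part is a trace of size
  \<open>b\<close> and the remainder is \<open>d - b\<close> times an average. The idealized output is
  \<open>tr (Q\<^sup>T f(A) Q)\<close> plus a multiple of a mean of Rayleigh quotients of
  \<open>F = P f(A) P\<close> at Gaussian vectors in the range of the projector \<open>P = I - Q Q\<^sup>T\<close>. In a common
  eigenbasis of \<open>P\<close> and \<open>F\<close> these quotients are weighted means of \<open>z\<^sub>a\<^sup>2 / \<bar>z\<bar>\<^sup>2\<close> for a standard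
  Gaussian \<open>z\<close>, whose first two moments follow from invariance under reflections. This gives the
  conditional mean \<open>tr f(A)\<close> and the conditional variance.

  For arbitrary QR and orthogonalization routines and arbitrary \<open>f\<close> the idealized output need not
  be jointly measurable, only measurable in \<open>\<Psi>\<close> for fixed \<open>\<Omega>\<close>. The \<open>L\<^sup>2\<close> triangle inequality is
  therefore used in the form \<open>(x + y)\<^sup>2 \<le> (1 + \<tau>) x\<^sup>2 + (1 + 1/\<tau>) y\<^sup>2\<close> for all \<open>\<tau> > 0\<close>, which
  survives integration first over \<open>\<Psi>\<close> and then over \<open>\<Omega>\<close>.

  A successful block Lanczos run has orthonormal blocks, and the range of \<open>Q\<close> in the simple procedure
  lies in the range of the first \<open>q\<close> of them. Hence the Krylov-aware residual is a compression of the
  simple one, and compressions decrease the Frobenius norm.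
\<close>

section \<open>Reflection invariance of the Gaussian measure\<close>

text \<open>The change of variables is reduced to one dimension: a reflection is a composition of
  shears and one sign change, and each of these moves a coordinate affinely with slope of modulus 1
  while the others are fixed, so Fubini suffices. A swap of two axes equalizes the first moments of
  the weights \<open>p a\<close>, a sign change kills the odd moments, and one oblique reflection
  fixes the ratio 3 : 1 between pure and mixed second moments; since the weights sum to 1, the scale
  is then determined. Different columns of \<open>\<Psi>\<close> are uncorrelated by the same
  symmetry, because a reflection within one column does not move another. With
  \<open>k = d - bh p\<close>, a single quotient has variance \<open>2 / (k (k + 2))\<close> times
  \<open>|F|^2 - tr(F)^2 / k\<close>; the scale \<open>k / m\<close> and the \<open>m\<close>
  uncorrelated samples turn this into the factor \<open>2 / m * k / (k + 2)\<close>. The conditional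
  mean is constant in \<open>\<Omega>\<close>, so no variance of conditional means is added. That
  the denominators are almost surely nonzero is read off from successful termination.\<close>

lemma nn_integral_PiM_lborel_shear:
  fixes c :: "('i \<Rightarrow> real) \<Rightarrow> real" and s :: real
  assumes I: "finite I" "p \<in> I" and s: "\<bar>s\<bar> = 1"
    and g[measurable]: "g \<in> borel_measurable (PiM I (\<lambda>_. lborel))"
    and c[measurable]: "c \<in> borel_measurable (PiM I (\<lambda>_. lborel))"
    and indep: "\<And>x y. c (x(p := y)) = c x"
  shows "(\<integral>\<^sup>+x. g (x(p := s * x p + c x)) \<partial>PiM I (\<lambda>_. lborel)) = (\<integral>\<^sup>+x. g x \<partial>PiM I (\<lambda>_. lborel))"
proof -
  interpret product_sigma_finite "\<lambda>_::'i. lborel :: real measure" ..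
  define J where "J = I - {p}"
  have IJ: "I = insert p J" and J: "finite J" "p \<notin> J" using I by (auto simp: J_def)
  have m: "(\<lambda>x. x(p := s * x p + c x)) \<in> PiM I (\<lambda>_. lborel) \<rightarrow>\<^sub>M PiM I (\<lambda>_. lborel)"
    by (rule measurable_fun_upd[where J = I]) (use I in auto)
  have gm: "(\<lambda>x. g (x(p := s * x p + c x))) \<in> borel_measurable (PiM I (\<lambda>_. lborel))"
    by (rule measurable_compose[OF m g])
  have "(\<integral>\<^sup>+x. g (x(p := s * x p + c x)) \<partial>PiM I (\<lambda>_. lborel))
      = (\<integral>\<^sup>+x. \<integral>\<^sup>+y. g (x(p := c x + s * y)) \<partial>lborel \<partial>PiM J (\<lambda>_. lborel))"
    unfolding IJ by (subst product_nn_integral_insert[OF J gm[unfolded IJ]])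
      (simp add: indep add.commute)
  also have "\<dots> = (\<integral>\<^sup>+x. \<integral>\<^sup>+y. g (x(p := y)) \<partial>lborel \<partial>PiM J (\<lambda>_. lborel))"
  proof (rule nn_integral_cong)
    fix x :: "'i \<Rightarrow> real" assume x: "x \<in> space (PiM J (\<lambda>_. lborel))"
    have "(\<lambda>y. x(p := y)) \<in> lborel \<rightarrow>\<^sub>M PiM I (\<lambda>_. lborel)"
      unfolding IJ by (rule measurable_component_update) (use x J in auto)
    from measurable_compose[OF this g] have "(\<lambda>y. g (x(p := y))) \<in> borel_measurable borel" by simp
    \<comment> \<open>For fixed other coordinates, \<open>c x\<close> is a constant by
      \<open>indep\<close>, so the substitution in coordinate \<open>p\<close> is affine with slope
      of modulus 1 and preserves Lebesgue measure.\<close>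
    from nn_integral_real_affine[OF this, of s "c x"] s
    show "(\<integral>\<^sup>+y. g (x(p := c x + s * y)) \<partial>lborel) = (\<integral>\<^sup>+y. g (x(p := y)) \<partial>lborel)"
      by (cases "s = 0") auto
  qed
  also have "\<dots> = (\<integral>\<^sup>+x. g x \<partial>PiM I (\<lambda>_. lborel))"
    unfolding IJ by (subst product_nn_integral_insert[OF J g[unfolded IJ]]) simp
  finally show ?thesis .
qed

text \<open>No shear of the family changes \<open>x p\<close> or a coordinate moved by another one,
  so they can be peeled off one at a time.\<close>

lemma nn_integral_PiM_lborel_multi_shear:
  fixes a :: "'i \<Rightarrow> real"
  assumes I: "finite I" "p \<in> I" and J: "J \<subseteq> I - {p}"
    and g: "g \<in> borel_measurable (PiM I (\<lambda>_. lborel))"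
  shows "(\<integral>\<^sup>+x. g (\<lambda>j. if j \<in> J then x j + a j * x p else x j) \<partial>PiM I (\<lambda>_. lborel))
    = (\<integral>\<^sup>+x. g x \<partial>PiM I (\<lambda>_. lborel))"
proof -
  have "finite J" using I J by (meson finite_Diff finite_subset)
  then show ?thesis using J g
  proof (induction J arbitrary: g)
    case empty
    then show ?case by simp
  next
    case (insert k J)
    let ?M = "PiM I (\<lambda>_. lborel :: real measure)"
    define T where "T x = (\<lambda>j. if j \<in> J then x j + a j * x p else x j)" for x :: "'i \<Rightarrow> real"
    have m: "(\<lambda>x. x(k := 1 * x k + a k * x p)) \<in> ?M \<rightarrow>\<^sub>M ?M"
      by (rule measurable_fun_upd[where J = I]) (use I insert.prems in auto)
    note g = insert.prems(2)
    have "(\<integral>\<^sup>+x. g (\<lambda>j. if j \<in> insert k J then x j + a j * x p else x j) \<partial>?M)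
        = (\<integral>\<^sup>+x. g ((T x)(k := 1 * T x k + a k * T x p)) \<partial>?M)"
      using insert by (intro nn_integral_cong arg_cong[of _ _ g]) (auto simp: T_def fun_eq_iff)
    also have "\<dots> = (\<integral>\<^sup>+x. g (x(k := 1 * x k + a k * x p)) \<partial>?M)"
      unfolding T_def by (rule insert.IH[OF _ measurable_compose[OF m g]]) (use insert.prems in auto)
    also have "\<dots> = (\<integral>\<^sup>+x. g x \<partial>?M)"
      by (rule nn_integral_PiM_lborel_shear[OF I(1) _ _ g]) (use insert.prems I in auto)
    finally show ?case .
  qed
qed

text \<open>The Householder map of \<open>v\<close>. It is an isometry for unit \<open>v\<close>;
  that condition is left to the lemmas, so that invariance can be stated for arbitrary
  \<open>v\<close>.\<close>

definition reflection :: "'i set \<Rightarrow> ('i \<Rightarrow> real) \<Rightarrow> ('i \<Rightarrow> real) \<Rightarrow> 'i \<Rightarrow> real" where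
  "reflection I v x = (\<lambda>i. x i - 2 * (\<Sum>j\<in>I. v j * x j) * v i)"

text \<open>With \<open>v p \<noteq> 0\<close>, the coordinate change \<open>x p \<mapsto> (v \<bullet> x) / v p\<close> is a shear and turns the
  reflection into a sign change of \<open>x p\<close> composed with shears along \<open>x p\<close>.\<close>
lemma nn_integral_PiM_lborel_reflection:
  fixes v :: "'i \<Rightarrow> real"
  assumes I: "finite I" and v: "(\<Sum>i\<in>I. (v i)\<^sup>2) = 1" and v0: "\<And>i. i \<notin> I \<Longrightarrow> v i = 0"
    and g: "g \<in> borel_measurable (PiM I (\<lambda>_. lborel))"
  shows "(\<integral>\<^sup>+x. g (reflection I v x) \<partial>PiM I (\<lambda>_. lborel)) = (\<integral>\<^sup>+x. g x \<partial>PiM I (\<lambda>_. lborel))"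
proof -
  let ?M = "PiM I (\<lambda>_. lborel :: real measure)"
  obtain p where p: "p \<in> I" "v p \<noteq> 0"
  proof (rule ccontr)
    assume "\<not> thesis"
    with that have "\<forall>i\<in>I. v i = 0" by blast
    with v show False by simp
  qed
  define J where "J = I - {p}"
  have IJ: "I = insert p J" and J: "finite J" "p \<notin> J" using I p by (auto simp: J_def)
  define c where "c x = (\<Sum>j\<in>J. v j / v p * x j)" for x :: "'i \<Rightarrow> real"
  have cm[measurable]: "c \<in> borel_measurable ?M"
    unfolding c_def by (intro borel_measurable_sum) (auto simp: IJ)
  have c0: "c (x(p := y)) = c x" for x y unfolding c_def using J by (intro sum.cong) auto
  define S where "S s e x = x(p := s * x p + e * c x)" for s e and x :: "'i \<Rightarrow> real"
  have Sm: "S s e \<in> ?M \<rightarrow>\<^sub>M ?M" for s e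
    unfolding S_def by (rule measurable_fun_upd[where J = I]) (use p in auto)
  have S: "(\<integral>\<^sup>+x. h (S s e x) \<partial>?M) = (\<integral>\<^sup>+x. h x \<partial>?M)" if "\<bar>s\<bar> = 1" "h \<in> borel_measurable ?M"
    for h s e
    unfolding S_def by (rule nn_integral_PiM_lborel_shear[OF I p(1) that]) (auto simp: c0)
  \<comment> \<open>Once coordinate \<open>p\<close> holds \<open>(v \<bullet> x) / v p\<close>, the
    factor \<open>v p\<close> cancels the division, and \<open>T\<close> subtracts
    \<open>2 (v \<bullet> x) v j\<close> exactly as the reflection does.\<close>
  define T where "T x = (\<lambda>j. if j \<in> J then x j + (- 2 * v j * v p) * x p else x j)"
    for x :: "'i \<Rightarrow> real"
  have T: "(\<integral>\<^sup>+x. h (T x) \<partial>?M) = (\<integral>\<^sup>+x. h x \<partial>?M)" if "h \<in> borel_measurable ?M" for h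
    unfolding T_def by (rule nn_integral_PiM_lborel_multi_shear[OF I p(1) _ that]) (auto simp: J_def)
  have Tm: "T \<in> ?M \<rightarrow>\<^sub>M ?M"
    by (rule measurable_PiM_single')
      (use p in \<open>auto simp: T_def space_PiM PiE_def extensional_def IJ\<close>)
  have eq: "reflection I v x = S 1 (- 1) (S (- 1) 0 (T (S 1 1 x)))" for x
  proof -
    define D where "D = (\<Sum>j\<in>I. v j * x j)"
    have D: "D = v p * x p + v p * c x"
      unfolding D_def IJ c_def using J p by (simp add: sum_distrib_left)
    \<comment> \<open>The unit norm makes \<open>T\<close> change \<open>c\<close> by a multiple of
      \<open>1 - (v p)^2\<close>, which is what lets coordinate \<open>p\<close> come out as
      \<open>x p - 2 D v p\<close> at the end.\<close>
    have v1: "(\<Sum>j\<in>J. (v j)\<^sup>2) = 1 - (v p)\<^sup>2" using v J unfolding IJ by simp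
    have "c (\<lambda>j. if j \<in> J then x j + - 2 * v j * D else x j)
        = (\<Sum>j\<in>J. v j / v p * x j - 2 * D / v p * (v j)\<^sup>2)"
      unfolding c_def by (intro sum.cong) (auto simp: power2_eq_square field_simps p)
    also have "\<dots> = c x - 2 * D / v p * (1 - (v p)\<^sup>2)"
      by (simp only: sum_subtractf c_def v1 flip: sum_distrib_left)
    finally have c1: "c (\<lambda>j. if j \<in> J then x j + - 2 * v j * D else x j)
        = c x - 2 * D / v p * (1 - (v p)\<^sup>2)" .
    have xp: "x p + c x = D / v p" using D p by (simp add: field_simps)
    have T1: "T (S 1 1 x) = (\<lambda>j. if j \<in> J then x j + - 2 * v j * D else x j)(p := D / v p)"
      using J p xp by (auto simp: T_def S_def fun_eq_iff)
    have "S (- 1) 0 (T (S 1 1 x)) = (\<lambda>j. if j \<in> J then x j + - 2 * v j * D else x j)(p := - D / v p)"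
      unfolding T1 by (auto simp: S_def)
    then have "S 1 (- 1) (S (- 1) 0 (T (S 1 1 x)))
        = (\<lambda>j. if j \<in> J then x j + - 2 * v j * D else x j)(p := 2 * D / v p * (1 - (v p)\<^sup>2) - c x - D / v p)"
      by (simp add: S_def c0 c1)
    also have "2 * D / v p * (1 - (v p)\<^sup>2) - c x - D / v p = x p - 2 * D * v p"
      using D p by (simp add: field_simps power2_eq_square)
    finally have "S 1 (- 1) (S (- 1) 0 (T (S 1 1 x)))
        = (\<lambda>j. if j \<in> J then x j + - 2 * v j * D else x j)(p := x p - 2 * D * v p)" .
    then show ?thesis
      unfolding reflection_def D_def[symmetric] using v0 by (auto simp: IJ fun_eq_iff)
  qed
  have 1: "(\<lambda>x. g (S 1 (- 1) x)) \<in> borel_measurable ?M" by (rule measurable_compose[OF Sm g])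
  have 2: "(\<lambda>x. g (S 1 (- 1) (S (- 1) 0 x))) \<in> borel_measurable ?M" by (rule measurable_compose[OF Sm 1])
  have 3: "(\<lambda>x. g (S 1 (- 1) (S (- 1) 0 (T x)))) \<in> borel_measurable ?M" by (rule measurable_compose[OF Tm 2])
  show ?thesis
    unfolding eq using S[OF _ 3] T[OF 2] S[OF _ 1] S[OF _ g] by simp
qed

section \<open>Invariance of the standard Gaussian product measure\<close>

abbreviation std_gauss :: "real measure" where
  "std_gauss \<equiv> density lborel (\<lambda>x. ennreal (std_normal_density x))"

lemma prob_space_std_gauss: "prob_space std_gauss"
  using prob_space_normal_density[of 1 0] by simp

text \<open>Both sides agree on boxes, which determine a finite product of sigma-finite measures.
  This transfers invariance from Lebesgue to Gaussian measure.\<close>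

lemma PiM_density_lborel:
  fixes \<phi> :: "real \<Rightarrow> ennreal"
  assumes I: "finite I" and \<phi>[measurable]: "\<phi> \<in> borel_measurable borel"
    and sf: "sigma_finite_measure (density lborel \<phi>)"
  shows "PiM I (\<lambda>_. density lborel \<phi>) = density (PiM I (\<lambda>_. lborel)) (\<lambda>x. \<Prod>i\<in>I. \<phi> (x i))"
proof -
  interpret D: product_sigma_finite "\<lambda>_. density lborel \<phi>" using sf by unfold_locales
    (auto simp: product_sigma_finite_def sigma_finite_measure_def)
  interpret L: product_sigma_finite "\<lambda>_. lborel :: real measure" ..
  show ?thesis
  proof (rule D.PiM_eqI[OF I, symmetric])
    show "sets (density (PiM I (\<lambda>_. lborel)) (\<lambda>x. \<Prod>i\<in>I. \<phi> (x i))) = sets (PiM I (\<lambda>_. density lborel \<phi>))"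
      by (auto intro!: sets_PiM_cong)
    fix A assume A: "\<And>i. i \<in> I \<Longrightarrow> A i \<in> sets (density lborel \<phi>)"
    then have A'[measurable]: "\<And>i. i \<in> I \<Longrightarrow> A i \<in> sets borel" by simp
    have sA: "Pi\<^sub>E I A \<in> sets (PiM I (\<lambda>_. lborel))" using A' I by (intro sets_PiM_I_finite) auto
    have pm: "(\<lambda>x. \<Prod>i\<in>I. \<phi> (x i)) \<in> borel_measurable (PiM I (\<lambda>_. lborel))"
      by (intro borel_measurable_prod_ennreal) measurable
    have "emeasure (density (PiM I (\<lambda>_. lborel)) (\<lambda>x. \<Prod>i\<in>I. \<phi> (x i))) (Pi\<^sub>E I A)
        = (\<integral>\<^sup>+x. (\<Prod>i\<in>I. \<phi> (x i)) * indicator (Pi\<^sub>E I A) x \<partial>PiM I (\<lambda>_. lborel))"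
      by (rule emeasure_density[OF pm sA])
    also have "\<dots> = (\<integral>\<^sup>+x. (\<Prod>i\<in>I. \<phi> (x i) * indicator (A i) (x i)) \<partial>PiM I (\<lambda>_. lborel))"
    proof (rule nn_integral_cong)
      fix x :: "'a \<Rightarrow> real" assume "x \<in> space (PiM I (\<lambda>_. lborel))"
      then have "indicator (Pi\<^sub>E I A) x = (\<Prod>i\<in>I. indicator (A i) (x i) :: ennreal)"
        using I by (auto simp: indicator_def of_bool_def space_PiM PiE_def prod_zero_iff Pi_iff)
      then show "(\<Prod>i\<in>I. \<phi> (x i)) * indicator (Pi\<^sub>E I A) x = (\<Prod>i\<in>I. \<phi> (x i) * indicator (A i) (x i))"
        by (simp add: prod.distrib)
    qed
    also have "\<dots> = (\<Prod>i\<in>I. \<integral>\<^sup>+x. \<phi> x * indicator (A i) x \<partial>lborel)"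
      by (rule L.product_nn_integral_prod[OF I]) measurable
    also have "\<dots> = (\<Prod>i\<in>I. emeasure (density lborel \<phi>) (A i))"
      by (intro prod.cong) (auto simp: emeasure_density)
    finally show "emeasure (density (PiM I (\<lambda>_. lborel)) (\<lambda>x. \<Prod>i\<in>I. \<phi> (x i))) (Pi\<^sub>E I A)
        = (\<Prod>i\<in>I. emeasure (density lborel \<phi>) (A i))" .
  qed
qed

lemma sum_reflection_square:
  assumes I: "finite I" and v: "(\<Sum>i\<in>I. (v i)\<^sup>2) = 1"
  shows "(\<Sum>i\<in>I. (reflection I v x i)\<^sup>2) = (\<Sum>i\<in>I. (x i)\<^sup>2)"
proof -
  define D where "D = (\<Sum>j\<in>I. v j * x j)"
  have "(\<Sum>i\<in>I. (reflection I v x i)\<^sup>2) = (\<Sum>i\<in>I. (x i)\<^sup>2 - 4 * D * (v i * x i) + 4 * D\<^sup>2 * (v i)\<^sup>2)"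
    unfolding reflection_def D_def[symmetric]
    by (intro sum.cong) (auto simp: power2_eq_square algebra_simps)
  also have "\<dots> = (\<Sum>i\<in>I. (x i)\<^sup>2) - 4 * D * D + 4 * D\<^sup>2 * (\<Sum>i\<in>I. (v i)\<^sup>2)"
    by (simp add: sum.distrib sum_subtractf D_def flip: sum_distrib_left)
  finally show ?thesis unfolding v by (simp add: power2_eq_square)
qed

lemma measurable_reflection:
  assumes v0: "\<And>i. i \<notin> I \<Longrightarrow> v i = 0" and M: "sets M = sets borel" "space M = UNIV"
  shows "reflection I v \<in> PiM I (\<lambda>_. M) \<rightarrow>\<^sub>M PiM I (\<lambda>_. M)"
proof (rule measurable_PiM_single')
  have [measurable]: "(\<lambda>x. x i) \<in> borel_measurable (PiM I (\<lambda>_. M))" if "i \<in> I" for i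
    using measurable_component_singleton[OF that, of "\<lambda>_. M"] M(1) measurable_cong_sets by blast
  show "(\<lambda>x. reflection I v x i) \<in> PiM I (\<lambda>_. M) \<rightarrow>\<^sub>M M" if "i \<in> I" for i
    unfolding reflection_def measurable_cong_sets[OF refl M(1)] using that by measurable
  show "(\<lambda>x i. reflection I v x i) \<in> space (PiM I (\<lambda>_. M)) \<rightarrow> I \<rightarrow>\<^sub>E space M"
    by (auto simp: reflection_def v0 space_PiM PiE_def extensional_def M)
qed

text \<open>The Gaussian density depends only on the sum of squares, which a unit reflection
  preserves, and the underlying Lebesgue measure is invariant.\<close>

lemma distr_PiM_std_gauss_reflection:
  fixes v :: "'i \<Rightarrow> real"
  assumes I: "finite I" and v: "(\<Sum>i\<in>I. (v i)\<^sup>2) = 1" and v0: "\<And>i. i \<notin> I \<Longrightarrow> v i = 0"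
  defines "G \<equiv> PiM I (\<lambda>_. std_gauss)"
  shows "distr G G (reflection I v) = G"
proof (rule measure_eqI)
  let ?M = "PiM I (\<lambda>_. lborel :: real measure)"
  let ?d = "\<lambda>x :: 'i \<Rightarrow> real. \<Prod>i\<in>I. ennreal (std_normal_density (x i))"
  have G: "G = density ?M ?d"
    unfolding G_def using prob_space_std_gauss
    by (intro PiM_density_lborel I prob_space_imp_sigma_finite) auto
  have dm[measurable]: "?d \<in> borel_measurable ?M"
    by (intro borel_measurable_prod_ennreal) measurable
  have Rm: "reflection I v \<in> ?M \<rightarrow>\<^sub>M ?M" by (rule measurable_reflection[OF v0]) auto
  have RG: "reflection I v \<in> G \<rightarrow>\<^sub>M G" unfolding G_def by (rule measurable_reflection[OF v0]) auto
  have d: "?d x = ennreal ((1 / sqrt (2 * pi)) ^ card I * exp (- (\<Sum>i\<in>I. (x i)\<^sup>2) / 2))" for x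
    using I by (subst prod_ennreal)
      (auto simp: normal_density_def prod_dividef power_one_over exp_sum sum_negf sum_divide_distrib simp flip: sum_negf)
  have dR: "?d (reflection I v x) = ?d x" for x unfolding d sum_reflection_square[OF I v] ..
  fix A assume "A \<in> sets (distr G G (reflection I v))"
  then have A: "A \<in> sets G" by simp
  then have AM[measurable]: "A \<in> sets ?M" by (simp add: G)
  have "emeasure (distr G G (reflection I v)) A = (\<integral>\<^sup>+x. indicator A x \<partial>distr G G (reflection I v))"
    using A by simp
  also have "\<dots> = (\<integral>\<^sup>+x. indicator A (reflection I v x) \<partial>G)"
    by (rule nn_integral_distr[OF RG]) (use A in simp)
  also have "\<dots> = (\<integral>\<^sup>+x. ?d x * indicator A (reflection I v x) \<partial>?M)"
    unfolding G by (rule nn_integral_density[OF dm]) (rule measurable_compose[OF Rm], measurable)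
  also have "\<dots> = (\<integral>\<^sup>+x. ?d (reflection I v x) * indicator A (reflection I v x) \<partial>?M)"
    unfolding dR ..
  also have "\<dots> = (\<integral>\<^sup>+x. ?d x * indicator A x \<partial>?M)"
    by (rule nn_integral_PiM_lborel_reflection[OF I v v0]) measurable
  also have "\<dots> = (\<integral>\<^sup>+x. indicator A x \<partial>G)"
    unfolding G by (rule nn_integral_density[OF dm, symmetric]) measurable
  also have "\<dots> = emeasure G A" using A by simp
  finally show "emeasure (distr G G (reflection I v)) A = emeasure G A" .
qed simp

section \<open>Moments of the direction of a Gaussian vector\<close>

lemma sum_of_two:
  fixes f :: "'a \<Rightarrow> real"
  assumes "finite J" "a \<in> J" "b \<in> J" "a \<noteq> b" "\<And>e. e \<in> J \<Longrightarrow> e \<noteq> a \<Longrightarrow> e \<noteq> b \<Longrightarrow> f e = 0"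
  shows "sum f J = f a + f b"
proof -
  have "sum f J = sum f {a, b}" using assms by (intro sum.mono_neutral_right) auto
  then show ?thesis using assms by simp
qed

text \<open>An orthonormal family \<open>u\<close> in the space indexed by \<open>I\<close>, and the
  coordinates of a Gaussian vector along it. The family need not span: later \<open>I\<close>
  indexes a whole Gaussian matrix while \<open>u\<close> lives on one of its columns. The assumption
  \<open>nonzero\<close> makes the normalization by \<open>R\<close> meaningful and excludes an
  empty \<open>J\<close>.\<close>

locale gauss_coords =
  fixes I :: "'i set" and J :: "'a set" and u :: "'a \<Rightarrow> 'i \<Rightarrow> real"
  assumes fin_I: "finite I" and fin_J: "finite J"
    and u_supp: "\<And>a i. a \<in> J \<Longrightarrow> i \<notin> I \<Longrightarrow> u a i = 0"
    and u_orth: "\<And>a b. a \<in> J \<Longrightarrow> b \<in> J \<Longrightarrow> (\<Sum>i\<in>I. u a i * u b i) = of_bool (a = b)"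
    and nonzero: "AE x in PiM I (\<lambda>_. std_gauss). (\<Sum>a\<in>J. (\<Sum>i\<in>I. u a i * x i)\<^sup>2) \<noteq> 0"
begin

definition G :: "('i \<Rightarrow> real) measure" where "G = PiM I (\<lambda>_. std_gauss)"

definition z :: "'a \<Rightarrow> ('i \<Rightarrow> real) \<Rightarrow> real" where "z a x = (\<Sum>i\<in>I. u a i * x i)"

definition comb :: "('a \<Rightarrow> real) \<Rightarrow> 'i \<Rightarrow> real" where "comb c i = (\<Sum>a\<in>J. c a * u a i)"

definition R :: "('i \<Rightarrow> real) \<Rightarrow> real" where "R x = (\<Sum>a\<in>J. (z a x)\<^sup>2)"

text \<open>The squared cosine of the angle between \<open>u a\<close> and the projection of
  \<open>x\<close> onto the span of \<open>u\<close>. Where \<open>R x = 0\<close> it is 0 by the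
  convention for division, so its bounds hold everywhere and only the sum being 1 is an almost sure
  statement.\<close>

definition p :: "'a \<Rightarrow> ('i \<Rightarrow> real) \<Rightarrow> real" where "p a x = (z a x)\<^sup>2 / R x"

abbreviation k :: real where "k \<equiv> real (card J)"

sublocale G: prob_space G
  unfolding G_def by (intro prob_space_PiM prob_space_std_gauss)

lemma measurable_z[measurable]: "z a \<in> borel_measurable G"
proof -
  have "(\<lambda>x. x i) \<in> borel_measurable G" if "i \<in> I" for i
    unfolding G_def using measurable_component_singleton[OF that, of "\<lambda>_. std_gauss"] by simp
  then have "(\<lambda>x. \<Sum>i\<in>I. u a i * x i) \<in> borel_measurable G"
    by (intro borel_measurable_sum borel_measurable_times) auto
  then show ?thesis unfolding z_def[abs_def] .
qed

lemma measurable_R[measurable]: "R \<in> borel_measurable G"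
  unfolding R_def[abs_def] by measurable

lemma measurable_p[measurable]: "p a \<in> borel_measurable G"
  unfolding p_def[abs_def] by measurable

lemma p_nonneg: "0 \<le> p a x"
  by (simp add: p_def R_def sum_nonneg)

lemma p_le_1: "a \<in> J \<Longrightarrow> p a x \<le> 1"
proof -
  assume "a \<in> J"
  then have "(z a x)\<^sup>2 \<le> R x"
    unfolding R_def using fin_J by (intro member_le_sum) auto
  then show ?thesis by (simp add: p_def R_def sum_nonneg divide_le_eq_1)
    (metis R_def sum_nonneg zero_le_power2 order_le_less zero_less_power2)
qed

lemma abs_p: "a \<in> J \<Longrightarrow> \<bar>p a x\<bar> \<le> 1"
  using p_nonneg p_le_1 by simp

lemma AE_R: "AE x in G. R x \<noteq> 0"
  using nonzero unfolding G_def R_def z_def .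

lemma AE_sum_p: "AE x in G. (\<Sum>a\<in>J. p a x) = 1"
  using AE_R by eventually_elim (simp add: p_def R_def flip: sum_divide_distrib)

text \<open>Reflecting along a vector of the span acts on the coordinates as a reflection of the
  space indexed by \<open>J\<close>, because \<open>u\<close> is orthonormal. All symmetry arguments
  can therefore be made in these coordinates.\<close>

lemma z_reflection:
  assumes a: "a \<in> J"
  shows "z a (reflection I (comb c) x) = reflection J c (\<lambda>a. z a x) a"
proof -
  define D where "D = (\<Sum>i\<in>I. comb c i * x i)"
  have D: "D = (\<Sum>e\<in>J. c e * z e x)"
    unfolding D_def comb_def z_def sum_distrib_left sum_distrib_right
    by (subst sum.swap) (simp add: mult.assoc)
  have "(\<Sum>i\<in>I. u a i * comb c i) = (\<Sum>e\<in>J. c e * (\<Sum>i\<in>I. u a i * u e i))"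
    unfolding comb_def sum_distrib_left by (subst sum.swap) (simp add: mult_ac)
  also have "\<dots> = (\<Sum>e\<in>J. if a = e then c e else 0)"
    using a by (intro sum.cong) (auto simp: u_orth)
  finally have *: "(\<Sum>i\<in>I. u a i * comb c i) = c a" using a fin_J by simp
  have "z a (reflection I (comb c) x) = (\<Sum>i\<in>I. u a i * x i - 2 * D * (u a i * comb c i))"
    unfolding z_def reflection_def D_def[symmetric] by (intro sum.cong) (auto simp: algebra_simps)
  also have "\<dots> = z a x - 2 * D * c a"
    by (simp add: sum_subtractf z_def * flip: sum_distrib_left)
  finally show ?thesis by (simp add: reflection_def D)
qed

lemma comb_norm:
  assumes "(\<Sum>a\<in>J. (c a)\<^sup>2) = 1"
  shows "(\<Sum>i\<in>I. (comb c i)\<^sup>2) = 1"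
proof -
  have "(\<Sum>i\<in>I. (comb c i)\<^sup>2) = (\<Sum>i\<in>I. \<Sum>a\<in>J. \<Sum>b\<in>J. c a * c b * (u a i * u b i))"
    unfolding comb_def power2_eq_square sum_product by (simp add: mult_ac)
  also have "\<dots> = (\<Sum>a\<in>J. \<Sum>b\<in>J. \<Sum>i\<in>I. c a * c b * (u a i * u b i))"
    by (subst sum.swap, rule sum.cong[OF refl], rule sum.swap)
  also have "\<dots> = (\<Sum>a\<in>J. \<Sum>b\<in>J. if a = b then c a * c b else 0)"
    by (intro sum.cong refl) (simp add: u_orth flip: sum_distrib_left)
  also have "\<dots> = (\<Sum>a\<in>J. (c a)\<^sup>2)"
    using fin_J by (simp add: power2_eq_square)
  finally show ?thesis using assms by simp
qed

lemma comb_supp: "i \<notin> I \<Longrightarrow> comb c i = 0"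
  by (simp add: comb_def u_supp)

lemma integral_reflection:
  fixes \<Phi> :: "('i \<Rightarrow> real) \<Rightarrow> real"
  assumes c: "(\<Sum>a\<in>J. (c a)\<^sup>2) = 1" and \<Phi>: "\<Phi> \<in> borel_measurable G"
  shows "(\<integral>x. \<Phi> (reflection I (comb c) x) \<partial>G) = (\<integral>x. \<Phi> x \<partial>G)"
proof -
  have m: "reflection I (comb c) \<in> G \<rightarrow>\<^sub>M G"
    unfolding G_def by (rule measurable_reflection[OF comb_supp]) auto
  have "(\<integral>x. \<Phi> x \<partial>G) = (\<integral>x. \<Phi> x \<partial>distr G G (reflection I (comb c)))"
    unfolding G_def by (subst distr_PiM_std_gauss_reflection[OF fin_I comb_norm[OF c] comb_supp]) auto
  also have "\<dots> = (\<integral>x. \<Phi> (reflection I (comb c) x) \<partial>G)"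
    by (rule integral_distr[OF m \<Phi>])
  finally show ?thesis ..
qed

lemma R_reflection:
  assumes c: "(\<Sum>a\<in>J. (c a)\<^sup>2) = 1"
  shows "R (reflection I (comb c) x) = R x"
  unfolding R_def using sum_reflection_square[OF fin_J c, of "\<lambda>a. z a x"]
  by (simp add: z_reflection)

lemma reflection_two:
  fixes \<zeta> :: "'a \<Rightarrow> real"
  assumes ab: "a \<in> J" "b \<in> J" "a \<noteq> b" and c: "\<And>e. e \<noteq> a \<Longrightarrow> e \<noteq> b \<Longrightarrow> c e = 0"
  shows "reflection J c \<zeta> e = \<zeta> e - 2 * (c a * \<zeta> a + c b * \<zeta> b) * c e"
  unfolding reflection_def using sum_of_two[OF fin_J ab, of "\<lambda>j. c j * \<zeta> j"] c by simp

text \<open>A stand-in for independence from the coordinates \<open>z\<close>: constants qualify,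
  and so do bounded functions of other columns of the Gaussian matrix. The latter are unaffected by
  \<open>reflection\<close> for every \<open>c\<close>, of unit norm or not.\<close>

definition invariant :: "(('i \<Rightarrow> real) \<Rightarrow> real) \<Rightarrow> bool" where
  "invariant h \<longleftrightarrow> h \<in> borel_measurable G \<and> (\<exists>B. \<forall>x. \<bar>h x\<bar> \<le> B)
     \<and> (\<forall>c x. h (reflection I (comb c) x) = h x)"

lemma integrable_bounded:
  fixes \<Phi> :: "('i \<Rightarrow> real) \<Rightarrow> real"
  assumes "\<Phi> \<in> borel_measurable G" "\<And>x. \<bar>\<Phi> x\<bar> \<le> B"
  shows "integrable G \<Phi>"
  by (rule G.integrable_const_bound[where B = B]) (use assms in auto)

lemma invariantD: "invariant h \<Longrightarrow> h \<in> borel_measurable G" "invariant h \<Longrightarrow> h (reflection I (comb c) x) = h x"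
  by (auto simp: invariant_def)

lemma invariantB: assumes "invariant h" obtains B where "B \<ge> 0" "\<And>x. \<bar>h x\<bar> \<le> B"
  using assms unfolding invariant_def by (meson abs_ge_zero order_trans)

lemma integrable_invariant_p: assumes h: "invariant h" and a: "a \<in> J" shows "integrable G (\<lambda>x. h x * p a x)"
proof -
  obtain B where B: "B \<ge> 0" "\<And>x. \<bar>h x\<bar> \<le> B" using invariantB[OF h] by blast
  have [measurable]: "h \<in> borel_measurable G" using invariantD[OF h] by simp
  show ?thesis
  proof (rule integrable_bounded)
    show "(\<lambda>x. h x * p a x) \<in> borel_measurable G" by measurable
    show "\<bar>h x * p a x\<bar> \<le> B" for x
      unfolding abs_mult using mult_mono[OF B(2)[of x] abs_p[OF a, of x]] B(1) by simp
  qed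
qed

text \<open>The reflection along \<open>(e_a - e_b) / sqrt 2\<close> exchanges the two coordinates
  and fixes both \<open>R\<close> and \<open>h\<close>.\<close>

lemma integral_invariant_p_swap:
  assumes h: "invariant h" and ab: "a \<in> J" "b \<in> J"
  shows "(\<integral>x. h x * p a x \<partial>G) = (\<integral>x. h x * p b x \<partial>G)"
proof (cases "a = b")
  case False
  define c where "c e = (if e = a then 1 / sqrt 2 else if e = b then - 1 / sqrt 2 else 0)" for e
  have c: "(\<Sum>a\<in>J. (c a)\<^sup>2) = 1"
    by (subst sum_of_two[OF fin_J ab False]) (use False in \<open>auto simp: c_def power_divide\<close>)
  have [measurable]: "h \<in> borel_measurable G" using invariantD[OF h] by simp
  have z: "z b (reflection I (comb c) x) = z a x" for x
    unfolding z_reflection[OF ab(2)]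
    by (subst reflection_two[OF ab False]) (use False in \<open>auto simp: c_def field_simps\<close>)
  have "(\<integral>x. h x * p b x \<partial>G) = (\<integral>x. h (reflection I (comb c) x) * p b (reflection I (comb c) x) \<partial>G)"
    by (rule integral_reflection[OF c, symmetric]) measurable
  also have "\<dots> = (\<integral>x. h x * p a x \<partial>G)"
    unfolding invariantD(2)[OF h] by (simp add: p_def z R_reflection[OF c])
  finally show ?thesis ..
qed simp

text \<open>The weights \<open>p b\<close> sum to 1 almost everywhere, and by the swap symmetry each
  of the \<open>k\<close> summands contributes equally.\<close>

lemma integral_invariant_p:
  assumes h: "invariant h" and a: "a \<in> J"
  shows "(\<integral>x. h x * p a x \<partial>G) = (\<integral>x. h x \<partial>G) / k"
proof -
  have "(\<integral>x. h x \<partial>G) = (\<integral>x. (\<Sum>b\<in>J. h x * p b x) \<partial>G)"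
  proof (rule integral_cong_AE)
    have [measurable]: "h \<in> borel_measurable G" using invariantD[OF h] by simp
    show "h \<in> borel_measurable G" "(\<lambda>x. \<Sum>b\<in>J. h x * p b x) \<in> borel_measurable G" by measurable
    show "AE x in G. h x = (\<Sum>b\<in>J. h x * p b x)"
      using AE_sum_p by eventually_elim (simp flip: sum_distrib_left)
  qed
  also have "\<dots> = (\<Sum>b\<in>J. \<integral>x. h x * p b x \<partial>G)"
    by (rule Bochner_Integration.integral_sum) (rule integrable_invariant_p[OF h])
  also have "\<dots> = (\<Sum>b\<in>J. \<integral>x. h x * p a x \<partial>G)"
    by (intro sum.cong refl integral_invariant_p_swap[OF h _ a])
  finally have "(\<integral>x. h x \<partial>G) = k * (\<integral>x. h x * p a x \<partial>G)" by simp
  moreover have "k \<noteq> 0" using a fin_J by auto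
  ultimately show ?thesis by simp
qed

lemma integrable_p2: "a \<in> J \<Longrightarrow> b \<in> J \<Longrightarrow> integrable G (\<lambda>x. p a x * p b x)"
  by (rule integrable_bounded[where B = 1]) (auto simp: abs_mult intro!: mult_le_one abs_p)

text \<open>The reflection along \<open>e_b\<close> flips the sign of \<open>z b\<close> and keeps
  \<open>z a\<close> and \<open>R\<close>, so the integral equals its negative.\<close>

lemma integral_odd:
  assumes ab: "a \<in> J" "b \<in> J" "a \<noteq> b"
  shows "(\<integral>x. (z a x) ^ 3 * z b x / (R x)\<^sup>2 \<partial>G) = 0"
proof -
  define c where "c e = (of_bool (e = b) :: real)" for e
  have c: "(\<Sum>a\<in>J. (c a)\<^sup>2) = 1"
    by (subst sum_of_two[OF fin_J ab]) (use ab in \<open>auto simp: c_def\<close>)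
  have za: "z a (reflection I (comb c) x) = z a x" for x
    unfolding z_reflection[OF ab(1)]
    by (subst reflection_two[OF ab]) (use ab in \<open>auto simp: c_def\<close>)
  have zb: "z b (reflection I (comb c) x) = - z b x" for x
    unfolding z_reflection[OF ab(2)]
    by (subst reflection_two[OF ab]) (use ab in \<open>auto simp: c_def\<close>)
  have "(\<integral>x. (z a (reflection I (comb c) x)) ^ 3 * z b (reflection I (comb c) x)
      / (R (reflection I (comb c) x))\<^sup>2 \<partial>G) = (\<integral>x. (z a x) ^ 3 * z b x / (R x)\<^sup>2 \<partial>G)"
    by (rule integral_reflection[OF c]) measurable
  then show ?thesis by (simp add: za zb R_reflection[OF c])
qed

lemma integrable_odd:
  assumes ab: "a \<in> J" "b \<in> J"
  shows "integrable G (\<lambda>x. (z a x) ^ 3 * z b x / (R x)\<^sup>2)"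
proof (rule integrable_bounded[where B = 1])
  show "\<bar>(z a x) ^ 3 * z b x / (R x)\<^sup>2\<bar> \<le> 1" for x
  proof -
    \<comment> \<open>The inequality between arithmetic and geometric mean bounds
      \<open>\<bar>z a x * z b x\<bar> / R x\<close> by the mean of \<open>p a x\<close> and
      \<open>p b x\<close>, hence by 1.\<close>
    have "2 * \<bar>z a x * z b x\<bar> \<le> (z a x)\<^sup>2 + (z b x)\<^sup>2"
      using sum_squares_bound[of "\<bar>z a x\<bar>" "\<bar>z b x\<bar>"] by (simp add: abs_mult)
    moreover have "R x \<ge> 0" by (simp add: R_def sum_nonneg)
    ultimately have "2 * (\<bar>z a x * z b x\<bar> / R x) \<le> p a x + p b x"
      unfolding p_def by (simp add: divide_right_mono flip: add_divide_distrib)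
    then have "\<bar>z a x * z b x\<bar> / R x \<le> 1" using p_le_1[of a x] p_le_1[of b x] ab by simp
    moreover have "\<bar>(z a x) ^ 3 * z b x / (R x)\<^sup>2\<bar> = p a x * (\<bar>z a x * z b x\<bar> / R x)"
      by (simp add: p_def abs_mult power2_eq_square power3_eq_cube)
    ultimately show ?thesis
      using mult_le_one[OF p_le_1[of a x], of "\<bar>z a x * z b x\<bar> / R x"] ab \<open>R x \<ge> 0\<close> by simp
  qed
qed measurable

text \<open>Invariance of the mixed moment under the reflection along \<open>(3/5, 4/5)\<close> in the plane of \<open>a\<close>
  and \<open>b\<close> ties it to the pure fourth moments.\<close>
lemma integral_p2_pure:
  assumes ab: "a \<in> J" "b \<in> J" "a \<noteq> b"
  shows "(\<integral>x. p a x * p a x \<partial>G) + (\<integral>x. p b x * p b x \<partial>G) = 6 * (\<integral>x. p a x * p b x \<partial>G)"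
proof -
  \<comment> \<open>The Pythagorean triple (3, 4, 5) gives a unit vector with rational entries, and
    the reflected coordinates get the coefficients 7/25 and 24/25.\<close>
  define c where "c e = (if e = a then 3 / 5 else if e = b then 4 / 5 else 0 :: real)" for e
  have c: "(\<Sum>a\<in>J. (c a)\<^sup>2) = 1"
    by (subst sum_of_two[OF fin_J ab]) (use ab in \<open>auto simp: c_def power_divide\<close>)
  have za: "z a (reflection I (comb c) x) = 7/25 * z a x - 24/25 * z b x" for x
    unfolding z_reflection[OF ab(1)]
    by (subst reflection_two[OF ab]) (use ab in \<open>auto simp: c_def field_simps\<close>)
  have zb: "z b (reflection I (comb c) x) = - 24/25 * z a x - 7/25 * z b x" for x
    unfolding z_reflection[OF ab(2)]
    by (subst reflection_two[OF ab]) (use ab in \<open>auto simp: c_def field_simps\<close>)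
  let ?o = "\<lambda>a b x. (z a x) ^ 3 * z b x / (R x)\<^sup>2"
  \<comment> \<open>The product under the squares is
    \<open>(168 s^2 - 527 s t - 168 t^2) / 625\<close> up to sign, with \<open>168 = 7 * 24\<close>
    and \<open>527 = 24^2 - 7^2\<close>. Squaring gives \<open>28224 = 168^2\<close>,
    \<open>221281 = 527^2 - 2 * 168^2\<close> and \<open>177072 = 2 * 168 * 527\<close>.\<close>
  have alg: "(7/25 * s - 24/25 * t)\<^sup>2 * (- 24/25 * s - 7/25 * t)\<^sup>2 = 
      (28224 * (s\<^sup>2 * s\<^sup>2) + 28224 * (t\<^sup>2 * t\<^sup>2) + 221281 * (s\<^sup>2 * t\<^sup>2) - 177072 * (s ^ 3 * t) + 177072 * (t ^ 3 * s)) / 390625"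
    for s t :: real
    by (simp add: power2_eq_square power3_eq_cube field_simps)
  have pp: "p a (reflection I (comb c) x) * p b (reflection I (comb c) x)
      = 28224 / 390625 * (p a x * p a x) + 28224 / 390625 * (p b x * p b x)
        + 221281 / 390625 * (p a x * p b x) - 177072 / 390625 * ?o a b x + 177072 / 390625 * ?o b a x" for x
    unfolding p_def R_reflection[OF c] za zb times_divide_times_eq alg
    by (simp add: add_divide_distrib diff_divide_distrib power2_eq_square)
  have "(\<integral>x. p a x * p b x \<partial>G) = (\<integral>x. p a (reflection I (comb c) x) * p b (reflection I (comb c) x) \<partial>G)"
    by (rule integral_reflection[OF c, symmetric]) measurable
  also have "\<dots> = 28224 / 390625 * (\<integral>x. p a x * p a x \<partial>G) + 28224 / 390625 * (\<integral>x. p b x * p b x \<partial>G)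
        + 221281 / 390625 * (\<integral>x. p a x * p b x \<partial>G) - 177072 / 390625 * (\<integral>x. ?o a b x \<partial>G)
        + 177072 / 390625 * (\<integral>x. ?o b a x \<partial>G)"
    unfolding pp using ab
    by (simp only: Bochner_Integration.integral_add Bochner_Integration.integral_diff integral_mult_right_zero
        Bochner_Integration.integrable_add Bochner_Integration.integrable_diff
        Bochner_Integration.integrable_mult_right integrable_p2 integrable_odd)
  \<comment> \<open>The odd terms vanish, and \<open>390625 - 221281 = 6 * 28224\<close>.\<close>
  finally show ?thesis using integral_odd[OF ab] integral_odd[OF ab(2,1)] ab(3) by simp
qed

text \<open>The matrix of second moments has a constant diagonal, off-diagonal entries equal to a
  third of it, and row sums \<open>1 / k\<close>. Hence
  \<open>M a a * (1 + (k - 1) / 3) = 1 / k\<close>. These are the moments of the Dirichlet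
  distribution with all parameters 1/2.\<close>

lemma integral_p2:
  assumes ab: "a \<in> J" "b \<in> J"
  shows "(\<integral>x. p a x * p b x \<partial>G) = (1 + 2 * of_bool (a = b)) / (k * (k + 2))"
proof -
  define M where "M a b = (\<integral>x. p a x * p b x \<partial>G)" for a b
  have k: "k > 0" using ab fin_J by (auto simp: card_gt_0_iff)
  have row: "(\<Sum>b\<in>J. M a b) = 1 / k" if a: "a \<in> J" for a
  proof -
    have "(\<Sum>b\<in>J. M a b) = (\<integral>x. (\<Sum>b\<in>J. p a x * p b x) \<partial>G)"
      unfolding M_def by (rule Bochner_Integration.integral_sum[symmetric]) (rule integrable_p2[OF a])
    also have "\<dots> = (\<integral>x. p a x \<partial>G)"
    proof (rule integral_cong_AE)
      show "AE x in G. (\<Sum>b\<in>J. p a x * p b x) = p a x"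
        using AE_sum_p by eventually_elim (simp flip: sum_distrib_left)
    qed measurable
    also have "\<dots> = 1 / k"
      using integral_invariant_p[of "\<lambda>_. 1", OF _ a] by (auto simp: invariant_def G.prob_space)
    finally show ?thesis .
  qed
  have off: "M a' b' = M a a / 3" if "a' \<in> J" "b' \<in> J" "a' \<noteq> b'" for a' b'
  proof -
    have d: "M e e = M a a" if "e \<in> J" for e
    proof (cases "e = a")
      case False
      define c where "c e' = (if e' = a then 1 / sqrt 2 else if e' = e then - 1 / sqrt 2 else 0)" for e'
      have c: "(\<Sum>a\<in>J. (c a)\<^sup>2) = 1"
        by (subst sum_of_two[OF fin_J ab(1) that]) (use False in \<open>auto simp: c_def power_divide\<close>)
      have z: "z e (reflection I (comb c) x) = z a x" for x
        unfolding z_reflection[OF that]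
        by (subst reflection_two[OF ab(1) that]) (use False in \<open>auto simp: c_def field_simps\<close>)
      have "(\<integral>x. p e (reflection I (comb c) x) * p e (reflection I (comb c) x) \<partial>G) = (\<integral>x. p e x * p e x \<partial>G)"
        by (rule integral_reflection[OF c]) measurable
      then show ?thesis by (simp add: M_def p_def z R_reflection[OF c])
    qed simp
    show ?thesis using integral_p2_pure[OF that] d[OF that(1)] d[OF that(2)]
      unfolding M_def by simp
  qed
  have "1 / k = (\<Sum>b\<in>J. if b = a then M a a else M a a / 3)"
    unfolding row[OF ab(1), symmetric] using ab off by (intro sum.cong) auto
  also have "\<dots> = M a a + (k - 1) * M a a / 3"
    using ab fin_J k by (subst sum.remove[OF fin_J ab(1)])
      (simp add: sum.If_cases card_Diff_singleton of_nat_diff card_gt_0_iff Suc_leI)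
  finally have "M a a * (k * (k + 2)) = 3" using k by (simp add: field_simps)
  then have "M a a = 3 / (k * (k + 2))" using k by (subst eq_divide_eq) auto
  then show ?thesis using off[OF ab] ab unfolding M_def by auto
qed

text \<open>The Rayleigh quotient, at the projected Gaussian vector, of the form that is diagonal
  along \<open>u\<close> with eigenvalues \<open>l\<close>.\<close>

definition s :: "('a \<Rightarrow> real) \<Rightarrow> ('i \<Rightarrow> real) \<Rightarrow> real" where
  "s l x = (\<Sum>a\<in>J. l a * (z a x)\<^sup>2) / R x"

lemma s_eq: "s l x = (\<Sum>a\<in>J. l a * p a x)"
  by (simp add: s_def p_def sum_divide_distrib)

lemma measurable_s[measurable]: "s l \<in> borel_measurable G"
  unfolding s_def[abs_def] by measurable

lemma abs_s: "\<bar>s l x\<bar> \<le> (\<Sum>a\<in>J. \<bar>l a\<bar>)"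
  unfolding s_eq using abs_p
  by (intro order_trans[OF sum_abs] sum_mono) (simp add: abs_mult mult_left_le)

text \<open>States that \<open>s l\<close> is uncorrelated with every invariant function; applied
  with \<open>h\<close> depending on one column and \<open>s l\<close> on another, it removes the
  cross terms of the variance.\<close>

lemma integral_invariant_s:
  assumes h: "invariant h"
  shows "(\<integral>x. h x * s l x \<partial>G) = (\<integral>x. h x \<partial>G) * ((\<Sum>a\<in>J. l a) / k)"
proof -
  have "(\<integral>x. h x * s l x \<partial>G) = (\<integral>x. (\<Sum>a\<in>J. l a * (h x * p a x)) \<partial>G)"
    unfolding s_eq sum_distrib_left by (simp add: mult_ac)
  also have "\<dots> = (\<Sum>a\<in>J. l a * (\<integral>x. h x * p a x \<partial>G))"
    by (subst Bochner_Integration.integral_sum) (auto intro: integrable_invariant_p[OF h])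
  also have "\<dots> = (\<Sum>a\<in>J. l a * ((\<integral>x. h x \<partial>G) / k))"
    by (intro sum.cong) (auto simp: integral_invariant_p[OF h])
  finally show ?thesis by (simp add: sum_distrib_left sum_divide_distrib mult_ac)
qed

lemma integral_s: "(\<integral>x. s l x \<partial>G) = (\<Sum>a\<in>J. l a) / k"
  using integral_invariant_s[of "\<lambda>_. 1"] by (auto simp: invariant_def G.prob_space)

lemma integral_s_square:
  "(\<integral>x. (s l x)\<^sup>2 \<partial>G) = ((\<Sum>a\<in>J. l a)\<^sup>2 + 2 * (\<Sum>a\<in>J. (l a)\<^sup>2)) / (k * (k + 2))"
proof -
  have "(\<integral>x. (s l x)\<^sup>2 \<partial>G) = (\<integral>x. (\<Sum>a\<in>J. \<Sum>b\<in>J. l a * l b * (p a x * p b x)) \<partial>G)"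
    unfolding s_eq power2_eq_square sum_product by (simp add: mult_ac)
  also have "\<dots> = (\<Sum>a\<in>J. \<Sum>b\<in>J. l a * l b * (\<integral>x. p a x * p b x \<partial>G))"
    by (subst Bochner_Integration.integral_sum, (auto intro!: integrable_p2)[1],
        rule sum.cong[OF refl], subst Bochner_Integration.integral_sum) (auto intro!: integrable_p2)
  also have "\<dots> = (\<Sum>a\<in>J. \<Sum>b\<in>J. (l a * l b + (if a = b then 2 * (l a * l b) else 0)) / (k * (k + 2)))"
    by (intro sum.cong refl) (auto simp: integral_p2 field_simps)
  also have "\<dots> = ((\<Sum>a\<in>J. l a)\<^sup>2 + 2 * (\<Sum>a\<in>J. (l a)\<^sup>2)) / (k * (k + 2))"
  proof -
    have "(\<Sum>a\<in>J. \<Sum>b\<in>J. l a * l b) = (\<Sum>a\<in>J. l a)\<^sup>2"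
      unfolding power2_eq_square sum_product ..
    moreover have "(\<Sum>a\<in>J. \<Sum>b\<in>J. if a = b then 2 * (l a * l b) else 0) = 2 * (\<Sum>a\<in>J. (l a)\<^sup>2)"
      using fin_J by (simp add: sum_distrib_left power2_eq_square)
    ultimately show ?thesis by (simp add: sum.distrib flip: sum_divide_distrib)
  qed
  finally show ?thesis .
qed

lemma integral_s_variance:
  assumes "J \<noteq> {}"
  shows "(\<integral>x. (s l x - (\<Sum>a\<in>J. l a) / k)\<^sup>2 \<partial>G)
    = 2 / (k * (k + 2)) * ((\<Sum>a\<in>J. (l a)\<^sup>2) - (\<Sum>a\<in>J. l a)\<^sup>2 / k)"
proof -
  have k: "k > 0" using assms fin_J by (simp add: card_gt_0_iff)
  have i: "integrable G (s l)" by (rule integrable_bounded[OF measurable_s abs_s])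
  have "integrable G (\<lambda>x. (s l x)\<^sup>2)"
    by (rule integrable_bounded[where B = "(\<Sum>a\<in>J. \<bar>l a\<bar>)\<^sup>2"])
      (auto simp: power2_le_iff_abs_le sum_nonneg abs_s)
  then have "(\<integral>x. (s l x - (\<Sum>a\<in>J. l a) / k)\<^sup>2 \<partial>G) = (\<integral>x. (s l x)\<^sup>2 \<partial>G) - ((\<Sum>a\<in>J. l a) / k)\<^sup>2"
    using G.variance_eq[OF i] by (simp add: integral_s)
  also have "\<dots> = 2 / (k * (k + 2)) * ((\<Sum>a\<in>J. (l a)\<^sup>2) - (\<Sum>a\<in>J. l a)\<^sup>2 / k)"
  proof -
    have "(A\<^sup>2 + 2 * B) / (k * (k + 2)) - (A / k)\<^sup>2 = 2 / (k * (k + 2)) * (B - A\<^sup>2 / k)" for A B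
    proof -
      have "k \<noteq> 0" "k + 2 \<noteq> 0" using k by linarith+
      then show ?thesis by (simp add: divide_simps power_divide) (simp add: algebra_simps power2_eq_square)
    qed
    then show ?thesis unfolding integral_s_square .
  qed
  finally show ?thesis .
qed

end

text \<open>Every column is its own instance of \<open>gauss_coords\<close> over the common index
  set of all matrix entries: \<open>u i a\<close> is column \<open>a\<close> of \<open>U\<close>
  placed in column \<open>i\<close> and padded with zeros. All instances thus share one measure, and
  the products of deviations can be integrated directly.\<close>

lemma gauss_columns_moments:
  fixes U :: "real mat" and l :: "nat \<Rightarrow> real" and d m :: nat and J :: "nat set"
  defines "z \<equiv> \<lambda>i a w. \<Sum>j<d. U $$ (j, a) * w (j, i)"
  defines "s \<equiv> \<lambda>i w. (\<Sum>a\<in>J. l a * (z i a w)\<^sup>2) / (\<Sum>a\<in>J. (z i a w)\<^sup>2)"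
  defines "\<mu> \<equiv> (\<Sum>a\<in>J. l a) / real (card J)"
  assumes U: "\<And>a b. a < d \<Longrightarrow> b < d \<Longrightarrow> (\<Sum>j<d. U $$ (j, a) * U $$ (j, b)) = of_bool (a = b)"
    and J: "J \<subseteq> {..<d}" "J \<noteq> {}"
    and nz: "\<And>i. i < m \<Longrightarrow> AE w in gauss_entries d m. (\<Sum>a\<in>J. (z i a w)\<^sup>2) \<noteq> 0"
  shows "\<And>i. i < m \<Longrightarrow> integrable (gauss_entries d m) (s i)"
    and "\<And>i. i < m \<Longrightarrow> (\<integral>w. s i w \<partial>gauss_entries d m) = \<mu>"
    and "integrable (gauss_entries d m) (\<lambda>w. (\<Sum>i<m. s i w - \<mu>)\<^sup>2)"
    and "(\<integral>w. (\<Sum>i<m. s i w - \<mu>)\<^sup>2 \<partial>gauss_entries d m) = real m *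
      (2 / (real (card J) * (real (card J) + 2)) * ((\<Sum>a\<in>J. (l a)\<^sup>2) - (\<Sum>a\<in>J. l a)\<^sup>2 / real (card J)))"
proof -
  define I :: "(nat \<times> nat) set" where "I = {..<d} \<times> {..<m}"
  define u where "u i a = (\<lambda>(j, i'). if j < d \<and> i' = i then U $$ (j, a) else 0)" for i a :: nat
  let ?G = "gauss_entries d m"
  have fJ: "finite J" using J finite_subset by blast
  have sum_u: "(\<Sum>x\<in>I. u i a x * g x) = (\<Sum>j<d. U $$ (j, a) * g (j, i))" if "i < m" for i a and g :: "nat \<times> nat \<Rightarrow> real"
  proof -
    have "(\<Sum>x\<in>I. u i a x * g x) = (\<Sum>j<d. \<Sum>i'<m. if i' = i then U $$ (j, a) * g (j, i) else 0)"
      unfolding I_def sum.cartesian_product by (intro sum.cong) (auto simp: u_def)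
    also have "\<dots> = (\<Sum>j<d. U $$ (j, a) * g (j, i))" using that by simp
    finally show ?thesis .
  qed
  have loc: "gauss_coords I J (u i)" if i: "i < m" for i
  proof
    show "finite I" by (simp add: I_def)
    show "finite J" by (rule fJ)
    show "u i a x = 0" if "a \<in> J" "x \<notin> I" for a x using that i by (auto simp: u_def I_def split: prod.splits)
    show "(\<Sum>x\<in>I. u i a x * u i b x) = of_bool (a = b)" if "a \<in> J" "b \<in> J" for a b
      unfolding sum_u[OF i] using U[of a b] J(1) that by (auto simp: u_def subset_iff)
    show "AE x in PiM I (\<lambda>_. std_gauss). (\<Sum>a\<in>J. (\<Sum>i'\<in>I. u i a i' * x i')\<^sup>2) \<noteq> 0"
      unfolding sum_u[OF i] using nz[OF i] unfolding z_def gauss_entries_def I_def[symmetric] .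
  qed
  have G: "gauss_coords.G I = ?G" if "i < m" for i
    using gauss_coords.G_def[OF loc[OF that]] unfolding gauss_entries_def I_def[symmetric] .
  have z_eq: "gauss_coords.z I (u i) a w = z i a w" if "i < m" for i a w
    unfolding gauss_coords.z_def[OF loc[OF that]] sum_u[OF that] z_def ..
  have s_eq: "gauss_coords.s I J (u i) l = s i" if "i < m" for i
    unfolding gauss_coords.s_def[OF loc[OF that]] gauss_coords.R_def[OF loc[OF that]] z_eq[OF that] s_def fun_eq_iff by simp
  have s_meas: "s i \<in> borel_measurable ?G" if "i < m" for i
    using gauss_coords.measurable_s[OF loc[OF that], of l] unfolding s_eq[OF that] G[OF that] .
  define B where "B = (\<Sum>a\<in>J. \<bar>l a\<bar>)"
  have s_bound: "\<bar>s i w\<bar> \<le> B" if "i < m" for i w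
    using gauss_coords.abs_s[OF loc[OF that], of l] unfolding s_eq[OF that] B_def .
  interpret G: prob_space ?G
    unfolding gauss_entries_def by (intro prob_space_PiM prob_space_std_gauss)
  show s_int: "integrable ?G (s i)" if "i < m" for i
    by (rule G.integrable_const_bound[where B = B]) (use s_bound[OF that] s_meas[OF that] in auto)
  show s_mean: "(\<integral>w. s i w \<partial>?G) = \<mu>" if "i < m" for i
    using gauss_coords.integral_s[OF loc[OF that], of l] unfolding s_eq[OF that] G[OF that] \<mu>_def .
  have prod_bound: "\<bar>(s i w - \<mu>) * (s i' w - \<mu>)\<bar> \<le> (B + \<bar>\<mu>\<bar>) * (B + \<bar>\<mu>\<bar>)" if "i < m" "i' < m" for i i' w
    unfolding abs_mult using s_bound[OF that(1), of w] s_bound[OF that(2), of w]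
    by (intro mult_mono) (auto intro: order_trans[OF abs_ge_zero])
  have prod_int: "integrable ?G (\<lambda>w. (s i w - \<mu>) * (s i' w - \<mu>))" if "i < m" "i' < m" for i i'
    by (rule G.integrable_const_bound[where B = "(B + \<bar>\<mu>\<bar>) * (B + \<bar>\<mu>\<bar>)"])
      (use prod_bound[OF that] s_meas that in auto)
  \<comment> \<open>A reflection inside column \<open>i'\<close> does not move column
    \<open>i\<close>, so \<open>s i - \<mu>\<close> is invariant for the instance of
    \<open>i'\<close>; as its mean is zero, the mixed integral vanishes.\<close>
  have cross: "(\<integral>w. (s i w - \<mu>) * (s i' w - \<mu>) \<partial>?G) = 0" if "i < m" "i' < m" "i \<noteq> i'" for i i'
  proof -
    interpret C: gauss_coords I J "u i'" by (rule loc[OF that(2)])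
    have comb0: "C.comb c (j, i) = 0" for c j
      using that by (auto simp: C.comb_def u_def intro!: sum.neutral)
    have "C.invariant (\<lambda>w. s i w - \<mu>)"
      unfolding C.invariant_def
    proof (intro conjI allI exI)
      show "(\<lambda>w. s i w - \<mu>) \<in> borel_measurable C.G" unfolding G[OF that(1)] using s_meas[OF that(1)] by measurable
      show "\<bar>s i w - \<mu>\<bar> \<le> B + \<bar>\<mu>\<bar>" for w using s_bound[OF that(1), of w] by linarith
      show "s i (reflection I (C.comb c) w) - \<mu> = s i w - \<mu>" for c w
        by (simp add: s_def z_def reflection_def comb0)
    qed
    from C.integral_invariant_s[OF this, of l]
    have "(\<integral>w. (s i w - \<mu>) * s i' w \<partial>?G) = (\<integral>w. s i w - \<mu> \<partial>?G) * \<mu>"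
      unfolding G[OF that(1)] s_eq[OF that(2)] \<mu>_def .
    moreover have "(\<integral>w. s i w - \<mu> \<partial>?G) = 0"
      using s_int[OF that(1)] s_mean[OF that(1)] by (simp add: G.prob_space)
    moreover have "(\<integral>w. (s i w - \<mu>) * (s i' w - \<mu>) \<partial>?G)
        = (\<integral>w. (s i w - \<mu>) * s i' w \<partial>?G) - (\<integral>w. (s i w - \<mu>) * \<mu> \<partial>?G)"
    proof -
      have "integrable ?G (\<lambda>w. (s i w - \<mu>) * \<mu>)" using s_int[OF that(1)] by auto
      then have "integrable ?G (\<lambda>w. (s i w - \<mu>) * (s i' w - \<mu>) + (s i w - \<mu>) * \<mu>)"
        by (intro Bochner_Integration.integrable_add prod_int that)
      then have "integrable ?G (\<lambda>w. (s i w - \<mu>) * s i' w)" by (simp add: algebra_simps)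
      with \<open>integrable ?G (\<lambda>w. (s i w - \<mu>) * \<mu>)\<close> show ?thesis
        by (subst Bochner_Integration.integral_diff[symmetric]) (auto simp: right_diff_distrib)
    qed
    ultimately show ?thesis by simp
  qed
  have diag: "(\<integral>w. (s i w - \<mu>) * (s i w - \<mu>) \<partial>?G)
      = 2 / (real (card J) * (real (card J) + 2)) * ((\<Sum>a\<in>J. (l a)\<^sup>2) - (\<Sum>a\<in>J. l a)\<^sup>2 / real (card J))" if "i < m" for i
    using gauss_coords.integral_s_variance[OF loc[OF that] J(2), of l]
    unfolding s_eq[OF that] G[OF that] \<mu>_def power2_eq_square .
  have expand: "(\<Sum>i<m. s i w - \<mu>)\<^sup>2 = (\<Sum>i<m. \<Sum>i'<m. (s i w - \<mu>) * (s i' w - \<mu>))" for w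
    unfolding power2_eq_square sum_product ..
  show "integrable ?G (\<lambda>w. (\<Sum>i<m. s i w - \<mu>)\<^sup>2)"
    unfolding expand by (intro Bochner_Integration.integrable_sum prod_int) auto
  let ?V = "2 / (real (card J) * (real (card J) + 2)) * ((\<Sum>a\<in>J. (l a)\<^sup>2) - (\<Sum>a\<in>J. l a)\<^sup>2 / real (card J))"
  have "(\<integral>w. (\<Sum>i<m. s i w - \<mu>)\<^sup>2 \<partial>?G) = (\<Sum>i<m. \<Sum>i'<m. \<integral>w. (s i w - \<mu>) * (s i' w - \<mu>) \<partial>?G)"
    unfolding expand
    by (subst Bochner_Integration.integral_sum, (auto intro!: prod_int)[1],
        rule sum.cong[OF refl], subst Bochner_Integration.integral_sum) (auto intro!: prod_int)
  also have "\<dots> = (\<Sum>i<m. \<Sum>i'<m. if i = i' then ?V else 0)"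
    by (intro sum.cong refl) (use cross diag in auto)
  also have "\<dots> = real m * ?V" by simp
  finally show "(\<integral>w. (\<Sum>i<m. s i w - \<mu>)\<^sup>2 \<partial>?G) = real m * ?V" .
qed

section \<open>Approximation error under a completed product measure\<close>

text \<open>Off a null set \<open>g\<close> agrees with a function measurable for the product, and
  almost every section of a null set is null. A section of \<open>g\<close> itself may fail to be
  measurable, which is why a version \<open>g'\<close> of it appears in the conclusion.\<close>

lemma integrable_completion_Fubini:
  fixes g :: "'a \<times> 'b \<Rightarrow> real"
  assumes M: "prob_space M1" "prob_space M2" and g: "integrable (completion (M1 \<Otimes>\<^sub>M M2)) g"
  obtains h where "integrable M1 h" "(\<integral>x. h x \<partial>M1) = (\<integral>w. g w \<partial>completion (M1 \<Otimes>\<^sub>M M2))"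
    "AE x in M1. \<exists>g'. integrable M2 g' \<and> (AE y in M2. g (x, y) = g' y) \<and> h x = (\<integral>y. g' y \<partial>M2)"
proof -
  interpret M1: prob_space M1 by fact
  interpret M2: prob_space M2 by fact
  interpret pair_sigma_finite M1 M2 ..
  let ?P = "M1 \<Otimes>\<^sub>M M2"
  obtain g' where g'[measurable]: "g' \<in> borel_measurable ?P" and ae: "AE w in ?P. g w = g' w"
    using completion_ex_borel_measurable_real[of g ?P] g by blast
  have aeC: "AE w in completion ?P. g w = g' w" by (rule AE_completion[OF ae])
  have g'C: "g' \<in> borel_measurable (completion ?P)" by (rule measurable_completion[OF g'])
  have "integrable (completion ?P) g'" using integrable_cong_AE_imp[OF g g'C] aeC by auto
  then have i: "integrable ?P g'" using integrable_completion[OF g'] by simp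
  show ?thesis
  proof
    show "integrable M1 (\<lambda>x. \<integral>y. g' (x, y) \<partial>M2)" by (rule integrable_fst'[OF i])
    have "(\<integral>x. \<integral>y. g' (x, y) \<partial>M2 \<partial>M1) = (\<integral>w. g' w \<partial>?P)" by (rule integral_fst'[OF i])
    also have "\<dots> = (\<integral>w. g' w \<partial>completion ?P)" by (rule integral_completion[OF g', symmetric])
    also have "\<dots> = (\<integral>w. g w \<partial>completion ?P)"
      using g g'C aeC by (intro integral_cong_AE) auto
    finally show "(\<integral>x. \<integral>y. g' (x, y) \<partial>M2 \<partial>M1) = (\<integral>w. g w \<partial>completion ?P)" .
    show "AE x in M1. \<exists>g''. integrable M2 g'' \<and> (AE y in M2. g (x, y) = g'' y) \<and> (\<integral>y. g' (x, y) \<partial>M2) = (\<integral>y. g'' y \<partial>M2)"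
      using AE_integrable_fst'[OF i] AE_pair[OF ae] by eventually_elim auto
  qed
qed

lemma square_add_le:
  fixes x y \<tau> :: real
  assumes "\<tau> > 0"
  shows "(x + y)\<^sup>2 \<le> (1 + \<tau>) * x\<^sup>2 + (1 + 1 / \<tau>) * y\<^sup>2"
proof -
  have "0 \<le> (\<tau> * x - y)\<^sup>2 / \<tau>" using assms by simp
  also have "\<dots> = \<tau> * x\<^sup>2 - 2 * x * y + y\<^sup>2 / \<tau>"
    using assms by (simp add: power2_eq_square field_simps)
  finally show ?thesis by (simp add: power2_eq_square algebra_simps)
qed

text \<open>The right-hand side is least at \<open>\<tau> = sqrt W / sqrt V\<close>, where it equals
  the claimed bound. If \<open>V\<close> or \<open>W\<close> is zero, this choice degenerates and
  \<open>\<tau>\<close> is sent to infinity or to zero instead.\<close>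

lemma weighted_sum_infimum:
  fixes a V W :: real
  assumes V: "V \<ge> 0" and W: "W \<ge> 0" and le: "\<And>\<tau>. \<tau> > 0 \<Longrightarrow> a \<le> (1 + \<tau>) * V + (1 + 1 / \<tau>) * W"
  shows "a \<le> (sqrt V + sqrt W)\<^sup>2"
proof (cases "V > 0 \<and> W > 0")
  case True
  let ?\<tau> = "sqrt W / sqrt V"
  have "a \<le> (1 + ?\<tau>) * V + (1 + 1 / ?\<tau>) * W" by (rule le) (use True in simp)
  also have "\<dots> = V + W + 2 * sqrt V * sqrt W"
  proof -
    have "?\<tau> * V = sqrt V * sqrt W" "1 / ?\<tau> * W = sqrt V * sqrt W"
      using True real_sqrt_mult_self[of V] real_sqrt_mult_self[of W] by (simp_all add: field_simps)
    then show ?thesis by (simp add: algebra_simps)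
  qed
  also have "\<dots> = (sqrt V + sqrt W)\<^sup>2" using V W by (simp add: power2_sum)
  finally show ?thesis .
next
  case False
  have "a \<le> V + W"
  proof (rule field_le_epsilon)
    fix e :: real assume e: "e > 0"
    show "a \<le> V + W + e"
    proof (cases "V = 0")
      case True
      \<comment> \<open>With \<open>\<tau> = (W + 1) / e\<close> the surplus is
        \<open>e * W / (W + 1)\<close>, at most \<open>e\<close>; the added 1 keeps
        \<open>\<tau>\<close> positive when \<open>W\<close> is zero.\<close>
      have "a \<le> W + 1 / ((W + 1) / e) * W"
        using le[of "(W + 1) / e"] e W True by (simp add: algebra_simps)
      moreover have "1 / ((W + 1) / e) * W \<le> e"
        using e W by (simp add: divide_le_eq algebra_simps)
      ultimately show ?thesis using True by simp
    next
      case False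
      with \<open>\<not> (V > 0 \<and> W > 0)\<close> V W have "W = 0" by simp
      then have "a \<le> (1 + e / V) * V" using le[of "e / V"] e V False by simp
      also have "\<dots> = V + e" using False by (simp add: algebra_simps)
      finally show ?thesis using \<open>W = 0\<close> by simp
    qed
  qed
  also have "\<dots> = (sqrt V + sqrt W)\<^sup>2" using False V W by (auto simp: power2_sum)
  finally show ?thesis .
qed

section \<open>Bias and variance of an estimator with sectionwise approximations\<close>

context
  fixes M1 :: "'a measure" and M2 :: "'b measure" and t D :: "'a \<times> 'b \<Rightarrow> real" and c \<kappa> :: real
  assumes M: "prob_space M1" "prob_space M2" and \<kappa>: "\<kappa> \<ge> 0"
begin

abbreviation completed where "completed \<equiv> completion (M1 \<Otimes>\<^sub>M M2)"

lemma prob_space_S: "prob_space completed"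
proof -
  interpret pair_prob_space M1 M2 using M by (simp add: pair_prob_space_def pair_sigma_finite_def prob_space_imp_sigma_finite)
  show ?thesis by (rule prob_spaceI) (simp add: emeasure_space_1)
qed

text \<open>To be read with \<open>t\<close> the output, \<open>D\<close> the error
  \<open>\<Delta>\<close>, \<open>\<kappa> = d\<close> and \<open>c = tr f(A)\<close>. For almost
  every \<open>x\<close> the mean of the section of \<open>t\<close> is within
  \<open>\<kappa>\<close> times the mean of the section of \<open>D\<close> from the same constant
  \<open>c\<close>, so integrating over \<open>x\<close> finishes.\<close>

lemma mean_error_completion:
  assumes approx: "AE x in M1. \<exists>T. integrable M2 T \<and> (\<integral>y. T y \<partial>M2) = c
      \<and> (AE y in M2. \<bar>t (x, y) - T y\<bar> \<le> \<kappa> * D (x, y))"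
    and t: "integrable completed t" and D: "integrable completed D"
  shows "\<bar>c - (\<integral>w. t w \<partial>completed)\<bar> \<le> \<kappa> * (\<integral>w. D w \<partial>completed)"
proof -
  interpret M1: prob_space M1 by (rule M(1))
  interpret M2: prob_space M2 by (rule M(2))
  obtain ht where ht: "integrable M1 ht" "(\<integral>x. ht x \<partial>M1) = (\<integral>w. t w \<partial>completed)"
    "AE x in M1. \<exists>g'. integrable M2 g' \<and> (AE y in M2. t (x, y) = g' y) \<and> ht x = (\<integral>y. g' y \<partial>M2)"
    using integrable_completion_Fubini[OF M t] by blast
  obtain hD where hD: "integrable M1 hD" "(\<integral>x. hD x \<partial>M1) = (\<integral>w. D w \<partial>completed)"
    "AE x in M1. \<exists>g'. integrable M2 g' \<and> (AE y in M2. D (x, y) = g' y) \<and> hD x = (\<integral>y. g' y \<partial>M2)"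
    using integrable_completion_Fubini[OF M D] by blast
  have "AE x in M1. \<bar>c - ht x\<bar> \<le> \<kappa> * hD x"
    using approx ht(3) hD(3)
  proof eventually_elim
    case (elim x)
    then obtain T t' D' where T: "integrable M2 T" "(\<integral>y. T y \<partial>M2) = c" "AE y in M2. \<bar>t (x, y) - T y\<bar> \<le> \<kappa> * D (x, y)"
      and t': "integrable M2 t'" "AE y in M2. t (x, y) = t' y" "ht x = (\<integral>y. t' y \<partial>M2)"
      and D': "integrable M2 D'" "AE y in M2. D (x, y) = D' y" "hD x = (\<integral>y. D' y \<partial>M2)"
      by blast
    have "\<bar>c - ht x\<bar> = \<bar>\<integral>y. T y - t' y \<partial>M2\<bar>" using T t' by simp
    also have "\<dots> \<le> (\<integral>y. \<bar>T y - t' y\<bar> \<partial>M2)" by (rule integral_abs_bound)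
    also have "\<dots> \<le> (\<integral>y. \<kappa> * D' y \<partial>M2)"
    proof (rule integral_mono_AE)
      show "AE y in M2. \<bar>T y - t' y\<bar> \<le> \<kappa> * D' y"
        using T(3) t'(2) D'(2) by eventually_elim auto
    qed (use T t' D' in auto)
    finally show ?case using D' by simp
  qed
  then have le: "(\<integral>x. \<bar>c - ht x\<bar> \<partial>M1) \<le> (\<integral>x. \<kappa> * hD x \<partial>M1)"
    using ht(1) hD(1) by (intro integral_mono_AE) auto
  have "\<bar>c - (\<integral>w. t w \<partial>completed)\<bar> = \<bar>\<integral>x. c - ht x \<partial>M1\<bar>"
    using ht(1) by (simp add: ht(2) M1.prob_space)
  also have "\<dots> \<le> (\<integral>x. \<bar>c - ht x\<bar> \<partial>M1)" by (rule integral_abs_bound)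
  also note le
  also have "(\<integral>x. \<kappa> * hD x \<partial>M1) = \<kappa> * (\<integral>w. D w \<partial>completed)" by (simp add: hD(2))
  finally show ?thesis .
qed

text \<open>The estimate is made for the second moment about \<open>c\<close>, the center at which
  the sectionwise second moment of \<open>T\<close> is \<open>v x\<close>. The variance does not
  exceed it, being the least second moment about any point.\<close>

lemma variance_completion_le:
  assumes approx: "AE x in M1. \<exists>T. T \<in> borel_measurable M2 \<and> integrable M2 (\<lambda>y. (T y - c)\<^sup>2)
      \<and> (\<integral>y. (T y - c)\<^sup>2 \<partial>M2) = v x \<and> (AE y in M2. \<bar>t (x, y) - T y\<bar> \<le> \<kappa> * D (x, y))"
    and t: "integrable completed t" "integrable completed (\<lambda>w. (t w)\<^sup>2)" and D: "integrable completed (\<lambda>w. (D w)\<^sup>2)"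
    and v: "integrable completed (\<lambda>w. v (fst w))"
  shows "(\<integral>w. (t w - (\<integral>w. t w \<partial>completed))\<^sup>2 \<partial>completed) \<le> (sqrt (\<integral>w. v (fst w) \<partial>completed) + \<kappa> * sqrt (\<integral>w. (D w)\<^sup>2 \<partial>completed))\<^sup>2"
proof -
  interpret M1: prob_space M1 by (rule M(1))
  interpret M2: prob_space M2 by (rule M(2))
  interpret S: prob_space completed by (rule prob_space_S)
  have tc: "integrable completed (\<lambda>w. (t w - c)\<^sup>2)"
    unfolding power2_diff using t by auto
  obtain ht where ht: "integrable M1 ht" "(\<integral>x. ht x \<partial>M1) = (\<integral>w. (t w - c)\<^sup>2 \<partial>completed)"
    "AE x in M1. \<exists>g'. integrable M2 g' \<and> (AE y in M2. (t (x, y) - c)\<^sup>2 = g' y) \<and> ht x = (\<integral>y. g' y \<partial>M2)"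
    using integrable_completion_Fubini[OF M tc] by blast
  obtain hD where hD: "integrable M1 hD" "(\<integral>x. hD x \<partial>M1) = (\<integral>w. (D w)\<^sup>2 \<partial>completed)"
    "AE x in M1. \<exists>g'. integrable M2 g' \<and> (AE y in M2. (D (x, y))\<^sup>2 = g' y) \<and> hD x = (\<integral>y. g' y \<partial>M2)"
    using integrable_completion_Fubini[OF M D] by blast
  obtain hv where hv: "integrable M1 hv" "(\<integral>x. hv x \<partial>M1) = (\<integral>w. v (fst w) \<partial>completed)"
    "AE x in M1. \<exists>g'. integrable M2 g' \<and> (AE y in M2. v (fst (x, y)) = g' y) \<and> hv x = (\<integral>y. g' y \<partial>M2)"
    using integrable_completion_Fubini[OF M v] by blast
  \<comment> \<open>Sections of \<open>v (fst w)\<close> are constant in \<open>y\<close>, so the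
    marginal delivered by Fubini is \<open>v\<close> itself almost everywhere; \<open>hv\<close>
    serves as its integrable version.\<close>
  have hv_eq: "AE x in M1. hv x = v x"
    using hv(3)
  proof eventually_elim
    case (elim x)
    then obtain g' where g': "integrable M2 g'" "AE y in M2. v x = g' y" "hv x = (\<integral>y. g' y \<partial>M2)" by auto
    have "(\<integral>y. v x \<partial>M2) = (\<integral>y. g' y \<partial>M2)" using g' by (intro integral_cong_AE) auto
    then show ?case using g'(3) by (simp add: M2.prob_space)
  qed
  have v0: "AE x in M1. 0 \<le> hv x"
    using approx hv_eq
  proof eventually_elim
    case (elim x)
    then obtain T where "(\<integral>y. (T y - c)\<^sup>2 \<partial>M2) = v x" by blast
    moreover have "0 \<le> (\<integral>y. (T y - c)\<^sup>2 \<partial>M2)" by simp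
    ultimately show ?case using elim by simp
  qed
  have bound: "(\<integral>w. (t w - c)\<^sup>2 \<partial>completed) \<le> (1 + \<tau>) * (\<integral>w. v (fst w) \<partial>completed) + (1 + 1 / \<tau>) * (\<kappa>\<^sup>2 * (\<integral>w. (D w)\<^sup>2 \<partial>completed))"
    if \<tau>: "\<tau> > 0" for \<tau>
  proof -
    have "AE x in M1. ht x \<le> (1 + \<tau>) * hv x + (1 + 1 / \<tau>) * (\<kappa>\<^sup>2 * hD x)"
      using approx ht(3) hD(3) hv_eq
    proof eventually_elim
      case (elim x)
      then obtain T t' D' where T: "T \<in> borel_measurable M2" "integrable M2 (\<lambda>y. (T y - c)\<^sup>2)"
          "(\<integral>y. (T y - c)\<^sup>2 \<partial>M2) = v x" "AE y in M2. \<bar>t (x, y) - T y\<bar> \<le> \<kappa> * D (x, y)"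
        and t': "integrable M2 t'" "AE y in M2. (t (x, y) - c)\<^sup>2 = t' y" "ht x = (\<integral>y. t' y \<partial>M2)"
        and D': "integrable M2 D'" "AE y in M2. (D (x, y))\<^sup>2 = D' y" "hD x = (\<integral>y. D' y \<partial>M2)"
        by blast
      have "(\<integral>y. t' y \<partial>M2) \<le> (\<integral>y. (1 + \<tau>) * (T y - c)\<^sup>2 + (1 + 1 / \<tau>) * (\<kappa>\<^sup>2 * D' y) \<partial>M2)"
      proof (rule integral_mono_AE)
        show "AE y in M2. t' y \<le> (1 + \<tau>) * (T y - c)\<^sup>2 + (1 + 1 / \<tau>) * (\<kappa>\<^sup>2 * D' y)"
          using T(4) t'(2) D'(2)
        proof eventually_elim
          case (elim y)
          have "\<bar>t (x, y) - T y\<bar> \<le> \<bar>\<kappa> * D (x, y)\<bar>" using elim(1) by linarith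
          then have sq: "(t (x, y) - T y)\<^sup>2 \<le> \<kappa>\<^sup>2 * D' y"
            unfolding elim(3)[symmetric] power_mult_distrib[symmetric] by (simp add: abs_le_square_iff)
          have "t' y = ((T y - c) + (t (x, y) - T y))\<^sup>2" using elim(2) by simp
          also have "\<dots> \<le> (1 + \<tau>) * (T y - c)\<^sup>2 + (1 + 1 / \<tau>) * (t (x, y) - T y)\<^sup>2"
            by (rule square_add_le[OF \<tau>])
          also have "\<dots> \<le> (1 + \<tau>) * (T y - c)\<^sup>2 + (1 + 1 / \<tau>) * (\<kappa>\<^sup>2 * D' y)"
            using \<tau> sq by (intro add_left_mono mult_left_mono) auto
          finally show ?case .
        qed
      qed (use T t' D' in auto)
      also have "\<dots> = (1 + \<tau>) * v x + (1 + 1 / \<tau>) * (\<kappa>\<^sup>2 * hD x)"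
        using T(2,3) D'(1,3) by simp
      finally show ?case using t'(3) elim by simp
    qed
    then have "(\<integral>x. ht x \<partial>M1) \<le> (\<integral>x. (1 + \<tau>) * hv x + (1 + 1 / \<tau>) * (\<kappa>\<^sup>2 * hD x) \<partial>M1)"
      using ht(1) hD(1) hv(1) by (intro integral_mono_AE) auto
    also have "\<dots> = (1 + \<tau>) * (\<integral>x. hv x \<partial>M1) + (1 + 1 / \<tau>) * (\<kappa>\<^sup>2 * (\<integral>x. hD x \<partial>M1))"
      using hD(1) hv(1) by simp
    finally show ?thesis unfolding ht(2) hD(2) hv(2) .
  qed
  have V: "0 \<le> (\<integral>w. v (fst w) \<partial>completed)" unfolding hv(2)[symmetric] by (rule integral_nonneg_AE[OF v0])
  have "(\<integral>w. (t w - c)\<^sup>2 \<partial>completed) \<le> (sqrt (\<integral>w. v (fst w) \<partial>completed) + sqrt (\<kappa>\<^sup>2 * (\<integral>w. (D w)\<^sup>2 \<partial>completed)))\<^sup>2"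
    by (rule weighted_sum_infimum[OF V _ bound]) simp
  also have "sqrt (\<kappa>\<^sup>2 * (\<integral>w. (D w)\<^sup>2 \<partial>completed)) = \<kappa> * sqrt (\<integral>w. (D w)\<^sup>2 \<partial>completed)"
    using \<kappa> by (simp add: real_sqrt_mult)
  finally have 1: "(\<integral>w. (t w - c)\<^sup>2 \<partial>completed) \<le> (sqrt (\<integral>w. v (fst w) \<partial>completed) + \<kappa> * sqrt (\<integral>w. (D w)\<^sup>2 \<partial>completed))\<^sup>2" .
  let ?e = "\<integral>w. t w \<partial>completed"
  have "(\<integral>w. (t w - ?e)\<^sup>2 \<partial>completed) = (\<integral>w. (t w)\<^sup>2 \<partial>completed) - ?e\<^sup>2" by (rule S.variance_eq[OF t])
  also have "\<dots> \<le> (\<integral>w. (t w)\<^sup>2 \<partial>completed) - 2 * c * ?e + c\<^sup>2"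
  proof -
    have "0 \<le> (?e - c)\<^sup>2" by simp
    also have "(?e - c)\<^sup>2 = ?e\<^sup>2 - 2 * c * ?e + c\<^sup>2" by (simp add: power2_eq_square algebra_simps)
    finally show ?thesis by linarith
  qed
  also have "\<dots> = (\<integral>w. (t w - c)\<^sup>2 \<partial>completed)"
    unfolding power2_diff using t S.prob_space by (simp del: measure_completion)
  finally show ?thesis using 1 by linarith
qed

end

section \<open>Spectral theorem for real symmetric matrices\<close>

lemma scalar_prod_mat_mult:
  fixes A :: "real mat"
  assumes "A \<in> carrier_mat n m" "x \<in> carrier_vec n" "y \<in> carrier_vec m"
  shows "x \<bullet> (A *\<^sub>v y) = (A\<^sup>T *\<^sub>v x) \<bullet> y"
  using assms by (metis transpose_vec_mult_scalar comm_scalar_prod mult_mat_vec_carrier transpose_carrier_mat)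

text \<open>An eigenvector exists over the complex numbers. Its Hermitian form
  \<open>q = e * r\<close> is self-conjugate by symmetry and \<open>r\<close> is a nonzero real, so
  \<open>e\<close> is real. As a root of the characteristic polynomial it is then also an eigenvalue
  over the reals.\<close>

lemma symmetric_mat_real_eigenvalue:
  fixes A :: "real mat"
  assumes A: "A \<in> carrier_mat n n" and sym: "A\<^sup>T = A" and n: "n \<noteq> 0"
  obtains e where "eigenvalue A e"
proof -
  let ?C = "map_mat complex_of_real A"
  have C: "?C \<in> carrier_mat n n" using A by simp
  from spectrum_non_empty[OF C] n obtain e where e: "eigenvalue ?C e" by (auto simp: spectrum_def)
  then obtain v where v: "v \<in> carrier_vec n" "v \<noteq> 0\<^sub>v n" "?C *\<^sub>v v = e \<cdot>\<^sub>v v"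
    using C by (auto simp: eigenvalue_def eigenvector_def)
  have Aij: "A $$ (i, j) = A $$ (j, i)" if "i < n" "j < n" for i j
    using arg_cong[OF sym, of "\<lambda>M. M $$ (i, j)"] A that by simp
  have vi: "(\<Sum>j<n. complex_of_real (A $$ (i, j)) * v $ j) = e * v $ i" if "i < n" for i
  proof -
    have "(\<Sum>j<n. complex_of_real (A $$ (i, j)) * v $ j) = (?C *\<^sub>v v) $ i"
      using that A v(1) by (simp add: scalar_prod_def atLeast0LessThan)
    then show ?thesis using v that by simp
  qed
  define q where "q = (\<Sum>i<n. \<Sum>j<n. cnj (v $ i) * (complex_of_real (A $$ (i, j)) * v $ j))"
  define r where "r = (\<Sum>i<n. cnj (v $ i) * v $ i)"
  have "q = (\<Sum>i<n. cnj (v $ i) * (e * v $ i))"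
    unfolding q_def sum_distrib_left[symmetric] by (simp add: vi)
  then have q: "q = e * r" unfolding r_def sum_distrib_left by (simp add: mult_ac)
  have "cnj q = (\<Sum>i<n. \<Sum>j<n. v $ i * (complex_of_real (A $$ (i, j)) * cnj (v $ j)))"
    unfolding q_def by simp
  also have "\<dots> = q"
    unfolding q_def by (subst sum.swap, intro sum.cong refl) (simp add: Aij mult_ac)
  finally have cq: "cnj q = q" .
  have r': "r = complex_of_real (\<Sum>i<n. (cmod (v $ i))\<^sup>2)"
    unfolding r_def by (simp add: complex_norm_square mult.commute del: of_real_power)
  have "(\<Sum>i<n. (cmod (v $ i))\<^sup>2) \<noteq> 0"
  proof
    assume "(\<Sum>i<n. (cmod (v $ i))\<^sup>2) = 0"
    then have "\<forall>i<n. v $ i = 0" by (subst (asm) sum_nonneg_eq_0_iff) auto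
    then have "v = 0\<^sub>v n" using v(1) by auto
    with v(2) show False ..
  qed
  then have "r \<noteq> 0" unfolding r' of_real_eq_0_iff .
  have "cnj e * r = e * r" using cq unfolding q r' by simp
  with \<open>r \<noteq> 0\<close> have "cnj e = e" by simp
  from arg_cong[OF this, of Im] have "Im e = 0" by simp
  then obtain x where x: "e = complex_of_real x" using complex_eq_iff[of e "complex_of_real (Re e)"] by auto
  have "poly (char_poly ?C) e = 0" using eigenvalue_root_char_poly[OF C] e by simp
  moreover have "char_poly ?C = map_poly complex_of_real (char_poly A)"
    by (rule of_real_hom.char_poly_hom[OF A])
  ultimately have "poly (char_poly A) x = 0" unfolding x by simp
  then have "eigenvalue A x" using eigenvalue_root_char_poly[OF A] by simp
  then show ?thesis by (rule that)
qed

text \<open>Gram-Schmidt keeps the first vector of a basis that starts with \<open>v\<close>, and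
  normalization only rescales it.\<close>

lemma orthonormal_completion:
  fixes v :: "real vec"
  assumes v: "v \<in> carrier_vec n" "v \<noteq> 0\<^sub>v n"
  obtains U c where "U \<in> carrier_mat n n" "U\<^sup>T * U = 1\<^sub>m n" "col U 0 = c \<cdot>\<^sub>v v"
proof -
  interpret cof_vec_space n "TYPE(real)" .
  have n: "n \<noteq> 0" using v by auto
  note bc = basis_completion[OF v]
  define ws where "ws = gram_schmidt n (basis_completion v)"
  from gram_schmidt_result[OF bc(2,4,5) ws_def]
  have ws: "corthogonal ws" "set ws \<subseteq> carrier_vec n" "length ws = n" using bc(6) by auto
  obtain vs where "basis_completion v = v # vs" using bc(6,7) n by (cases "basis_completion v") auto
  then have hd: "hd ws = v" unfolding ws_def using gram_schmidt_hd[OF v(1), of vs] by simp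
  have w: "ws ! i \<in> carrier_vec n" if "i < n" for i using ws that by auto
  have orth: "(ws ! i \<bullet> ws ! j = 0) \<longleftrightarrow> i \<noteq> j" if "i < n" "j < n" for i j
    using corthogonalD[OF ws(1), of i j] that ws(3) by simp
  define N where "N i = 1 / sqrt (ws ! i \<bullet> ws ! i)" for i
  have pos: "ws ! i \<bullet> ws ! i > 0" if "i < n" for i
    using orth[OF that that] sum_nonneg[of "{0..<dim_vec (ws ! i)}" "\<lambda>j. ws ! i $ j * ws ! i $ j"]
    by (simp add: scalar_prod_def)
  define U where "U = mat_of_cols n (map (\<lambda>i. N i \<cdot>\<^sub>v ws ! i) [0..<n])"
  have U: "U \<in> carrier_mat n n" by (simp add: U_def mat_of_cols_def)
  have colU: "col U i = N i \<cdot>\<^sub>v ws ! i" if "i < n" for i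
    unfolding U_def using that w by (subst col_mat_of_cols) auto
  have "U\<^sup>T * U = 1\<^sub>m n"
  proof (rule eq_matI)
    fix i j assume ij: "i < dim_row (1\<^sub>m n)" "j < dim_col (1\<^sub>m n)"
    then have "(U\<^sup>T * U) $$ (i, j) = col U i \<bullet> col U j" using U by simp
    also have "\<dots> = N i * N j * (ws ! i \<bullet> ws ! j)"
      using ij w[of i] w[of j] by (simp add: colU)
    also have "\<dots> = 1\<^sub>m n $$ (i, j)"
      using ij orth[of i j] pos[of i] by (auto simp: N_def)
    finally show "(U\<^sup>T * U) $$ (i, j) = 1\<^sub>m n $$ (i, j)" .
  qed (use U in auto)
  moreover have "col U 0 = N 0 \<cdot>\<^sub>v v"
    using colU[of 0] hd n ws(3) by (simp add: hd_conv_nth flip: length_0_conv)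
  ultimately show ?thesis using U that by blast
qed

text \<open>Deflation: in an orthonormal basis that starts with an eigenvector, the first column has
  only its diagonal entry, symmetry clears the first row as well, and the induction hypothesis
  diagonalizes the remaining block.\<close>

theorem spectral_theorem:
  fixes A :: "real mat"
  assumes "A \<in> carrier_mat n n" "A\<^sup>T = A"
  shows "\<exists>U l. U \<in> carrier_mat n n \<and> U\<^sup>T * U = 1\<^sub>m n \<and> A = U * mat_diag n l * U\<^sup>T"
  using assms
proof (induction n arbitrary: A)
  case 0
  then show ?case by (intro exI[of _ A]) (auto intro!: eq_matI)
next
  case (Suc n A)
  note A = Suc.prems(1) and sym = Suc.prems(2)
  obtain e where "eigenvalue A e" using symmetric_mat_real_eigenvalue[OF A sym] by auto
  then obtain v where v: "v \<in> carrier_vec (Suc n)" "v \<noteq> 0\<^sub>v (Suc n)" "A *\<^sub>v v = e \<cdot>\<^sub>v v"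
    using A by (auto simp: eigenvalue_def eigenvector_def)
  obtain W c where W: "W \<in> carrier_mat (Suc n) (Suc n)" "W\<^sup>T * W = 1\<^sub>m (Suc n)"
    and W0: "col W 0 = c \<cdot>\<^sub>v v"
    using orthonormal_completion[OF v(1,2)] by blast
  have WW: "W * W\<^sup>T = 1\<^sub>m (Suc n)"
    using mat_mult_left_right_inverse[OF _ W(1) W(2)] W(1) by simp
  define B where "B = W\<^sup>T * A * W"
  have B: "B \<in> carrier_mat (Suc n) (Suc n)" using W A by (auto simp: B_def)
  have Bsym: "B\<^sup>T = B"
    unfolding B_def using W A sym by (simp add: transpose_mult[of _ "Suc n" "Suc n" _ "Suc n"] assoc_mult_mat[of _ "Suc n" "Suc n" _ "Suc n" _ "Suc n"])
  have AB: "A = W * B * W\<^sup>T"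
  proof -
    have "W * B * W\<^sup>T = (W * W\<^sup>T) * A * (W * W\<^sup>T)"
      unfolding B_def using W A by (simp add: assoc_mult_mat[of _ "Suc n" "Suc n" _ "Suc n" _ "Suc n"])
    then show ?thesis using A by (simp add: WW)
  qed
  have col0: "B $$ (i, 0) = (if i = 0 then e else 0)" if "i < Suc n" for i
  proof -
    have "B $$ (i, 0) = (W\<^sup>T * (A * W)) $$ (i, 0)"
      unfolding B_def using W A by (simp add: assoc_mult_mat[of _ "Suc n" "Suc n" _ "Suc n" _ "Suc n"])
    also have "\<dots> = col W i \<bullet> (A *\<^sub>v col W 0)"
      using W A that by (simp add: col_mult2[of _ "Suc n" "Suc n" _ "Suc n"] mult_mat_vec_def)
    also have "A *\<^sub>v col W 0 = e \<cdot>\<^sub>v col W 0"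
      unfolding W0 using v A by (simp add: mult_mat_vec smult_smult_assoc mult.commute)
    also have "col W i \<bullet> (e \<cdot>\<^sub>v col W 0) = e * (col W i \<bullet> col W 0)"
      using W by simp
    also have "col W i \<bullet> col W 0 = (if i = 0 then 1 else 0)"
      using arg_cong[OF W(2), of "\<lambda>M. M $$ (i, 0)"] W(1) that by simp
    also have "e * (if i = 0 then 1 else 0) = (if i = 0 then e else 0)" by simp
    finally show ?thesis .
  qed
  define B' where "B' = mat n n (\<lambda>(i, j). B $$ (Suc i, Suc j))"
  have Bij: "B $$ (i, j) = B $$ (j, i)" if "i < Suc n" "j < Suc n" for i j
    using arg_cong[OF Bsym, of "\<lambda>M. M $$ (i, j)"] B that by simp
  have "B' \<in> carrier_mat n n" "B'\<^sup>T = B'" by (auto simp: B'_def intro!: eq_matI Bij)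
  from Suc.IH[OF this] obtain V l where V: "V \<in> carrier_mat n n" "V\<^sup>T * V = 1\<^sub>m n"
    and B'V: "B' = V * mat_diag n l * V\<^sup>T" by blast
  let ?z = "0\<^sub>m 1 n :: real mat" and ?z' = "0\<^sub>m n 1 :: real mat"
  define E where "E = mat 1 1 (\<lambda>_. e)"
  have E: "E \<in> carrier_mat 1 1" by (simp add: E_def)
  define Y where "Y = four_block_mat (1\<^sub>m 1) ?z ?z' V"
  define l' where "l' i = (case i of 0 \<Rightarrow> e | Suc j \<Rightarrow> l j)" for i
  have Y: "Y \<in> carrier_mat (Suc n) (Suc n)"
    unfolding Y_def using four_block_carrier_mat[of "1\<^sub>m 1" 1 1 V n n] V(1) by simp
  have YT: "Y\<^sup>T = four_block_mat (1\<^sub>m 1) ?z ?z' V\<^sup>T"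
    unfolding Y_def by (subst transpose_four_block_mat[of _ 1 1 _ n _ n]) (use V in auto)
  have Bblock: "B = four_block_mat E ?z ?z' B'"
  proof (rule eq_matI)
    fix i j assume "i < dim_row (four_block_mat E ?z ?z' B')" "j < dim_col (four_block_mat E ?z ?z' B')"
    then have ij: "i < Suc n" "j < Suc n" by (auto simp: E_def B'_def)
    show "B $$ (i, j) = four_block_mat E ?z ?z' B' $$ (i, j)"
      using ij col0[of i] col0[of j] Bij[OF ij] by (cases i; cases j) (auto simp: E_def B'_def)
  qed (use B in \<open>auto simp: E_def B'_def\<close>)
  have Dblock: "mat_diag (Suc n) l' = four_block_mat E ?z ?z' (mat_diag n l)"
    by (rule eq_matI) (auto simp: E_def l'_def mat_diag_def split: nat.split)
  have YY: "Y\<^sup>T * Y = 1\<^sub>m (Suc n)"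
  proof -
    have "Y\<^sup>T * Y = four_block_mat (1\<^sub>m 1) ?z ?z' (1\<^sub>m n)"
      unfolding YT unfolding Y_def
      by (subst mult_four_block_mat[of _ 1 1 _ n _ n _ _ 1 _ n]) (use V in auto)
    also have "\<dots> = 1\<^sub>m (Suc n)" by (rule eq_matI) auto
    finally show ?thesis .
  qed
  have Dn: "mat_diag n l \<in> carrier_mat n n" by simp
  have BY: "B = Y * mat_diag (Suc n) l' * Y\<^sup>T"
  proof -
    have "Y * mat_diag (Suc n) l' = four_block_mat E ?z ?z' (V * mat_diag n l)"
      unfolding Dblock Y_def
      by (subst mult_four_block_mat[of _ 1 1 _ n _ n _ _ 1 _ n])
        (use V E Dn in \<open>auto simp: left_mult_zero_mat[OF Dn]\<close>)
    also have "\<dots> * Y\<^sup>T = four_block_mat E ?z ?z' (V * mat_diag n l * V\<^sup>T)"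
    proof -
      have VD: "V * mat_diag n l \<in> carrier_mat n n" using V Dn by auto
      then have VDV: "V * mat_diag n l * V\<^sup>T \<in> carrier_mat n n" using V by auto
      show ?thesis
        unfolding YT
        by (subst mult_four_block_mat[of _ 1 1 _ n _ n _ _ 1 _ n])
          (use V E VD VDV in \<open>auto simp: right_mult_zero_mat[OF VD] left_add_zero_mat[OF VDV]\<close>)
    qed
    finally show ?thesis unfolding Bblock B'V by simp
  qed
  have D: "mat_diag (Suc n) l' \<in> carrier_mat (Suc n) (Suc n)" by simp
  show ?case
  proof (intro exI conjI)
    show "W * Y \<in> carrier_mat (Suc n) (Suc n)" using W Y by simp
    have "(W * Y)\<^sup>T * (W * Y) = Y\<^sup>T * (W\<^sup>T * W) * Y"
      using W(1) Y by (simp add: transpose_mult[of _ "Suc n" "Suc n" _ "Suc n"] assoc_mult_mat[of _ "Suc n" "Suc n" _ "Suc n" _ "Suc n"])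
    then show "(W * Y)\<^sup>T * (W * Y) = 1\<^sub>m (Suc n)" using Y by (simp add: W(2) YY)
    have YDY: "Y * (mat_diag (Suc n) l' * Y\<^sup>T) \<in> carrier_mat (Suc n) (Suc n)"
      "mat_diag (Suc n) l' * Y\<^sup>T \<in> carrier_mat (Suc n) (Suc n)"
      using Y D by (auto intro!: mult_carrier_mat)
    show "A = W * Y * mat_diag (Suc n) l' * (W * Y)\<^sup>T"
      unfolding AB BY using W(1) Y D YDY
      by (simp add: transpose_mult[of _ "Suc n" "Suc n" _ "Suc n"] assoc_mult_mat[of _ "Suc n" "Suc n" _ "Suc n" _ "Suc n"])
  qed
qed

text \<open>Since an eigendecomposition exists, the choice operator returns some
  \<open>U f(\<Lambda>) U^T\<close>, and size and symmetry are visible in that form.\<close>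

lemma mat_fun_symmetric:
  fixes A :: "real mat"
  assumes A: "A \<in> carrier_mat n n" "A\<^sup>T = A"
  shows "mat_fun f A \<in> carrier_mat n n" "(mat_fun f A)\<^sup>T = mat_fun f A"
proof -
  from spectral_theorem[OF A] obtain U l
    where "U \<in> carrier_mat n n" "U\<^sup>T * U = 1\<^sub>m n" "A = U * mat_diag n l * U\<^sup>T" by blast
  then have "\<exists>F U l. U \<in> carrier_mat n n \<and> U\<^sup>T * U = 1\<^sub>m n \<and> A = U * mat_diag n l * U\<^sup>T
      \<and> F = U * mat_diag n (\<lambda>i. f (l i)) * U\<^sup>T" by blast
  from someI_ex[OF this] obtain U l where U: "U \<in> carrier_mat n n"
    and F: "mat_fun f A = U * mat_diag n (\<lambda>i. f (l i)) * U\<^sup>T"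
    unfolding mat_fun_def using A(1) by auto
  have D: "mat_diag n (\<lambda>i. f (l i)) \<in> carrier_mat n n" by simp
  have DT: "(mat_diag n (\<lambda>i. f (l i)))\<^sup>T = mat_diag n (\<lambda>i. f (l i))"
    by (rule eq_matI) (auto simp: mat_diag_def)
  show "mat_fun f A \<in> carrier_mat n n" unfolding F using U D by auto
  have "(U * mat_diag n (\<lambda>i. f (l i)) * U\<^sup>T)\<^sup>T = U * (U * mat_diag n (\<lambda>i. f (l i)))\<^sup>T"
    using U by (subst transpose_mult[of _ n n _ n]) auto
  also have "\<dots> = U * (mat_diag n (\<lambda>i. f (l i)) * U\<^sup>T)"
    using U D by (subst transpose_mult[of _ n n _ n]) (auto simp: DT)
  finally show "(mat_fun f A)\<^sup>T = mat_fun f A"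
    unfolding F using U D by (simp add: assoc_mult_mat[of _ n n _ n _ n])
qed

section \<open>Krylov subspaces and block Lanczos\<close>

text \<open>A repeated column leaves fewer than \<open>nc\<close> different ones, and the rank is
  the size of a maximal independent set among them.\<close>

lemma (in vec_space) full_rank_distinct_cols:
  assumes A: "A \<in> carrier_mat n nc" and rank: "rank A = nc"
  shows "distinct (cols A)"
proof (rule ccontr)
  assume nd: "\<not> distinct (cols A)"
  obtain S where S: "maximal S (\<lambda>T. T \<subseteq> set (cols A) \<and> lin_indpt T)"
    using maximal_exists[of "(\<lambda>T. T \<subseteq> set (cols A) \<and> lin_indpt T)" "card (set (cols A))" "{}"]
    by (meson List.finite_set card_mono empty_iff empty_subsetI finite_lin_indpt2 rev_finite_subset)
  then have "card S \<le> card (set (cols A))" by (simp add: card_mono maximal_def)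
  also have "\<dots> < nc"
    using nd A card_length[of "cols A"] card_distinct[of "cols A"] by (force simp: le_less)
  finally show False using rank_card_indpt[OF A S] rank by simp
qed

lemma (in vec_space) full_rank_kernel:
  assumes A: "A \<in> carrier_mat n nc" and rank: "rank A = nc"
    and v: "v \<in> carrier_vec nc" "A *\<^sub>v v = 0\<^sub>v n"
  shows "v = 0\<^sub>v nc"
  using full_rank_distinct_cols[OF A rank] full_rank_lin_indpt[OF A rank] lin_depI[OF A v(1) _ v(2)]
  by blast

lemma (in vec_space) full_rank_le:
  assumes A: "A \<in> carrier_mat n nc" and rank: "rank A = nc"
  shows "nc \<le> n"
proof -
  have d: "distinct (cols A)" by (rule full_rank_distinct_cols[OF A rank])
  have "card (set (cols A)) \<le> dim"
    using A cols_dim[of A] by (intro li_le_dim(2)[OF fin_dim] full_rank_lin_indpt[OF A rank d]) auto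
  then show ?thesis using distinct_card[OF d] A by (simp add: dim_is_n)
qed

text \<open>The vector \<open>Z c_0 + A Z c_1 + ... + A^(k-1) Z c_(k-1)\<close>: an element of the
  Krylov space given by its block coordinates. The recursion lets inductions split off the top power
  of \<open>A\<close>.\<close>

fun krylov_comb :: "real mat \<Rightarrow> real mat \<Rightarrow> nat \<Rightarrow> (nat \<Rightarrow> real vec) \<Rightarrow> real vec" where
  "krylov_comb A Z 0 c = 0\<^sub>v (dim_row A)"
| "krylov_comb A Z (Suc k) c = krylov_comb A Z k c + (A ^\<^sub>m k * Z) *\<^sub>v c k"

definition krylov_mat :: "nat \<Rightarrow> real mat \<Rightarrow> real mat \<Rightarrow> real mat" where
  "krylov_mat s A Z = mat (dim_row A) (s * dim_col Z)
     (\<lambda>(r, c). (A ^\<^sub>m (c div dim_col Z) * Z) $$ (r, c mod dim_col Z))"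

lemma div_mod_less:
  fixes i s b :: nat
  assumes "i < s * b"
  shows "i div b < s" "i mod b < b"
proof -
  have "b > 0" using assms by (cases b) auto
  then show "i mod b < b" by simp
  show "i div b < s" using assms by (rule less_mult_imp_div_less)
qed

lemma block_index_less:
  fixes i s b r :: nat
  assumes "i < s" "r < b"
  shows "i * b + r < s * b"
proof -
  have "i * b + r < Suc i * b" using assms(2) by simp
  also have "\<dots> \<le> s * b" using assms(1) by (intro mult_le_mono1) simp
  finally show ?thesis .
qed

locale krylov =
  fixes A Z :: "real mat" and d b s :: nat
  assumes A: "A \<in> carrier_mat d d" and Z: "Z \<in> carrier_mat d b"
    and success: "lanczos_success A Z s"
begin

lemma Ak[simp]: "A ^\<^sub>m k \<in> carrier_mat d d" using A by simp

lemma dims[simp]: "dim_row A = d" "dim_col A = d" "dim_row Z = d" "dim_col Z = b"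
  using A Z by auto

lemma AkZ[simp]: "A ^\<^sub>m k * Z \<in> carrier_mat d b" using Z by (intro mult_carrier_mat[of _ d d]) auto

lemma dim_AkZ[simp]: "dim_row (A ^\<^sub>m k * Z) = d" "dim_col (A ^\<^sub>m k * Z) = b"
  using AkZ by auto

lemma row_AkZ[simp]: "row (A ^\<^sub>m k * Z) r \<in> carrier_vec b"
  using carrier_matD(2)[OF AkZ] by (intro carrier_vecI) (simp only: row_def dim_vec)

lemma AkZ_zero: "(A ^\<^sub>m k * Z) *\<^sub>v 0\<^sub>v b = 0\<^sub>v d"
proof (rule eq_vecI)
  show dim: "dim_vec ((A ^\<^sub>m k * Z) *\<^sub>v 0\<^sub>v b) = dim_vec (0\<^sub>v d)"
    using carrier_matD(1)[OF AkZ] by (simp only: dim_mult_mat_vec index_zero_vec)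
  fix r assume "r < dim_vec (0\<^sub>v d)"
  then have r: "r < d" "r < dim_row (A ^\<^sub>m k * Z)" using carrier_matD(1)[OF AkZ] by simp_all
  show "((A ^\<^sub>m k * Z) *\<^sub>v 0\<^sub>v b) $ r = 0\<^sub>v d $ r"
    using r scalar_prod_right_zero[OF row_AkZ] by (simp only: index_mult_mat_vec index_zero_vec)
qed

text \<open>The columns of \<open>krylov_mat\<close> are exactly the generators of the Krylov space,
  so a successful run means full column rank.\<close>

lemma rank_krylov_mat: "vec_space.rank d (krylov_mat s A Z) = s * b"
proof -
  have "set (cols (krylov_mat s A Z)) = (\<Union>i<s. set (cols (A ^\<^sub>m i * Z)))" (is "?L = ?R")
  proof
    show "?L \<subseteq> ?R"
    proof
      fix v assume "v \<in> ?L"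
      then obtain c where c: "c < s * b" "v = col (krylov_mat s A Z) c"
        using A Z by (auto simp: cols_def krylov_mat_def)
      from div_mod_less[OF c(1)] have i: "c div b < s" "c mod b < b" .
      have "v = col (A ^\<^sub>m (c div b) * Z) (c mod b)"
        using c i A Z AkZ by (intro eq_vecI) (auto simp: krylov_mat_def)
      then have "v \<in> set (cols (A ^\<^sub>m (c div b) * Z))" using i by (auto simp: cols_def)
      then show "v \<in> ?R" using i by blast
    qed
    show "?R \<subseteq> ?L"
    proof
      fix v assume "v \<in> ?R"
      then obtain i r where i: "i < s" "r < b" "v = col (A ^\<^sub>m i * Z) r"
        using A Z AkZ by (auto simp: cols_def)
      have c: "i * b + r < s * b" by (rule block_index_less[OF i(1,2)])
      have "v = col (krylov_mat s A Z) (i * b + r)"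
        using c i A Z AkZ by (intro eq_vecI) (auto simp: krylov_mat_def)
      moreover have "col (krylov_mat s A Z) (i * b + r) \<in> set (cols (krylov_mat s A Z))"
        unfolding cols_def set_map using c by (intro imageI) (simp add: krylov_mat_def)
      ultimately show "v \<in> ?L" by simp
    qed
  qed
  then show ?thesis
    using success A Z unfolding lanczos_success_def krylov_dim_def krylov_space_def vec_space.rank_def
    by simp
qed

lemma krylov_mat[simp]: "krylov_mat s A Z \<in> carrier_mat d (s * b)"
  using A Z by (simp add: krylov_mat_def)

lemma size_le: "s * b \<le> d"
  by (rule vec_space.full_rank_le[OF krylov_mat rank_krylov_mat])

lemma comb_carrier[simp]: "krylov_comb A Z k c \<in> carrier_vec d"
  by (induction k) (auto intro!: add_carrier_vec carrier_vecI)

lemma dim_comb[simp]: "dim_vec (krylov_comb A Z k c) = d"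
  using comb_carrier by (rule carrier_vecD)

lemma krylov_comb_index:
  "r < d \<Longrightarrow> krylov_comb A Z k c $ r = (\<Sum>i<k. row (A ^\<^sub>m i * Z) r \<bullet> c i)"
proof (induction k)
  case (Suc k)
  have "((A ^\<^sub>m k * Z) *\<^sub>v c k) $ r = row (A ^\<^sub>m k * Z) r \<bullet> c k"
    using AkZ[of k] Suc.prems by (intro index_mult_mat_vec) auto
  moreover have "dim_vec ((A ^\<^sub>m k * Z) *\<^sub>v c k) = d" using AkZ[of k] by (metis carrier_matD(1) dim_mult_mat_vec)
  ultimately show ?case using Suc by (simp del: index_mult_mat_vec)
qed (use A in simp)

lemma krylov_comb_eq_mat:
  assumes c: "\<And>i. i < s \<Longrightarrow> c i \<in> carrier_vec b"
  shows "krylov_comb A Z s c = krylov_mat s A Z *\<^sub>v vec (s * b) (\<lambda>j. c (j div b) $ (j mod b))"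
proof (rule eq_vecI)
  fix r assume "r < dim_vec (krylov_mat s A Z *\<^sub>v vec (s * b) (\<lambda>j. c (j div b) $ (j mod b)))"
  then have r: "r < d" using krylov_mat by simp
  have "(krylov_mat s A Z *\<^sub>v vec (s * b) (\<lambda>j. c (j div b) $ (j mod b))) $ r
      = (\<Sum>j<s * b. (A ^\<^sub>m (j div b) * Z) $$ (r, j mod b) * c (j div b) $ (j mod b))"
    using r A Z by (simp add: scalar_prod_def krylov_mat_def atLeast0LessThan)
  also have "\<dots> = (\<Sum>i<s. \<Sum>j\<in>{i * b..<i * b + b}. (A ^\<^sub>m (j div b) * Z) $$ (r, j mod b) * c (j div b) $ (j mod b))"
    by (rule sum.nat_group[symmetric])
  also have "\<dots> = (\<Sum>i<s. row (A ^\<^sub>m i * Z) r \<bullet> c i)"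
  proof (rule sum.cong[OF refl])
    fix i assume "i \<in> {..<s}"
    then have ci: "dim_vec (c i) = b" using c by auto
    let ?F = "\<lambda>j. (A ^\<^sub>m (j div b) * Z) $$ (r, j mod b) * c (j div b) $ (j mod b)"
    have "sum ?F {i * b..<i * b + b} = (\<Sum>j\<in>{0..<b}. ?F (j + i * b))"
      using sum.shift_bounds_nat_ivl[of ?F 0 "i * b" b] unfolding add_0 add.commute[of b "i * b"] .
    also have "\<dots> = (\<Sum>j\<in>{0..<b}. (A ^\<^sub>m i * Z) $$ (r, j) * c i $ j)"
      by (intro sum.cong) auto
    also have "\<dots> = row (A ^\<^sub>m i * Z) r \<bullet> c i"
      unfolding scalar_prod_def ci using AkZ[of i] r by (intro sum.cong) auto
    finally show "(\<Sum>j\<in>{i * b..<i * b + b}. (A ^\<^sub>m (j div b) * Z) $$ (r, j mod b) * c (j div b) $ (j mod b))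
        = row (A ^\<^sub>m i * Z) r \<bullet> c i" .
  qed
  finally show "krylov_comb A Z s c $ r = (krylov_mat s A Z *\<^sub>v vec (s * b) (\<lambda>j. c (j div b) $ (j mod b))) $ r"
    using r by (simp add: krylov_comb_index)
qed (use carrier_matD(1)[OF krylov_mat] in auto)

lemma krylov_independent:
  assumes c: "\<And>i. i < s \<Longrightarrow> c i \<in> carrier_vec b" and 0: "krylov_comb A Z s c = 0\<^sub>v d"
    and i: "i < s"
  shows "c i = 0\<^sub>v b"
proof (rule eq_vecI)
  have "krylov_mat s A Z *\<^sub>v vec (s * b) (\<lambda>j. c (j div b) $ (j mod b)) = 0\<^sub>v d"
    using krylov_comb_eq_mat[of c] c 0 by metis
  then have eq0: "vec (s * b) (\<lambda>j. c (j div b) $ (j mod b)) = 0\<^sub>v (s * b)"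
    by (rule vec_space.full_rank_kernel[OF krylov_mat rank_krylov_mat vec_carrier])
  have *: "c (j div b) $ (j mod b) = 0" if "j < s * b" for j
    using arg_cong[OF eq0, of "\<lambda>v. vec_index v j"] that by simp
  fix r assume "r < dim_vec (0\<^sub>v b)"
  then have r: "r < b" by simp
  from *[OF block_index_less[OF i r]] r show "c i $ r = 0\<^sub>v b $ r" by simp
qed (use c[OF i] in auto)

text \<open>The Krylov space again, but through block coordinates rather than as a span, so that the
  coefficient of the highest power is available. \<open>K 0\<close> is the zero space.\<close>

definition K :: "nat \<Rightarrow> real vec set" where
  "K k = {krylov_comb A Z k c | c. \<forall>i. c i \<in> carrier_vec b}"

lemma K_carrier: "K k \<subseteq> carrier_vec d" by (auto simp: K_def)

lemma comb_cong: "(\<And>i. i < k \<Longrightarrow> c i = c' i) \<Longrightarrow> krylov_comb A Z k c = krylov_comb A Z k c'"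
  by (induction k) auto

lemma comb_add:
  assumes "\<forall>i. c i \<in> carrier_vec b" "\<forall>i. c' i \<in> carrier_vec b"
  shows "krylov_comb A Z k (\<lambda>i. c i + c' i) = krylov_comb A Z k c + krylov_comb A Z k c'"
proof (rule eq_vecI)
  fix r assume "r < dim_vec (krylov_comb A Z k c + krylov_comb A Z k c')"
  then have r: "r < d" using carrier_vecD[OF comb_carrier] by simp
  have "row (A ^\<^sub>m i * Z) r \<bullet> (c i + c' i) = row (A ^\<^sub>m i * Z) r \<bullet> c i + row (A ^\<^sub>m i * Z) r \<bullet> c' i" for i
    using assms by (intro scalar_prod_add_distrib[OF row_AkZ]) auto
  then show "krylov_comb A Z k (\<lambda>i. c i + c' i) $ r = (krylov_comb A Z k c + krylov_comb A Z k c') $ r"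
    using r carrier_vecD[OF comb_carrier] by (simp add: krylov_comb_index sum.distrib)
qed (use carrier_vecD[OF comb_carrier] in auto)

lemma comb_uminus:
  assumes "\<forall>i. c i \<in> carrier_vec b"
  shows "krylov_comb A Z k (\<lambda>i. - c i) = - krylov_comb A Z k c"
proof (rule eq_vecI)
  fix r assume "r < dim_vec (- krylov_comb A Z k c)"
  then have r: "r < d" using comb_carrier[of k c] by simp
  have "row (A ^\<^sub>m i * Z) r \<bullet> - c i = - (row (A ^\<^sub>m i * Z) r \<bullet> c i)" for i
    using assms by (intro scalar_prod_uminus_right) (metis carrier_vecD row_AkZ)
  then show "krylov_comb A Z k (\<lambda>i. - c i) $ r = (- krylov_comb A Z k c) $ r"
    using r carrier_vecD[OF comb_carrier] by (simp add: krylov_comb_index sum_negf)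
qed (use carrier_vecD[OF comb_carrier] in auto)

lemma K_add: "v \<in> K k \<Longrightarrow> w \<in> K k \<Longrightarrow> v + w \<in> K k"
proof -
  assume "v \<in> K k" "w \<in> K k"
  then obtain c c' where c: "\<forall>i. c i \<in> carrier_vec b" "\<forall>i. c' i \<in> carrier_vec b"
    and v: "v = krylov_comb A Z k c" "w = krylov_comb A Z k c'" by (auto simp: K_def)
  have "v + w = krylov_comb A Z k (\<lambda>i. c i + c' i)" unfolding v comb_add[OF c] ..
  then show ?thesis unfolding K_def using c by (intro CollectI exI[of _ "\<lambda>i. c i + c' i"]) auto
qed

lemma K_uminus: "v \<in> K k \<Longrightarrow> - v \<in> K k"
proof -
  assume "v \<in> K k"
  then obtain c where c: "\<forall>i. c i \<in> carrier_vec b" and v: "v = krylov_comb A Z k c" by (auto simp: K_def)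
  have "- v = krylov_comb A Z k (\<lambda>i. - c i)" unfolding v comb_uminus[OF c] ..
  then show ?thesis unfolding K_def using c by (intro CollectI exI[of _ "\<lambda>i. - c i"]) auto
qed

lemma K_minus: "v \<in> K k \<Longrightarrow> w \<in> K k \<Longrightarrow> v - w \<in> K k"
  using K_add[of v k "- w"] K_uminus[of w k] K_carrier[of k] minus_add_uminus_vec[of v d w]
  by (metis subsetD)

lemma comb_zero: "krylov_comb A Z k (\<lambda>_. 0\<^sub>v b) = 0\<^sub>v d"
proof (rule eq_vecI)
  fix r assume "r < dim_vec (0\<^sub>v d)"
  then show "krylov_comb A Z k (\<lambda>_. 0\<^sub>v b) $ r = 0\<^sub>v d $ r"
    using scalar_prod_right_zero[OF row_AkZ] by (simp add: krylov_comb_index)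
qed (use carrier_vecD[OF comb_carrier] in auto)

lemma K_0: "0\<^sub>v d \<in> K k"
proof -
  have "0\<^sub>v d = krylov_comb A Z k (\<lambda>_. 0\<^sub>v b)" by (simp add: comb_zero)
  then show ?thesis unfolding K_def by (intro CollectI exI[of _ "\<lambda>_. 0\<^sub>v b"]) auto
qed

lemma K_top: "x \<in> carrier_vec b \<Longrightarrow> (A ^\<^sub>m k * Z) *\<^sub>v x \<in> K (Suc k)"
proof -
  assume x: "x \<in> carrier_vec b"
  let ?c = "\<lambda>i. if i = k then x else 0\<^sub>v b"
  have "krylov_comb A Z k ?c = krylov_comb A Z k (\<lambda>_. 0\<^sub>v b)" by (rule comb_cong) auto
  also have "\<dots> = 0\<^sub>v d" by (rule comb_zero)
  finally have "krylov_comb A Z (Suc k) ?c = (A ^\<^sub>m k * Z) *\<^sub>v x"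
    using mult_mat_vec_carrier[OF AkZ x, of k] by simp
  then show ?thesis unfolding K_def using x by (intro CollectI exI[of _ ?c]) auto
qed

lemma K_Suc: "K k \<subseteq> K (Suc k)"
proof
  fix v assume "v \<in> K k"
  then obtain c where c: "\<forall>i. c i \<in> carrier_vec b" and v: "v = krylov_comb A Z k c" by (auto simp: K_def)
  let ?c = "\<lambda>i. if i = k then 0\<^sub>v b else c i"
  have "krylov_comb A Z k ?c = v" unfolding v by (rule comb_cong) auto
  moreover have "(A ^\<^sub>m k * Z) *\<^sub>v 0\<^sub>v b = 0\<^sub>v d"
    by (rule AkZ_zero)
  ultimately have "krylov_comb A Z (Suc k) ?c = v" using v comb_carrier[of k c] by simp
  then show "v \<in> K (Suc k)" unfolding K_def using c by (intro CollectI exI[of _ ?c]) auto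
qed

lemma K_decomp:
  assumes "v \<in> K (Suc k)"
  obtains w x where "w \<in> K k" "x \<in> carrier_vec b" "v = w + (A ^\<^sub>m k * Z) *\<^sub>v x"
  using assms by (auto simp: K_def)

lemma mult_AkZ:
  assumes x: "x \<in> carrier_vec b"
  shows "A *\<^sub>v ((A ^\<^sub>m k * Z) *\<^sub>v x) = (A ^\<^sub>m Suc k * Z) *\<^sub>v x"
proof -
  have pow: "A * A ^\<^sub>m k = A ^\<^sub>m Suc k"
  proof (induction k)
    case (Suc k)
    then show ?case using assoc_mult_mat[OF A Ak A, of k] by simp
  qed (use A in auto)
  have "A *\<^sub>v ((A ^\<^sub>m k * Z) *\<^sub>v x) = (A * (A ^\<^sub>m k * Z)) *\<^sub>v x"
    by (rule assoc_mult_mat_vec[OF A AkZ x, symmetric])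
  also have "A * (A ^\<^sub>m k * Z) = A ^\<^sub>m Suc k * Z"
    unfolding pow[symmetric] by (rule assoc_mult_mat[OF A Ak Z, symmetric])
  finally show ?thesis .
qed

lemma K_mult: "v \<in> K k \<Longrightarrow> A *\<^sub>v v \<in> K (Suc k)"
proof (induction k arbitrary: v)
  case 0
  then have "A *\<^sub>v v = 0\<^sub>v d" using A by (auto simp: K_def intro!: eq_vecI)
  then show ?case using K_0 by simp
next
  case (Suc k)
  from K_decomp[OF Suc.prems] obtain w x where w: "w \<in> K k" and x: "x \<in> carrier_vec b"
    and v: "v = w + (A ^\<^sub>m k * Z) *\<^sub>v x" by blast
  have wc: "w \<in> carrier_vec d" using w K_carrier by auto
  have "A *\<^sub>v v = A *\<^sub>v w + (A ^\<^sub>m Suc k * Z) *\<^sub>v x"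
    unfolding v using mult_add_distrib_mat_vec[OF A wc mult_mat_vec_carrier[OF AkZ x]] mult_AkZ[OF x] by metis
  then show ?case using K_add[OF _ K_top[OF x, of "Suc k"]] K_Suc[of "Suc k"] Suc.IH[OF w] by auto
qed

text \<open>Subtracting the two representations of the vector gives a vanishing combination whose
  coefficient at \<open>A^k Z\<close> is \<open>- x\<close>.\<close>

lemma K_independent:
  assumes k: "k < s" and x: "x \<in> carrier_vec b" and v: "(A ^\<^sub>m k * Z) *\<^sub>v x \<in> K k"
  shows "x = 0\<^sub>v b"
proof -
  obtain c where c: "\<forall>i. c i \<in> carrier_vec b" and e: "(A ^\<^sub>m k * Z) *\<^sub>v x = krylov_comb A Z k c"
    using v by (auto simp: K_def)
  let ?c = "\<lambda>i. if i < k then c i else if i = k then - x else 0\<^sub>v b"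
  have "krylov_comb A Z k ?c = (A ^\<^sub>m k * Z) *\<^sub>v x" unfolding e by (rule comb_cong) auto
  moreover have "(A ^\<^sub>m k * Z) *\<^sub>v (- x) = - ((A ^\<^sub>m k * Z) *\<^sub>v x)"
  proof (rule eq_vecI)
    fix r assume "r < dim_vec (- ((A ^\<^sub>m k * Z) *\<^sub>v x))"
    then have r: "r < dim_row (A ^\<^sub>m k * Z)" by (simp only: index_uminus_vec dim_mult_mat_vec)
    show "((A ^\<^sub>m k * Z) *\<^sub>v - x) $ r = (- ((A ^\<^sub>m k * Z) *\<^sub>v x)) $ r"
      using r x carrier_vecD[OF row_AkZ]
      by (simp only: index_mult_mat_vec index_uminus_vec dim_mult_mat_vec scalar_prod_uminus_right carrier_vecD)
  qed (simp only: index_uminus_vec dim_mult_mat_vec)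
  ultimately have "krylov_comb A Z (Suc k) ?c = 0\<^sub>v d"
    using mult_mat_vec_carrier[OF AkZ x, of k] by simp
  \<comment> \<open>Independence is known for combinations of full length \<open>s\<close>, so the
    short one is padded with zero blocks.\<close>
  moreover have "krylov_comb A Z j ?c = krylov_comb A Z (Suc k) ?c" if "j \<ge> Suc k" for j
    using that
  proof (induction j rule: dec_induct)
    case (step j)
    have "(A ^\<^sub>m j * Z) *\<^sub>v 0\<^sub>v b = 0\<^sub>v d"
      by (rule AkZ_zero)
    moreover have "?c j = 0\<^sub>v b" using step by simp
    ultimately have "krylov_comb A Z (Suc j) ?c = krylov_comb A Z j ?c"
      using right_zero_vec[OF comb_carrier[of j ?c]] by (simp only: krylov_comb.simps)
    then show ?case using step by simp
  qed simp
  ultimately have "krylov_comb A Z s ?c = 0\<^sub>v d" using k by (metis Suc_leI)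
  then have "?c k = 0\<^sub>v b" by (rule krylov_independent[rotated]) (use k c x in auto)
  then have "- x = 0\<^sub>v b" by simp
  then show ?thesis using x by (metis uminus_uminus_vec uminus_zero_vec)
qed

end

lemma inverse_of_injective_mat:
  fixes B :: "real mat"
  assumes B: "B \<in> carrier_mat n n" and inj: "\<And>x. x \<in> carrier_vec n \<Longrightarrow> B *\<^sub>v x = 0\<^sub>v n \<Longrightarrow> x = 0\<^sub>v n"
  obtains C where "C \<in> carrier_mat n n" "B * C = 1\<^sub>m n" "C * B = 1\<^sub>m n"
proof -
  have "det B \<noteq> 0" using det_0_iff_vec_prod_zero_field[OF B] inj by auto
  from det_non_zero_imp_unit[OF B this, of "()"]
  show ?thesis using that by (auto simp: Units_def ring_mat_def)
qed

section \<open>Orthonormality of the blocks of a successful Lanczos run\<close>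

locale lanczos_run = krylov +
  fixes qr :: "real mat \<Rightarrow> real mat \<times> real mat"
  assumes sym: "A\<^sup>T = A" and qr: "qr_routine qr" and s: "s \<ge> 1"
begin

abbreviation Q where "Q \<equiv> lanczos_Q qr A Z"
abbreviation R where "R \<equiv> lanczos_R qr A Z"
abbreviation M where "M \<equiv> lanczos_M qr A Z"

lemma b_le_d: "b \<le> d"
proof -
  have "1 * b \<le> s * b" using s by (rule mult_le_mono1)
  then show ?thesis using size_le by linarith
qed

lemma qrD:
  assumes "B \<in> carrier_mat d b"
  shows "fst (qr B) \<in> carrier_mat d b" "(fst (qr B))\<^sup>T * fst (qr B) = 1\<^sub>m b"
    "snd (qr B) \<in> carrier_mat b b" "B = fst (qr B) * snd (qr B)"
  using qr[unfolded qr_routine_def, rule_format, of B] b_le_d assms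
  by (auto simp: is_qr_def orthonormal_cols_def split: prod.splits)

lemma step: "Q (Suc (Suc k)) = fst (qr (A * Q (Suc k) - Q k * (R (Suc k))\<^sup>T - Q (Suc k) * M (Suc k)))"
  "R (Suc (Suc k)) = snd (qr (A * Q (Suc k) - Q k * (R (Suc k))\<^sup>T - Q (Suc k) * M (Suc k)))"
  by (simp_all add: lanczos_Q_def lanczos_R_def lanczos_M_def Let_def case_prod_beta)

lemma Q_0: "Q 0 = 0\<^sub>m d b"
  by (simp add: lanczos_Q_def)

lemma first: "Q 1 \<in> carrier_mat d b" "R 1 \<in> carrier_mat b b" "(Q 1)\<^sup>T * Q 1 = 1\<^sub>m b" "Z = Q 1 * R 1"
  using qrD[OF Z] Z by (auto simp: lanczos_Q_def lanczos_R_def orthonormal_cols_def)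

lemma carriers: "Q k \<in> carrier_mat d b \<and> R k \<in> carrier_mat b b \<and> Q (Suc k) \<in> carrier_mat d b \<and> R (Suc k) \<in> carrier_mat b b"
proof (induction k)
  case 0
  then show ?case using first by (auto simp: Q_0 lanczos_R_def)
next
  case (Suc k)
  then have "M (Suc k) \<in> carrier_mat b b"
    unfolding lanczos_M_def using A by (auto intro!: mult_carrier_mat minus_carrier_mat)
  then have "A * Q (Suc k) - Q k * (R (Suc k))\<^sup>T - Q (Suc k) * M (Suc k) \<in> carrier_mat d b"
    using Suc A by (auto intro!: mult_carrier_mat minus_carrier_mat)
  then show ?case using Suc qrD unfolding step by blast
qed

lemma Q[simp]: "Q k \<in> carrier_mat d b" and R[simp]: "R k \<in> carrier_mat b b"
  using carriers by auto

lemma RT[simp]: "(R k)\<^sup>T \<in> carrier_mat b b" by simp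

lemma AQ[simp]: "A * Q k \<in> carrier_mat d b" using A Q by (rule mult_carrier_mat)

lemma QR[simp]: "Q j * R k \<in> carrier_mat d b" "Q j * (R k)\<^sup>T \<in> carrier_mat d b"
  by (auto intro!: mult_carrier_mat[OF Q])

lemma W[simp]: "A * Q (Suc k) - Q k * (R (Suc k))\<^sup>T \<in> carrier_mat d b"
  by (intro minus_carrier_mat QR)

lemma M[simp]: "M (Suc k) \<in> carrier_mat b b"
  unfolding lanczos_M_def by (auto intro!: mult_carrier_mat[of _ b d])

lemma QM[simp]: "Q j * M (Suc k) \<in> carrier_mat d b"
  by (rule mult_carrier_mat[OF Q M])

lemma residual_carrier[simp]: "A * Q (Suc k) - Q k * (R (Suc k))\<^sup>T - Q (Suc k) * M (Suc k) \<in> carrier_mat d b"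
  by (intro minus_carrier_mat QM)

lemma residual: "Q (Suc (Suc k)) * R (Suc (Suc k)) = A * Q (Suc k) - Q k * (R (Suc k))\<^sup>T - Q (Suc k) * M (Suc k)"
  unfolding step by (rule qrD(4)[OF residual_carrier, symmetric])

lemma Q_normalized: "(Q (Suc k))\<^sup>T * Q (Suc k) = 1\<^sub>m b"
  by (cases k) (use first qrD(2)[OF residual_carrier] in \<open>auto simp: step\<close>)

text \<open>The three-term recurrence follows from the QR identity alone, before anything is known
  about orthogonality between different blocks.\<close>

lemma recurrence: "A * Q (Suc k) = Q (Suc (Suc k)) * R (Suc (Suc k)) + Q (Suc k) * M (Suc k) + Q k * (R (Suc k))\<^sup>T"
proof (rule eq_matI)
  fix i j
  assume "i < dim_row (Q (Suc (Suc k)) * R (Suc (Suc k)) + Q (Suc k) * M (Suc k) + Q k * (R (Suc k))\<^sup>T)"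
    "j < dim_col (Q (Suc (Suc k)) * R (Suc (Suc k)) + Q (Suc k) * M (Suc k) + Q k * (R (Suc k))\<^sup>T)"
  then have ij: "i < d" "j < b" using carrier_matD[OF QR(2)[of k "Suc k"]] by simp_all
  have "(Q (Suc (Suc k)) * R (Suc (Suc k))) $$ (i, j)
      = (A * Q (Suc k)) $$ (i, j) - (Q k * (R (Suc k))\<^sup>T) $$ (i, j) - (Q (Suc k) * M (Suc k)) $$ (i, j)"
    unfolding residual using ij carrier_matD[OF AQ] carrier_matD[OF QR(2)] carrier_matD[OF QM] 
    by (simp del: index_mult_mat)
  then show "(A * Q (Suc k)) $$ (i, j)
      = (Q (Suc (Suc k)) * R (Suc (Suc k)) + Q (Suc k) * M (Suc k) + Q k * (R (Suc k))\<^sup>T) $$ (i, j)"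
    using ij carrier_matD[OF AQ] carrier_matD[OF QR(1)] carrier_matD[OF QR(2)] carrier_matD[OF QM]
    by (simp del: index_mult_mat)
qed (use carrier_matD[OF AQ] carrier_matD[OF QR(2)] in \<open>simp_all del: index_mult_mat\<close>)

lemma mult_vec_closed[simp]: "B \<in> carrier_mat n m \<Longrightarrow> x \<in> carrier_vec m \<Longrightarrow> B *\<^sub>v x \<in> carrier_vec n" for B :: "real mat"
  by (rule mult_mat_vec_carrier)

lemma recurrence_vec:
  assumes x: "x \<in> carrier_vec b"
  shows "A *\<^sub>v (Q (Suc k) *\<^sub>v x) = Q (Suc (Suc k)) *\<^sub>v (R (Suc (Suc k)) *\<^sub>v x)
    + Q (Suc k) *\<^sub>v (M (Suc k) *\<^sub>v x) + Q k *\<^sub>v ((R (Suc k))\<^sup>T *\<^sub>v x)"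
proof -
  have "A *\<^sub>v (Q (Suc k) *\<^sub>v x) = (A * Q (Suc k)) *\<^sub>v x"
    by (rule assoc_mult_mat_vec[OF A Q x, symmetric])
  also have "\<dots> = (Q (Suc (Suc k)) * R (Suc (Suc k))) *\<^sub>v x + (Q (Suc k) * M (Suc k)) *\<^sub>v x + (Q k * (R (Suc k))\<^sup>T) *\<^sub>v x"
    unfolding recurrence
    using add_mult_distrib_mat_vec[OF add_carrier_mat[OF QM] QR(2) x] add_mult_distrib_mat_vec[OF QR(1) QM x]
    by simp
  also have "\<dots> = Q (Suc (Suc k)) *\<^sub>v (R (Suc (Suc k)) *\<^sub>v x)
    + Q (Suc k) *\<^sub>v (M (Suc k) *\<^sub>v x) + Q k *\<^sub>v ((R (Suc k))\<^sup>T *\<^sub>v x)"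
    using assoc_mult_mat_vec[OF Q R x] assoc_mult_mat_vec[OF Q M x] assoc_mult_mat_vec[OF Q RT x]
    by simp
  finally show ?thesis .
qed

text \<open>The leading term of the block \<open>Q (Suc k)\<close> in \<open>Z, A Z, \<dots>\<close> is \<open>A ^ k Z D\<inverse>\<close>, where \<open>D\<close> is the
  product of the triangular factors so far; linear independence makes each of them invertible.\<close>
lemma leading_term:
  assumes "k < s"
  shows "(\<exists>D\<in>carrier_mat b b. (\<forall>x\<in>carrier_vec b. D *\<^sub>v x = 0\<^sub>v b \<longrightarrow> x = 0\<^sub>v b)
      \<and> (\<forall>x\<in>carrier_vec b. (A ^\<^sub>m k * Z) *\<^sub>v x - Q (Suc k) *\<^sub>v (D *\<^sub>v x) \<in> K k))
    \<and> (\<forall>j\<le>Suc k. \<forall>x\<in>carrier_vec b. Q j *\<^sub>v x \<in> K j)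
    \<and> (\<exists>C\<in>carrier_mat b b. R (Suc k) * C = 1\<^sub>m b)"
proof -
  \<comment> \<open>Solving \<open>D x = y\<close> turns the relation for the leading term into
    membership of \<open>Q (Suc k) y\<close> in the Krylov space.\<close>
  have Q_in_K: "Q (Suc k) *\<^sub>v y \<in> K (Suc k)"
    if D: "D \<in> carrier_mat b b" "\<forall>x\<in>carrier_vec b. D *\<^sub>v x = 0\<^sub>v b \<longrightarrow> x = 0\<^sub>v b"
      "\<forall>x\<in>carrier_vec b. (A ^\<^sub>m k * Z) *\<^sub>v x - Q (Suc k) *\<^sub>v (D *\<^sub>v x) \<in> K k"
      and y: "y \<in> carrier_vec b" for D y k
  proof -
    obtain C where C: "C \<in> carrier_mat b b" "D * C = 1\<^sub>m b" using inverse_of_injective_mat[OF D(1)] D(2) by blast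
    let ?x = "C *\<^sub>v y"
    have x: "?x \<in> carrier_vec b" using C y by simp
    have Dx: "D *\<^sub>v ?x = y" using assoc_mult_mat_vec[OF D(1) C(1) y] C(2) y by simp
    have "(A ^\<^sub>m k * Z) *\<^sub>v ?x - Q (Suc k) *\<^sub>v y \<in> K (Suc k)"
      using D(3)[rule_format, OF x] K_Suc unfolding Dx by blast
    from K_minus[OF K_top[OF x] this]
    have "(A ^\<^sub>m k * Z) *\<^sub>v ?x - ((A ^\<^sub>m k * Z) *\<^sub>v ?x - Q (Suc k) *\<^sub>v y) \<in> K (Suc k)" .
    also have "(A ^\<^sub>m k * Z) *\<^sub>v ?x - ((A ^\<^sub>m k * Z) *\<^sub>v ?x - Q (Suc k) *\<^sub>v y) = Q (Suc k) *\<^sub>v y"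
      using carrier_vecD[OF mult_vec_closed[OF AkZ x]] carrier_vecD[OF mult_vec_closed[OF Q y]]
      by (intro eq_vecI) (simp_all del: index_mult_mat_vec)
    finally show ?thesis .
  qed
  have R_inv: "\<exists>C\<in>carrier_mat b b. R k * C = 1\<^sub>m b"
    if D: "D \<in> carrier_mat b b" "\<And>x. x \<in> carrier_vec b \<Longrightarrow> R k *\<^sub>v (D *\<^sub>v x) = 0\<^sub>v b \<Longrightarrow> x = 0\<^sub>v b" for D k
  proof -
    have RD: "R k * D \<in> carrier_mat b b" using D(1) by (intro mult_carrier_mat[OF R])
    obtain C where C: "C \<in> carrier_mat b b" "(R k * D) * C = 1\<^sub>m b"
      using inverse_of_injective_mat[OF RD] D(2) assoc_mult_mat_vec[OF R D(1)] by metis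
    then show ?thesis using assoc_mult_mat[OF R D(1) C(1)] mult_carrier_mat[OF D(1) C(1)] by metis
  qed
  show ?thesis using assms
  proof (induction k)
    case 0
    have Z0: "A ^\<^sub>m 0 * Z = Q 1 * R 1" using first(4) A Z by simp
    have top: "(A ^\<^sub>m 0 * Z) *\<^sub>v x = Q (Suc 0) *\<^sub>v (R (Suc 0) *\<^sub>v x)" if "x \<in> carrier_vec b" for x
      unfolding Z0 using assoc_mult_mat_vec[OF Q R that] by simp
    have inj: "x = 0\<^sub>v b" if x: "x \<in> carrier_vec b" "R (Suc 0) *\<^sub>v x = 0\<^sub>v b" for x
    proof (rule K_independent[OF 0 x(1)])
      have "(A ^\<^sub>m 0 * Z) *\<^sub>v x = 0\<^sub>v d"
        unfolding top[OF x(1)] x(2) using carrier_matD[OF Q] by (intro eq_vecI) auto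
      then show "(A ^\<^sub>m 0 * Z) *\<^sub>v x \<in> K 0" using K_0 by simp
    qed
    have lead: "\<forall>x\<in>carrier_vec b. (A ^\<^sub>m 0 * Z) *\<^sub>v x - Q (Suc 0) *\<^sub>v (R (Suc 0) *\<^sub>v x) \<in> K 0"
    proof
      fix x :: "real vec" assume x: "x \<in> carrier_vec b"
      have "Q (Suc 0) *\<^sub>v (R (Suc 0) *\<^sub>v x) - Q (Suc 0) *\<^sub>v (R (Suc 0) *\<^sub>v x) = 0\<^sub>v d"
        using mult_vec_closed[OF Q mult_vec_closed[OF R x]] by (rule minus_cancel_vec)
      then show "(A ^\<^sub>m 0 * Z) *\<^sub>v x - Q (Suc 0) *\<^sub>v (R (Suc 0) *\<^sub>v x) \<in> K 0"
        unfolding top[OF x] using K_0 by simp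
    qed
    have "Q j *\<^sub>v x \<in> K j" if "j \<le> Suc 0" "x \<in> carrier_vec b" for j x
    proof (cases j)
      case 0
      have "0\<^sub>m d b *\<^sub>v x = 0\<^sub>v d" using that(2) by (intro eq_vecI) auto
      then show ?thesis using 0 K_0 by (simp add: Q_0)
    next
      case (Suc i)
      then have "j = Suc 0" using that by simp
      then show ?thesis using Q_in_K[of "R (Suc 0)" 0 x] inj lead that(2) by simp
    qed
    moreover have "\<exists>C\<in>carrier_mat b b. R (Suc 0) * C = 1\<^sub>m b"
      using inverse_of_injective_mat[OF R inj] by metis
    ultimately show ?case using inj lead R by blast
  next
    case (Suc k)
    then have k: "k < s" by simp
    from Suc.IH[OF k] obtain D where D: "D \<in> carrier_mat b b"
      and Dinj: "\<And>x. x \<in> carrier_vec b \<Longrightarrow> D *\<^sub>v x = 0\<^sub>v b \<Longrightarrow> x = 0\<^sub>v b"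
      and Dlead: "\<And>x. x \<in> carrier_vec b \<Longrightarrow> (A ^\<^sub>m k * Z) *\<^sub>v x - Q (Suc k) *\<^sub>v (D *\<^sub>v x) \<in> K k"
      by blast
    from Suc.IH[OF k] have QK: "\<And>j x. j \<le> Suc k \<Longrightarrow> x \<in> carrier_vec b \<Longrightarrow> Q j *\<^sub>v x \<in> K j" by blast
    \<comment> \<open>By the recurrence, \<open>A\<close> sends the current block to
      \<open>Q (Suc (Suc k)) R (Suc (Suc k))\<close> plus terms in \<open>K (Suc k)\<close>, so the
      leading coefficient gains the factor \<open>R (Suc (Suc k))\<close> on the left.\<close>
    let ?D = "R (Suc (Suc k)) * D"
    have D': "?D \<in> carrier_mat b b" using D by (intro mult_carrier_mat[OF R])
    have D'x: "?D *\<^sub>v x = R (Suc (Suc k)) *\<^sub>v (D *\<^sub>v x)" if "x \<in> carrier_vec b" for x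
      by (rule assoc_mult_mat_vec[OF R D that])
    have lead: "(A ^\<^sub>m Suc k * Z) *\<^sub>v x - Q (Suc (Suc k)) *\<^sub>v (?D *\<^sub>v x) \<in> K (Suc k)"
      if x: "x \<in> carrier_vec b" for x
    proof -
      let ?y = "D *\<^sub>v x"
      have y: "?y \<in> carrier_vec b" using D x by simp
      have 1: "A *\<^sub>v ((A ^\<^sub>m k * Z) *\<^sub>v x - Q (Suc k) *\<^sub>v ?y) \<in> K (Suc k)"
        by (rule K_mult[OF Dlead[OF x]])
      have 2: "Q (Suc k) *\<^sub>v (M (Suc k) *\<^sub>v ?y) \<in> K (Suc k)"
        using QK[OF order_refl mult_vec_closed[OF M y]] .
      have "(R (Suc k))\<^sup>T *\<^sub>v ?y \<in> carrier_vec b" by (rule mult_vec_closed[OF RT y])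
      then have 3: "Q k *\<^sub>v ((R (Suc k))\<^sup>T *\<^sub>v ?y) \<in> K (Suc k)" using QK[of k] K_Suc by auto
      have "A *\<^sub>v ((A ^\<^sub>m k * Z) *\<^sub>v x - Q (Suc k) *\<^sub>v ?y)
          = A *\<^sub>v ((A ^\<^sub>m k * Z) *\<^sub>v x) - A *\<^sub>v (Q (Suc k) *\<^sub>v ?y)"
        by (rule mult_minus_distrib_mat_vec[OF A mult_vec_closed[OF AkZ x] mult_vec_closed[OF Q y]])
      also have "A *\<^sub>v ((A ^\<^sub>m k * Z) *\<^sub>v x) = (A ^\<^sub>m Suc k * Z) *\<^sub>v x"
        by (rule mult_AkZ[OF x])
      finally have "A *\<^sub>v ((A ^\<^sub>m k * Z) *\<^sub>v x - Q (Suc k) *\<^sub>v ?y) + Q (Suc k) *\<^sub>v (M (Suc k) *\<^sub>v ?y)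
          + Q k *\<^sub>v ((R (Suc k))\<^sup>T *\<^sub>v ?y)
        = (A ^\<^sub>m Suc k * Z) *\<^sub>v x - Q (Suc (Suc k)) *\<^sub>v (?D *\<^sub>v x)"
        unfolding recurrence_vec[OF y] D'x[OF x]
        using carrier_vecD[OF mult_vec_closed[OF AkZ x, of "Suc k"]] carrier_vecD[OF mult_vec_closed[OF Q]]
          y mult_vec_closed[OF R y] mult_vec_closed[OF M y, of k] \<open>(R (Suc k))\<^sup>T *\<^sub>v ?y \<in> carrier_vec b\<close>
        by (intro eq_vecI) (simp_all del: index_mult_mat_vec)
      then show ?thesis using K_add[OF K_add[OF 1 2] 3] by simp
    qed
    \<comment> \<open>If \<open>?D\<close> annihilates \<open>x\<close>, then
      \<open>A^(k+1) Z x\<close> already lies in \<open>K (Suc k)\<close>, which the dimension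
      hypothesis allows only for \<open>x = 0\<close>.\<close>
    have inj: "x = 0\<^sub>v b" if x: "x \<in> carrier_vec b" "?D *\<^sub>v x = 0\<^sub>v b" for x
    proof (rule K_independent[OF Suc.prems x(1)])
      have "Q (Suc (Suc k)) *\<^sub>v 0\<^sub>v b = 0\<^sub>v d" using carrier_matD[OF Q] by (intro eq_vecI) auto
      then have "(A ^\<^sub>m Suc k * Z) *\<^sub>v x - Q (Suc (Suc k)) *\<^sub>v (?D *\<^sub>v x) = (A ^\<^sub>m Suc k * Z) *\<^sub>v x"
        unfolding x(2) using mult_vec_closed[OF AkZ x(1), of "Suc k"] by (intro eq_vecI) (simp_all del: index_mult_mat_vec)
      then show "(A ^\<^sub>m Suc k * Z) *\<^sub>v x \<in> K (Suc k)" using lead[OF x(1)] by simp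
    qed
    have "Q j *\<^sub>v x \<in> K j" if "j \<le> Suc (Suc k)" "x \<in> carrier_vec b" for j x
      using that QK Q_in_K[OF D', of "Suc k"] inj lead by (cases "j = Suc (Suc k)") auto
    moreover have "\<exists>C\<in>carrier_mat b b. R (Suc (Suc k)) * C = 1\<^sub>m b"
      using R_inv[OF D, of "Suc (Suc k)"] inj D'x by metis
    ultimately show ?case using inj lead D' by blast
  qed
qed

lemma R_right_inverse:
  assumes "k < s" obtains C where "C \<in> carrier_mat b b" "R (Suc k) * C = 1\<^sub>m b"
  using leading_term[OF assms] by blast

lemma assoc_QT:
  assumes "B \<in> carrier_mat b b"
  shows "(Q i)\<^sup>T * (Q j * B) = ((Q i)\<^sup>T * Q j) * B"
  by (rule assoc_mult_mat[of _ b d _ b _ b, symmetric]) (use assms in auto)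

lemma QT[simp]: "(Q i)\<^sup>T \<in> carrier_mat b d" by simp

lemma QTQ[simp]: "(Q i)\<^sup>T * Q j \<in> carrier_mat b b"
  by (rule mult_carrier_mat[OF QT Q])

text \<open>Symmetry moves \<open>A\<close> to the left factor, where the recurrence expands
  it.\<close>

lemma QTAQ: "(Q (Suc i))\<^sup>T * (A * Q j) = (R (Suc (Suc i)))\<^sup>T * ((Q (Suc (Suc i)))\<^sup>T * Q j)
    + (M (Suc i))\<^sup>T * ((Q (Suc i))\<^sup>T * Q j) + R (Suc i) * ((Q i)\<^sup>T * Q j)"
proof -
  have t: "((Q i)\<^sup>T)\<^sup>T = Q i" for i by simp
  have c: "(Q i * B)\<^sup>T * Q j = B\<^sup>T * ((Q i)\<^sup>T * Q j)" if B: "B \<in> carrier_mat b b" for i B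
    unfolding transpose_mult[OF Q B] by (rule assoc_mult_mat[of _ b b _ d _ b]) (use B in auto)
  have "(Q (Suc i))\<^sup>T * (A * Q j) = ((Q (Suc i))\<^sup>T * A) * Q j"
    by (rule assoc_mult_mat[OF QT A Q, symmetric])
  also have "(Q (Suc i))\<^sup>T * A = (A * Q (Suc i))\<^sup>T"
    using transpose_mult[OF A Q, of "Suc i"] sym by simp
  also have "(A * Q (Suc i))\<^sup>T = (Q (Suc (Suc i)) * R (Suc (Suc i)))\<^sup>T + (Q (Suc i) * M (Suc i))\<^sup>T
      + (Q i * (R (Suc i))\<^sup>T)\<^sup>T"
    unfolding recurrence using transpose_add[OF add_carrier_mat[OF QM] QR(2)] transpose_add[OF QR(1) QM]
    by metis
  also have "\<dots> * Q j = (Q (Suc (Suc i)) * R (Suc (Suc i)))\<^sup>T * Q j + (Q (Suc i) * M (Suc i))\<^sup>T * Q j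
      + (Q i * (R (Suc i))\<^sup>T)\<^sup>T * Q j"
  proof -
    have m: "(Q (Suc (Suc i)) * R (Suc (Suc i)))\<^sup>T \<in> carrier_mat b d" "(Q (Suc i) * M (Suc i))\<^sup>T \<in> carrier_mat b d"
      "(Q i * (R (Suc i))\<^sup>T)\<^sup>T \<in> carrier_mat b d"
      by (simp_all del: index_mult_mat)
    show ?thesis
      using add_mult_distrib_mat[OF add_carrier_mat[OF m(2)] m(3) Q] add_mult_distrib_mat[OF m(1,2) Q] by simp
  qed
  also have "\<dots> = (R (Suc (Suc i)))\<^sup>T * ((Q (Suc (Suc i)))\<^sup>T * Q j)
    + (M (Suc i))\<^sup>T * ((Q (Suc i))\<^sup>T * Q j) + R (Suc i) * ((Q i)\<^sup>T * Q j)"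
    by (simp add: c[OF R] c[OF M] c[OF RT] del: transpose_mult)
  finally show ?thesis .
qed

text \<open>A QR routine guarantees orthonormal columns within a block only. Orthogonality to
  earlier blocks holds first for the residual \<open>Q R\<close>, and passes to \<open>Q\<close>
  because \<open>R\<close> is invertible on a successful run; for a singular \<open>R\<close> the
  routine could return arbitrary directions.\<close>

lemma orthonormal_blocks:
  assumes "k < s"
  shows "\<forall>i\<le>k. \<forall>j\<le>k. (Q (Suc i))\<^sup>T * Q (Suc j) = (if i = j then 1\<^sub>m b else 0\<^sub>m b b)"
  using assms
proof (induction k)
  case 0
  then show ?case using Q_normalized by simp
next
  case (Suc k)
  then have IH: "\<And>i j. i \<le> k \<Longrightarrow> j \<le> k \<Longrightarrow> (Q (Suc i))\<^sup>T * Q (Suc j) = (if i = j then 1\<^sub>m b else 0\<^sub>m b b)"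
    by simp
  have new: "(Q (Suc i))\<^sup>T * Q (Suc (Suc k)) = 0\<^sub>m b b" if i: "i \<le> k" for i
  proof -
    let ?N = "A * Q (Suc k) - Q k * (R (Suc k))\<^sup>T - Q (Suc k) * M (Suc k)"
    have X: "(Q (Suc i))\<^sup>T * ?N = 0\<^sub>m b b"
    proof (cases "i = k")
      case True
      \<comment> \<open>For the current block the cancellation is the choice of \<open>M\<close> as
        the projection coefficient of \<open>W\<close>.\<close>
      have "(Q (Suc k))\<^sup>T * ?N = (Q (Suc k))\<^sup>T * (A * Q (Suc k) - Q k * (R (Suc k))\<^sup>T)
          - (Q (Suc k))\<^sup>T * (Q (Suc k) * M (Suc k))"
        by (rule mult_minus_distrib_mat[OF QT W QM])
      also have "(Q (Suc k))\<^sup>T * (Q (Suc k) * M (Suc k)) = M (Suc k)"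
        unfolding assoc_QT[OF M] Q_normalized by (rule left_mult_one_mat[OF M])
      also have "(Q (Suc k))\<^sup>T * (A * Q (Suc k) - Q k * (R (Suc k))\<^sup>T) = M (Suc k)"
        by (simp add: lanczos_M_def)
      also have "M (Suc k) - M (Suc k) = 0\<^sub>m b b" by (rule minus_r_inv_mat[OF M])
      finally show ?thesis using True by simp
    next
      case False
      then have ik: "i < k" using i by simp
      then obtain k' where k': "k = Suc k'" by (cases k) auto
      have "(Q (Suc i))\<^sup>T * ?N = (Q (Suc i))\<^sup>T * (A * Q (Suc k) - Q k * (R (Suc k))\<^sup>T)
          - (Q (Suc i))\<^sup>T * (Q (Suc k) * M (Suc k))"
        by (rule mult_minus_distrib_mat[OF QT W QM])
      also have "(Q (Suc i))\<^sup>T * (Q (Suc k) * M (Suc k)) = 0\<^sub>m b b"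
        unfolding assoc_QT[OF M] using IH[OF i order_refl] False left_mult_zero_mat[OF M] by simp
      also have "(Q (Suc i))\<^sup>T * (A * Q (Suc k) - Q k * (R (Suc k))\<^sup>T)
          = (Q (Suc i))\<^sup>T * (A * Q (Suc k)) - (Q (Suc i))\<^sup>T * (Q k * (R (Suc k))\<^sup>T)"
        by (rule mult_minus_distrib_mat[OF QT AQ QR(2)])
      \<comment> \<open>Among the earlier blocks only \<open>i + 1 = k\<close> sees a nonzero term,
        and the subtracted \<open>Q k R^T\<close> produces the same block there.\<close>
      also have "(Q (Suc i))\<^sup>T * (A * Q (Suc k)) = (if Suc i = k then (R (Suc k))\<^sup>T else 0\<^sub>m b b)"
      proof -
        \<comment> \<open>For \<open>i = 0\<close> this is the artificial zero block, which is
          outside the orthonormal family and so treated separately.\<close>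
        have "(Q i)\<^sup>T * Q (Suc k) = 0\<^sub>m b b"
        proof (cases i)
          case 0
          then show ?thesis using left_mult_zero_mat[OF Q] by (simp add: Q_0)
        next
          case (Suc i')
          then show ?thesis using IH[of i' k] ik by simp
        qed
        then show ?thesis
          unfolding QTAQ
          using IH[of "Suc i" k] IH[of i k] ik right_mult_zero_mat[OF R] RT[of "Suc (Suc i)"]
            right_mult_zero_mat[OF transpose_carrier_mat[THEN iffD2, OF M]] right_mult_zero_mat[OF RT]
            right_mult_one_mat[OF RT] right_add_zero_mat[OF RT]
          by auto
      qed
      also have "(Q (Suc i))\<^sup>T * (Q k * (R (Suc k))\<^sup>T) = (if Suc i = k then (R (Suc k))\<^sup>T else 0\<^sub>m b b)"
        unfolding assoc_QT[OF RT] using IH[of i k'] ik k' left_mult_one_mat[OF RT] left_mult_zero_mat[OF RT] by auto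
      also have "(if Suc i = k then (R (Suc k))\<^sup>T else 0\<^sub>m b b) - (if Suc i = k then (R (Suc k))\<^sup>T else 0\<^sub>m b b)
          - 0\<^sub>m b b = 0\<^sub>m b b"
        using carrier_matD[OF RT] by (intro eq_matI) auto
      finally show ?thesis .
    qed
    \<comment> \<open>The right inverse cancels \<open>R\<close> from the product of an earlier
      block with the residual.\<close>
    obtain C where C: "C \<in> carrier_mat b b" "R (Suc (Suc k)) * C = 1\<^sub>m b"
      using R_right_inverse[OF Suc.prems] by blast
    have "(Q (Suc i))\<^sup>T * Q (Suc (Suc k)) = ((Q (Suc i))\<^sup>T * Q (Suc (Suc k))) * (R (Suc (Suc k)) * C)"
      unfolding C(2) by (rule right_mult_one_mat[OF QTQ, symmetric])
    also have "\<dots> = ((Q (Suc i))\<^sup>T * (Q (Suc (Suc k)) * R (Suc (Suc k)))) * C"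
      unfolding assoc_QT[OF R] by (rule assoc_mult_mat[OF QTQ R C(1), symmetric])
    also have "\<dots> = 0\<^sub>m b b" unfolding residual X using C(1) by simp
    finally show ?thesis .
  qed
  have new': "(Q (Suc (Suc k)))\<^sup>T * Q (Suc i) = 0\<^sub>m b b" if "i \<le> k" for i
    using arg_cong[OF new[OF that], of transpose_mat] transpose_mult[OF QT Q, of "Suc i" "Suc (Suc k)"] by simp
  show ?case using IH new new' Q_normalized by (auto simp: le_Suc_eq)
qed

lemma Qbar_orthonormal:
  assumes "k \<le> s"
  shows "(lanczos_Qbar qr A Z k)\<^sup>T * lanczos_Qbar qr A Z k = 1\<^sub>m (k * b)"
proof (rule eq_matI)
  fix i j assume "i < dim_row (1\<^sub>m (k * b))" "j < dim_col (1\<^sub>m (k * b))"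
  then have ij: "i < k * b" "j < k * b" by simp_all
  note i = div_mod_less[OF ij(1)] and j = div_mod_less[OF ij(2)]
  have "((lanczos_Qbar qr A Z k)\<^sup>T * lanczos_Qbar qr A Z k) $$ (i, j)
      = (\<Sum>r<d. Q (Suc (i div b)) $$ (r, i mod b) * Q (Suc (j div b)) $$ (r, j mod b))"
    using ij by (simp add: lanczos_Qbar_def scalar_prod_def atLeast0LessThan)
  also have "\<dots> = ((Q (Suc (i div b)))\<^sup>T * Q (Suc (j div b))) $$ (i mod b, j mod b)"
    using i j carrier_matD[OF Q] by (simp add: scalar_prod_def atLeast0LessThan)
  also have "\<dots> = (if i div b = j div b then 1\<^sub>m b else 0\<^sub>m b b) $$ (i mod b, j mod b)"
    using orthonormal_blocks[of "k - 1"] i(1) j(1) assms by auto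
  also have "\<dots> = 1\<^sub>m (k * b) $$ (i, j)"
    using ij i j by (auto) (metis div_mult_mod_eq)+
  finally show "((lanczos_Qbar qr A Z k)\<^sup>T * lanczos_Qbar qr A Z k) $$ (i, j) = 1\<^sub>m (k * b) $$ (i, j)" .
qed (simp_all add: lanczos_Qbar_def)

end

section \<open>Orthogonal diagonalization\<close>

lemma orth_diag_carrier:
  fixes U :: "real mat"
  assumes "U \<in> carrier_mat d d"
  shows "U * mat_diag d l * U\<^sup>T \<in> carrier_mat d d"
  using assms by (auto intro!: mult_carrier_mat)

lemma orth_diag_index:
  fixes U :: "real mat"
  assumes U: "U \<in> carrier_mat d d" and ij: "i < d" "j < d"
  shows "(U * mat_diag d l * U\<^sup>T) $$ (i, j) = (\<Sum>a<d. l a * (U $$ (i, a) * U $$ (j, a)))"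
proof -
  have "(U * mat_diag d l) $$ (i, a) = U $$ (i, a) * l a" if "a < d" for a
    using U ij that by (subst mat_diag_mult_right) auto
  moreover have UD: "U * mat_diag d l \<in> carrier_mat d d" using U by (auto intro!: mult_carrier_mat)
  ultimately have "row (U * mat_diag d l) i \<bullet> col U\<^sup>T j = (\<Sum>a<d. (U $$ (i, a) * l a) * U $$ (j, a))"
    unfolding scalar_prod_def using U ij carrier_matD[OF UD]
    by (auto intro!: sum.cong simp: atLeast0LessThan simp del: index_mult_mat(1))
  then show ?thesis using U ij carrier_matD[OF UD]
    by (subst index_mult_mat(1)) (auto simp: mult_ac)
qed

lemma orth_cols_sum:
  fixes U :: "real mat"
  assumes U: "U \<in> carrier_mat d d" "U\<^sup>T * U = 1\<^sub>m d" and ab: "a < d" "b < d"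
  shows "(\<Sum>i<d. U $$ (i, a) * U $$ (i, b)) = of_bool (a = b)"
proof -
  have "(U\<^sup>T * U) $$ (a, b) = (\<Sum>i<d. U $$ (i, a) * U $$ (i, b))"
    using U(1) ab by (simp add: scalar_prod_def atLeast0LessThan)
  then show ?thesis unfolding U(2) using ab by (simp split: if_splits)
qed

lemma trace_orth_diag:
  fixes U :: "real mat"
  assumes U: "U \<in> carrier_mat d d" "U\<^sup>T * U = 1\<^sub>m d"
  shows "trace (U * mat_diag d l * U\<^sup>T) = (\<Sum>a<d. l a)"
proof -
  have "trace (U * mat_diag d l * U\<^sup>T) = (\<Sum>i<d. \<Sum>a<d. l a * (U $$ (i, a) * U $$ (i, a)))"
    unfolding trace_def carrier_matD[OF orth_diag_carrier[OF U(1)]]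
    by (intro sum.cong refl orth_diag_index[OF U(1)]) simp_all
  also have "\<dots> = (\<Sum>a<d. l a * (\<Sum>i<d. U $$ (i, a) * U $$ (i, a)))"
    unfolding sum_distrib_left by (rule sum.swap)
  also have "\<dots> = (\<Sum>a<d. l a)" by (intro sum.cong) (auto simp: orth_cols_sum[OF U])
  finally show ?thesis .
qed

lemma frob_norm_square: "(frob_norm B)\<^sup>2 = (\<Sum>i<dim_row B. \<Sum>j<dim_col B. (B $$ (i, j))\<^sup>2)"
  unfolding frob_norm_def by (intro real_sqrt_pow2 sum_nonneg) auto

lemma frob_norm_orth_diag:
  fixes U :: "real mat"
  assumes U: "U \<in> carrier_mat d d" "U\<^sup>T * U = 1\<^sub>m d"
  shows "(frob_norm (U * mat_diag d l * U\<^sup>T))\<^sup>2 = (\<Sum>a<d. (l a)\<^sup>2)"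
proof -
  let ?u = "\<lambda>i a. U $$ (i, a)"
  have "(frob_norm (U * mat_diag d l * U\<^sup>T))\<^sup>2 = (\<Sum>i<d. \<Sum>j<d. (\<Sum>a<d. l a * (?u i a * ?u j a))\<^sup>2)"
    unfolding frob_norm_square carrier_matD[OF orth_diag_carrier[OF U(1)]]
    by (intro sum.cong refl) (simp add: orth_diag_index[OF U(1)] del: index_mult_mat)
  also have "\<dots> = (\<Sum>i<d. \<Sum>j<d. \<Sum>a<d. \<Sum>b<d. l a * l b * ((?u i a * ?u i b) * (?u j a * ?u j b)))"
    unfolding power2_eq_square sum_product by (simp add: mult_ac)
  also have "\<dots> = (\<Sum>i<d. \<Sum>a<d. \<Sum>j<d. \<Sum>b<d. l a * l b * ((?u i a * ?u i b) * (?u j a * ?u j b)))"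
    by (intro sum.cong refl sum.swap)
  also have "\<dots> = (\<Sum>a<d. \<Sum>i<d. \<Sum>j<d. \<Sum>b<d. l a * l b * ((?u i a * ?u i b) * (?u j a * ?u j b)))"
    by (rule sum.swap)
  also have "\<dots> = (\<Sum>a<d. \<Sum>i<d. \<Sum>b<d. \<Sum>j<d. l a * l b * ((?u i a * ?u i b) * (?u j a * ?u j b)))"
    by (intro sum.cong refl sum.swap)
  also have "\<dots> = (\<Sum>a<d. \<Sum>b<d. \<Sum>i<d. \<Sum>j<d. l a * l b * ((?u i a * ?u i b) * (?u j a * ?u j b)))"
    by (intro sum.cong refl sum.swap)
  also have "\<dots> = (\<Sum>a<d. \<Sum>b<d. l a * l b * ((\<Sum>i<d. ?u i a * ?u i b) * (\<Sum>j<d. ?u j a * ?u j b)))"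
    unfolding sum_product by (simp only: sum_distrib_left)
  also have "\<dots> = (\<Sum>a<d. \<Sum>b<d. if a = b then (l a)\<^sup>2 else 0)"
    by (intro sum.cong) (auto simp: orth_cols_sum[OF U] power2_eq_square)
  finally show ?thesis by simp
qed

lemma orth_diag_quadratic:
  fixes U :: "real mat"
  assumes U: "U \<in> carrier_mat d d" and x: "x \<in> carrier_vec d"
  shows "x \<bullet> ((U * mat_diag d l * U\<^sup>T) *\<^sub>v x) = (\<Sum>a<d. l a * (\<Sum>j<d. U $$ (j, a) * x $ j)\<^sup>2)"
proof -
  let ?F = "U * mat_diag d l * U\<^sup>T"
  have F: "?F \<in> carrier_mat d d" using U by (auto intro!: mult_carrier_mat)
  have "x \<bullet> (?F *\<^sub>v x) = (\<Sum>i<d. x $ i * (\<Sum>j<d. ?F $$ (i, j) * x $ j))"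
    using F x by (simp add: scalar_prod_def atLeast0LessThan del: index_mult_mat)
  also have "\<dots> = (\<Sum>i<d. \<Sum>j<d. \<Sum>a<d. l a * ((U $$ (i, a) * x $ i) * (U $$ (j, a) * x $ j)))"
    by (intro sum.cong refl)
      (simp add: orth_diag_index[OF U] sum_distrib_left sum_distrib_right mult_ac del: index_mult_mat)
  also have "\<dots> = (\<Sum>i<d. \<Sum>a<d. \<Sum>j<d. l a * ((U $$ (i, a) * x $ i) * (U $$ (j, a) * x $ j)))"
    by (intro sum.cong refl sum.swap)
  also have "\<dots> = (\<Sum>a<d. \<Sum>i<d. \<Sum>j<d. l a * ((U $$ (i, a) * x $ i) * (U $$ (j, a) * x $ j)))"
    by (rule sum.swap)
  also have "\<dots> = (\<Sum>a<d. l a * (\<Sum>j<d. U $$ (j, a) * x $ j)\<^sup>2)"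
    unfolding power2_eq_square sum_product by (simp only: sum_distrib_left)
  finally show ?thesis .
qed

lemma smult_mat_mult_vec:
  fixes B :: "real mat"
  assumes "B \<in> carrier_mat n m" "x \<in> carrier_vec m"
  shows "(c \<cdot>\<^sub>m B) *\<^sub>v x = c \<cdot>\<^sub>v (B *\<^sub>v x)"
  using assms by (intro eq_vecI) (auto simp: scalar_prod_def sum_distrib_left mult.assoc)

lemma orth_diagI:
  fixes U :: "real mat"
  assumes U: "U \<in> carrier_mat d d" "U\<^sup>T * U = 1\<^sub>m d" and M: "M \<in> carrier_mat d d"
    and ev: "\<And>a. a < d \<Longrightarrow> M *\<^sub>v col U a = l a \<cdot>\<^sub>v col U a"
  shows "M = U * mat_diag d l * U\<^sup>T"
proof -
  have UU: "U * U\<^sup>T = 1\<^sub>m d" using mat_mult_left_right_inverse[OF _ U(1) U(2)] U(1) by simp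
  have MU: "M * U = U * mat_diag d l"
  proof (rule eq_matI)
    fix i j assume "i < dim_row (U * mat_diag d l)" "j < dim_col (U * mat_diag d l)"
    then have ij: "i < d" "j < d" using U(1) by (auto simp: mat_diag_def)
    have "(M * U) $$ (i, j) = (M *\<^sub>v col U j) $ i" using M U(1) ij by simp
    also have "\<dots> = l j * U $$ (i, j)" unfolding ev[OF ij(2)] using U(1) ij by simp
    also have "\<dots> = (U * mat_diag d l) $$ (i, j)"
      using U(1) ij by (subst mat_diag_mult_right) auto
    finally show "(M * U) $$ (i, j) = (U * mat_diag d l) $$ (i, j)" .
  qed (use M U in \<open>auto simp: mat_diag_def\<close>)
  have "M = M * (U * U\<^sup>T)" unfolding UU using M by simp
  also have "\<dots> = M * U * U\<^sup>T" using M U(1) by (simp add: assoc_mult_mat[of _ d d _ d _ d])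
  finally show ?thesis unfolding MU .
qed

lemma orth_diag_eigen:
  fixes U :: "real mat"
  assumes U: "U \<in> carrier_mat d d" "U\<^sup>T * U = 1\<^sub>m d" and a: "a < d"
  shows "(U * mat_diag d l * U\<^sup>T) *\<^sub>v col U a = l a \<cdot>\<^sub>v col U a"
proof (rule eq_vecI)
  fix i assume "i < dim_vec (l a \<cdot>\<^sub>v col U a)"
  then have i: "i < d" using U(1) by simp
  have F: "U * mat_diag d l * U\<^sup>T \<in> carrier_mat d d" using U by (auto intro!: mult_carrier_mat)
  have "((U * mat_diag d l * U\<^sup>T) *\<^sub>v col U a) $ i = (\<Sum>j<d. (U * mat_diag d l * U\<^sup>T) $$ (i, j) * U $$ (j, a))"
    using F U(1) i a by (simp add: scalar_prod_def atLeast0LessThan del: index_mult_mat)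
  also have "\<dots> = (\<Sum>j<d. \<Sum>e<d. l e * U $$ (i, e) * (U $$ (j, e) * U $$ (j, a)))"
    using i by (intro sum.cong refl)
      (simp add: orth_diag_index[OF U(1)] sum_distrib_left sum_distrib_right mult_ac del: index_mult_mat)
  also have "\<dots> = (\<Sum>e<d. l e * U $$ (i, e) * (\<Sum>j<d. U $$ (j, e) * U $$ (j, a)))"
    unfolding sum_distrib_left by (rule sum.swap)
  also have "\<dots> = (\<Sum>e<d. if e = a then l e * U $$ (i, e) else 0)"
    using a by (intro sum.cong) (auto simp: orth_cols_sum[OF U])
  also have "\<dots> = (l a \<cdot>\<^sub>v col U a) $ i" using a i U(1) by simp
  finally show "((U * mat_diag d l * U\<^sup>T) *\<^sub>v col U a) $ i = (l a \<cdot>\<^sub>v col U a) $ i" .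
qed (use U in simp)

text \<open>For all but finitely many \<open>c\<close>, an eigenbasis of \<open>F + c (1 - P)\<close> diagonalizes \<open>F\<close> and \<open>P\<close>
  simultaneously.\<close>
lemma projection_simultaneous_diagonalization:
  fixes P F :: "real mat"
  assumes P: "P \<in> carrier_mat d d" "P\<^sup>T = P" "P * P = P"
    and F: "F \<in> carrier_mat d d" "F\<^sup>T = F" "P * F = F" "F * P = F"
  obtains U l J where "U \<in> carrier_mat d d" "U\<^sup>T * U = 1\<^sub>m d" "J \<subseteq> {..<d}"
    "P = U * mat_diag d (\<lambda>a. of_bool (a \<in> J)) * U\<^sup>T" "F = U * mat_diag d l * U\<^sup>T"
    "\<And>a. a < d \<Longrightarrow> a \<notin> J \<Longrightarrow> l a = 0"
proof -
  obtain V g where V: "V \<in> carrier_mat d d" "V\<^sup>T * V = 1\<^sub>m d" "F = V * mat_diag d g * V\<^sup>T"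
    using spectral_theorem[OF F(1,2)] by blast
  have VV: "V * V\<^sup>T = 1\<^sub>m d" using mat_mult_left_right_inverse[OF _ V(1) V(2)] V(1) by simp
  \<comment> \<open>With \<open>c\<close> outside the spectrum of \<open>F\<close>, the eigenvalue
    \<open>c\<close> of \<open>F + c (1 - P)\<close> can come only from the kernel of
    \<open>P\<close>.\<close>
  obtain c where c: "c \<notin> g ` {..<d}"
    using ex_new_if_finite[of "g ` {..<d}"] infinite_UNIV_char_0 by auto
  have not_eigen: "p = 0\<^sub>v d" if p: "p \<in> carrier_vec d" "F *\<^sub>v p = c \<cdot>\<^sub>v p" for p
  proof -
    define q where "q = V\<^sup>T *\<^sub>v p"
    have q: "q \<in> carrier_vec d" unfolding q_def using V(1) p by simp
    have "V\<^sup>T * F = V\<^sup>T * (V * (mat_diag d g * V\<^sup>T))"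
      unfolding V(3) using V(1) by (simp add: assoc_mult_mat[of _ d d _ d _ d])
    also have "\<dots> = (V\<^sup>T * V) * (mat_diag d g * V\<^sup>T)"
      by (rule assoc_mult_mat[symmetric, of _ d d _ d _ d]) (use V(1) in \<open>auto intro!: mult_carrier_mat\<close>)
    also have "\<dots> = mat_diag d g * V\<^sup>T"
      unfolding V(2) by (rule left_mult_one_mat) (use V(1) in \<open>auto intro!: mult_carrier_mat\<close>)
    finally have VF: "V\<^sup>T * F = mat_diag d g * V\<^sup>T" .
    have "mat_diag d g *\<^sub>v q = (V\<^sup>T * F) *\<^sub>v p"
      unfolding q_def VF using V(1) p by (intro assoc_mult_mat_vec[symmetric, of _ d d _ d]) auto
    also have "\<dots> = V\<^sup>T *\<^sub>v (c \<cdot>\<^sub>v p)"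
      unfolding p(2)[symmetric] using V(1) p F by (intro assoc_mult_mat_vec[of _ d d _ d]) auto
    also have "\<dots> = c \<cdot>\<^sub>v q" unfolding q_def using V(1) p by (intro mult_mat_vec[of _ d d]) auto
    finally have e: "mat_diag d g *\<^sub>v q = c \<cdot>\<^sub>v q" .
    have "q = 0\<^sub>v d"
    proof (rule eq_vecI)
      fix i assume "i < dim_vec (0\<^sub>v d)"
      then have i: "i < d" by simp
      have "(mat_diag d g *\<^sub>v q) $ i = (\<Sum>j<d. (if i = j then g j else 0) * q $ j)"
        using i q by (simp add: scalar_prod_def atLeast0LessThan mat_diag_def)
      also have "\<dots> = (\<Sum>j<d. if i = j then g j * q $ j else 0)" by (intro sum.cong) auto
      also have "\<dots> = g i * q $ i" using i by simp
      finally have "c * q $ i = g i * q $ i" unfolding e using i q by simp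
      moreover have "c \<noteq> g i" using c i by auto
      ultimately show "q $ i = 0\<^sub>v d $ i" using i by auto
    qed (use q in simp)
    moreover have "p = V *\<^sub>v q"
      unfolding q_def using assoc_mult_mat_vec[of V d d "V\<^sup>T" d p] V(1) VV p by simp
    ultimately show ?thesis using V(1) by auto
  qed
  define H where "H = F + c \<cdot>\<^sub>m (1\<^sub>m d - P)"
  have H: "H \<in> carrier_mat d d" unfolding H_def using P by (intro add_carrier_mat smult_carrier_mat minus_carrier_mat)
  have "H\<^sup>T = H"
    unfolding H_def
  proof (rule eq_matI)
    fix i j assume ij: "i < dim_row (F + c \<cdot>\<^sub>m (1\<^sub>m d - P))" "j < dim_col (F + c \<cdot>\<^sub>m (1\<^sub>m d - P))"
    have "F $$ (j, i) = F $$ (i, j)" "P $$ (j, i) = P $$ (i, j)"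
      using arg_cong[OF F(2), of "\<lambda>M. M $$ (i, j)"] arg_cong[OF P(2), of "\<lambda>M. M $$ (i, j)"] ij F(1) P(1) by auto
    then show "(F + c \<cdot>\<^sub>m (1\<^sub>m d - P))\<^sup>T $$ (i, j) = (F + c \<cdot>\<^sub>m (1\<^sub>m d - P)) $$ (i, j)"
      using ij F(1) P(1) by auto
  qed (use F P in auto)
  from spectral_theorem[OF H this] obtain U h where U: "U \<in> carrier_mat d d" "U\<^sup>T * U = 1\<^sub>m d"
    and Hd: "H = U * mat_diag d h * U\<^sup>T" by blast
  \<comment> \<open>These indices will span the range of \<open>P\<close>. Writing
    \<open>p = P u\<close> for an eigenvector \<open>u\<close>: if \<open>h a \<noteq> c\<close>,
    the eigenvector equation forces \<open>u = p\<close>; if \<open>h a = c\<close>, it gives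
    \<open>F p = c p\<close>, hence \<open>p = 0\<close>.\<close>
  define J where "J = {a. a < d \<and> h a \<noteq> c}"
  have ev: "P *\<^sub>v col U a = of_bool (a \<in> J) \<cdot>\<^sub>v col U a \<and>
      F *\<^sub>v col U a = (if a \<in> J then h a else 0) \<cdot>\<^sub>v col U a" if a: "a < d" for a
  proof -
    define u where "u = col U a"
    define p where "p = P *\<^sub>v u"
    have u: "u \<in> carrier_vec d" unfolding u_def using U a by simp
    have p: "p \<in> carrier_vec d" unfolding p_def using P u by simp
    have Fp: "F *\<^sub>v p = F *\<^sub>v u" unfolding p_def using assoc_mult_mat_vec[OF F(1) P(1) u] F(4) by simp
    have Fu: "F *\<^sub>v u \<in> carrier_vec d" using F u by simp
    have PF: "P *\<^sub>v (F *\<^sub>v u) = F *\<^sub>v u" using assoc_mult_mat_vec[OF P(1) F(1) u] F(3) by simp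
    have Pp: "P *\<^sub>v p = p" unfolding p_def using assoc_mult_mat_vec[OF P(1) P(1) u] P(3) by simp
    have Hu: "H *\<^sub>v u = h a \<cdot>\<^sub>v u" unfolding Hd u_def by (rule orth_diag_eigen[OF U a])
    have "H *\<^sub>v u = F *\<^sub>v u + c \<cdot>\<^sub>v (u - p)"
    proof -
      have 1: "1\<^sub>m d - P \<in> carrier_mat d d" using P by (intro minus_carrier_mat)
      have "(1\<^sub>m d - P) *\<^sub>v u = u - p"
        unfolding p_def using minus_mult_distrib_mat_vec[of "1\<^sub>m d" d d P u] P u by simp
      then have "(c \<cdot>\<^sub>m (1\<^sub>m d - P)) *\<^sub>v u = c \<cdot>\<^sub>v (u - p)"
        using smult_mat_mult_vec[OF 1 u] by simp
      then show ?thesis unfolding H_def using add_mult_distrib_mat_vec[OF F(1) _ u] 1 by simp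
    qed
    with Hu have E: "F *\<^sub>v u + c \<cdot>\<^sub>v (u - p) = h a \<cdot>\<^sub>v u" by simp
    have "P *\<^sub>v (h a \<cdot>\<^sub>v u) = P *\<^sub>v (F *\<^sub>v u) + P *\<^sub>v (c \<cdot>\<^sub>v (u - p))"
      unfolding E[symmetric] using P(1) Fu u p by (intro mult_add_distrib_mat_vec[of _ d d]) auto
    also have "P *\<^sub>v (c \<cdot>\<^sub>v (u - p)) = c \<cdot>\<^sub>v (P *\<^sub>v (u - p))"
      using P(1) u p by (intro mult_mat_vec[of _ d d]) auto
    also have "P *\<^sub>v (u - p) = 0\<^sub>v d"
      using mult_minus_distrib_mat_vec[OF P(1) u p] Pp p by (simp add: p_def[symmetric])
    also have "P *\<^sub>v (h a \<cdot>\<^sub>v u) = h a \<cdot>\<^sub>v p"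
      unfolding p_def using P(1) u by (intro mult_mat_vec[of _ d d]) auto
    also have "c \<cdot>\<^sub>v 0\<^sub>v d = 0\<^sub>v d" by (intro eq_vecI) auto
    \<comment> \<open>Applying \<open>P\<close> removes the term with \<open>c\<close>, since
      \<open>P (u - p) = 0\<close>, and leaves \<open>F u = h a p\<close>.\<close>
    finally have Fhp: "F *\<^sub>v u = h a \<cdot>\<^sub>v p" unfolding PF using Fu by auto
    show ?thesis
    proof (cases "a \<in> J")
      case True
      then have hc: "h a \<noteq> c" by (simp add: J_def)
      have "p = u"
      proof (rule eq_vecI)
        fix i assume "i < dim_vec u"
        then have i: "i < d" using u by simp
        have "h a * p $ i + c * (u $ i - p $ i) = h a * u $ i"
          using arg_cong[OF E[unfolded Fhp], of "\<lambda>v. vec_index v i"] i u p by simp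
        then have "(c - h a) * (u $ i - p $ i) = 0" by (simp add: algebra_simps)
        then show "p $ i = u $ i" using hc by simp
      qed (use u p in simp)
      then show ?thesis using True Fhp by (simp add: u_def p_def)
    next
      case False
      then have hc: "h a = c" using a by (simp add: J_def)
      have "p = 0\<^sub>v d" by (rule not_eigen[OF p]) (use Fp Fhp hc in simp)
      moreover from this have "F *\<^sub>v u = 0\<^sub>v d" using Fhp by auto
      moreover have "0 \<cdot>\<^sub>v u = 0\<^sub>v d" using u by auto
      ultimately show ?thesis using False by (simp add: u_def p_def)
    qed
  qed
  show ?thesis
  proof (rule that[OF U, of J "\<lambda>a. if a \<in> J then h a else 0"])
    show "P = U * mat_diag d (\<lambda>a. of_bool (a \<in> J)) * U\<^sup>T" by (rule orth_diagI[OF U P(1)]) (use ev in blast)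
    show "F = U * mat_diag d (\<lambda>a. if a \<in> J then h a else 0) * U\<^sup>T" by (rule orth_diagI[OF U F(1)]) (use ev in blast)
  qed (auto simp: J_def)
qed

section \<open>Complementary projectors and norms\<close>

lemma proj_compl_carrier: "Q \<in> carrier_mat d k \<Longrightarrow> proj_compl Q \<in> carrier_mat d d"
  unfolding proj_compl_def by (auto intro!: minus_carrier_mat)

lemma proj_compl_transpose: "Q \<in> carrier_mat d k \<Longrightarrow> (proj_compl Q)\<^sup>T = proj_compl Q"
  unfolding proj_compl_def
  by (subst transpose_minus[of _ d d]) (auto simp: transpose_mult[of Q d k "Q\<^sup>T" d])

lemma orthonormal_colsD: "orthonormal_cols Q \<Longrightarrow> Q \<in> carrier_mat d k \<Longrightarrow> Q\<^sup>T * Q = 1\<^sub>m k"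
  by (auto simp: orthonormal_cols_def)

lemma proj_compl_mult:
  assumes Q: "Q \<in> carrier_mat d k" "orthonormal_cols Q"
  shows "proj_compl Q * Q = 0\<^sub>m d k"
proof -
  have "proj_compl Q * Q = 1\<^sub>m d * Q - Q * Q\<^sup>T * Q"
    unfolding proj_compl_def using Q(1) by (subst minus_mult_distrib_mat[of _ d d _ _ k]) auto
  also have "Q * Q\<^sup>T * Q = Q * (Q\<^sup>T * Q)" using Q(1) by (intro assoc_mult_mat[of _ d k _ d _ k]) auto
  also have "\<dots> = Q" unfolding orthonormal_colsD[OF Q(2,1)] using Q(1) by simp
  finally show ?thesis using Q(1) by simp
qed

lemma mult_proj_compl:
  assumes B: "B \<in> carrier_mat n d" and Q: "Q \<in> carrier_mat d k" and 0: "B * Q = 0\<^sub>m n k"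
  shows "B * proj_compl Q = B"
proof -
  have "B * proj_compl Q = B * 1\<^sub>m d - B * (Q * Q\<^sup>T)"
    unfolding proj_compl_def using B Q by (subst mult_minus_distrib_mat[of _ n d _ d]) auto
  also have "B * (Q * Q\<^sup>T) = B * Q * Q\<^sup>T" using B Q by (intro assoc_mult_mat[symmetric, of _ n d _ k _ d]) auto
  also have "\<dots> = 0\<^sub>m n d" unfolding 0 using Q by simp
  also have "B * 1\<^sub>m d - 0\<^sub>m n d = B" using B by (intro eq_matI) auto
  finally show ?thesis .
qed

lemma proj_compl_idem:
  assumes Q: "Q \<in> carrier_mat d k" "orthonormal_cols Q"
  shows "proj_compl Q * proj_compl Q = proj_compl Q"
  by (rule mult_proj_compl[OF proj_compl_carrier[OF Q(1)] Q(1) proj_compl_mult[OF Q]])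

section \<open>Traces and the splitting along a projector\<close>

lemma trace_mult_comm:
  assumes "B \<in> carrier_mat n k" "C \<in> carrier_mat k n"
  shows "trace (B * C) = trace (C * B)"
proof -
  have "trace (B * C) = (\<Sum>i<n. \<Sum>j<k. B $$ (i, j) * C $$ (j, i))"
    using assms by (simp add: trace_def scalar_prod_def atLeast0LessThan)
  also have "\<dots> = (\<Sum>j<k. \<Sum>i<n. C $$ (j, i) * B $$ (i, j))"
    by (subst sum.swap) (simp add: mult.commute)
  also have "\<dots> = trace (C * B)"
    using assms by (simp add: trace_def scalar_prod_def atLeast0LessThan)
  finally show ?thesis .
qed

lemma trace_minus:
  assumes "B \<in> carrier_mat n n" "C \<in> carrier_mat n n"
  shows "trace (B - C) = trace B - trace C"
  using assms by (simp add: trace_def sum_subtractf)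

lemma trace_proj_compl:
  assumes Q: "Q \<in> carrier_mat d k" "orthonormal_cols Q"
  shows "trace (proj_compl Q) = real d - real k"
proof -
  have "trace (proj_compl Q) = trace (1\<^sub>m d) - trace (Q * Q\<^sup>T)"
    unfolding proj_compl_def using Q(1) by (subst trace_minus[of _ d]) auto
  also have "trace (Q * Q\<^sup>T) = trace (Q\<^sup>T * Q)" using Q(1) by (intro trace_mult_comm[of _ d k]) auto
  finally show ?thesis unfolding orthonormal_colsD[OF Q(2,1)] by (simp add: trace_def)
qed

text \<open>Cyclicity and idempotence give \<open>tr (P X P) = tr (P X)\<close>, and
  \<open>P = 1 - Q Q^T\<close> separates the deflated part. This is why the idealized estimator is
  unbiased.\<close>

lemma trace_split:
  assumes Q: "Q \<in> carrier_mat d k" "orthonormal_cols Q" and X: "X \<in> carrier_mat d d"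
  shows "trace (Q\<^sup>T * X * Q) + trace (proj_compl Q * X * proj_compl Q) = trace X"
proof -
  note P = proj_compl_carrier[OF Q(1)]
  have "trace (proj_compl Q * X * proj_compl Q) = trace (proj_compl Q * (proj_compl Q * X))"
    using P X by (intro trace_mult_comm[of _ d d]) (auto intro!: mult_carrier_mat)
  also have "proj_compl Q * (proj_compl Q * X) = proj_compl Q * X"
    using assoc_mult_mat[OF P P X] proj_compl_idem[OF Q] by simp
  also have "trace (proj_compl Q * X) = trace (1\<^sub>m d * X - Q * Q\<^sup>T * X)"
    unfolding proj_compl_def using Q(1) X by (subst minus_mult_distrib_mat[of _ d d _ _ d]) auto
  also have "\<dots> = trace X - trace (Q * Q\<^sup>T * X)"
    using Q(1) X by (subst trace_minus[of _ d]) (auto intro!: mult_carrier_mat)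
  also have "trace (Q * Q\<^sup>T * X) = trace (Q * (Q\<^sup>T * X))"
    using Q(1) X by (subst assoc_mult_mat[of _ d k _ d _ d]) auto
  also have "\<dots> = trace (Q\<^sup>T * X * Q)"
    using Q(1) X by (intro trace_mult_comm[of _ d k]) (auto intro!: mult_carrier_mat)
  finally show ?thesis by simp
qed

section \<open>Euclidean and operator norms\<close>

lemma vec_norm_square: "(vec_norm v)\<^sup>2 = v \<bullet> v"
  unfolding vec_norm_def by (intro real_sqrt_pow2) (simp add: scalar_prod_def sum_nonneg)

lemma vec_norm_eq_L2_set: "vec_norm v = L2_set (\<lambda>i. v $ i) {..<dim_vec v}"
  by (simp add: vec_norm_def L2_set_def scalar_prod_def power2_eq_square atLeast0LessThan)

lemma vec_norm_eq_0: "v \<in> carrier_vec d \<Longrightarrow> v \<bullet> v = 0 \<Longrightarrow> v = (0\<^sub>v d :: real vec)"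
  by (intro eq_vecI) (auto simp: scalar_prod_def sum_nonneg_eq_0_iff)

text \<open>The supremum in \<open>op_norm\<close> is an upper bound only once the set is known to
  be bounded; the sum of the absolute values of all entries is a crude bound.\<close>

lemma vec_norm_mult_le_op_norm:
  assumes v: "v \<in> carrier_vec (dim_col B)" "vec_norm v \<le> 1"
  shows "vec_norm (B *\<^sub>v v) \<le> op_norm B"
  unfolding op_norm_def
proof (rule cSup_upper)
  show "vec_norm (B *\<^sub>v v) \<in> {vec_norm (B *\<^sub>v v) |v. v \<in> carrier_vec (dim_col B) \<and> vec_norm v \<le> 1}"
    using v by blast
  show "bdd_above {vec_norm (B *\<^sub>v v) |v. v \<in> carrier_vec (dim_col B) \<and> vec_norm v \<le> 1}"
  proof (rule bdd_aboveI)
    fix x assume "x \<in> {vec_norm (B *\<^sub>v v) |v. v \<in> carrier_vec (dim_col B) \<and> vec_norm v \<le> 1}"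
    then obtain v where v: "v \<in> carrier_vec (dim_col B)" "vec_norm v \<le> 1" and x: "x = vec_norm (B *\<^sub>v v)"
      by blast
    have "\<bar>v $ j\<bar> \<le> 1" if "j < dim_col B" for j
      using member_le_L2_set[of "{..<dim_vec v}" j "\<lambda>i. \<bar>v $ i\<bar>"] v that
      by (simp add: vec_norm_eq_L2_set L2_set_def) (meson order_trans real_sqrt_le_1_iff)
    then have row: "\<bar>row B i \<bullet> v\<bar> \<le> (\<Sum>j<dim_col B. \<bar>B $$ (i, j)\<bar>)" if "i < dim_row B" for i
      using v that unfolding scalar_prod_def atLeast0LessThan
      by (intro order_trans[OF sum_abs]) (auto intro!: sum_mono mult_left_le simp: abs_mult)
    have "x \<le> (\<Sum>i<dim_row B. \<bar>(B *\<^sub>v v) $ i\<bar>)"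
      unfolding x vec_norm_eq_L2_set dim_mult_mat_vec by (rule L2_set_le_sum_abs)
    also have "\<dots> \<le> (\<Sum>i<dim_row B. \<Sum>j<dim_col B. \<bar>B $$ (i, j)\<bar>)"
      by (intro sum_mono) (use row in simp)
    finally show "x \<le> (\<Sum>i<dim_row B. \<Sum>j<dim_col B. \<bar>B $$ (i, j)\<bar>)" .
  qed
qed

lemma abs_diag_le_op_norm:
  assumes B: "B \<in> carrier_mat n n" and i: "i < n"
  shows "\<bar>B $$ (i, i)\<bar> \<le> op_norm B"
proof -
  have e: "vec_norm (unit_vec n i :: real vec) \<le> 1" using i by (simp add: vec_norm_def)
  have "\<bar>B $$ (i, i)\<bar> = \<bar>(B *\<^sub>v unit_vec n i) $ i\<bar>" using B i by simp
  also have "\<dots> \<le> vec_norm (B *\<^sub>v unit_vec n i)"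
    using member_le_L2_set[of "{..<n}" i "\<lambda>j. \<bar>(B *\<^sub>v unit_vec n i) $ j\<bar>"] B i
    by (simp add: vec_norm_eq_L2_set L2_set_def)
  also have "\<dots> \<le> op_norm B" using vec_norm_mult_le_op_norm[of "unit_vec n i" B] e B by simp
  finally show ?thesis .
qed

lemma abs_trace_diff_le:
  assumes "B \<in> carrier_mat n n" "C \<in> carrier_mat n n"
  shows "\<bar>trace B - trace C\<bar> \<le> real n * op_norm (B - C)"
proof -
  have BC: "B - C \<in> carrier_mat n n" using assms by (intro minus_carrier_mat)
  have "\<bar>trace (B - C)\<bar> \<le> (\<Sum>i<n. \<bar>(B - C) $$ (i, i)\<bar>)"
    unfolding trace_def carrier_matD[OF BC] by (rule sum_abs)
  also have "\<dots> \<le> (\<Sum>i<n. op_norm (B - C))"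
    by (intro sum_mono abs_diag_le_op_norm[OF BC]) simp
  finally show ?thesis using trace_minus[OF assms] by simp
qed

text \<open>Orthonormal columns make \<open>Q\<close> an isometry, and \<open>k > 0\<close> supplies
  a unit vector attaining the norm. Thus the denominator in \<open>Delta_defl\<close> is 1.\<close>

lemma op_norm_orthonormal:
  assumes Q: "Q \<in> carrier_mat d k" "orthonormal_cols Q" and k: "k > 0"
  shows "op_norm Q = 1"
proof -
  have iso: "vec_norm (Q *\<^sub>v v) = vec_norm v" if v: "v \<in> carrier_vec k" for v
  proof -
    have "(Q *\<^sub>v v) \<bullet> (Q *\<^sub>v v) = (Q\<^sup>T *\<^sub>v (Q *\<^sub>v v)) \<bullet> v"
      using Q(1) v by (intro scalar_prod_mat_mult[of _ d k]) auto
    also have "Q\<^sup>T *\<^sub>v (Q *\<^sub>v v) = (Q\<^sup>T * Q) *\<^sub>v v"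
      using Q(1) v by (intro assoc_mult_mat_vec[symmetric, of _ k d _ k]) auto
    also have "\<dots> = v" unfolding orthonormal_colsD[OF Q(2,1)] using v by simp
    finally show ?thesis by (simp add: vec_norm_def)
  qed
  have e: "vec_norm (unit_vec k 0 :: real vec) = 1" using k by (simp add: vec_norm_def)
  have dim: "dim_col Q = k" using Q(1) by simp
  show ?thesis
  proof (rule antisym)
    show "op_norm Q \<le> 1"
      unfolding op_norm_def dim
      by (rule cSup_least) (use iso e in \<open>auto intro!: exI[of _ "unit_vec k 0"]\<close>)
    show "1 \<le> op_norm Q"
      using vec_norm_mult_le_op_norm[of "unit_vec k 0" Q] iso[of "unit_vec k 0"] e dim by simp
  qed
qed

section \<open>Frobenius norms of compressions\<close>

lemma frob_norm_transpose: "frob_norm B\<^sup>T = frob_norm B"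
  unfolding frob_norm_def by (simp add: sum.swap[of _ "{..<dim_col B}"])

lemma frob_norm_eq_cols: "(frob_norm B)\<^sup>2 = (\<Sum>j<dim_col B. col B j \<bullet> col B j)"
  unfolding frob_norm_square
  by (subst sum.swap) (simp add: scalar_prod_def power2_eq_square atLeast0LessThan)

text \<open>Columnwise Pythagoras: \<open>|y - P y|^2 = |y|^2 - |P y|^2\<close> is
  nonnegative.\<close>

lemma frob_norm_projection_le:
  fixes P :: "real mat"
  assumes P: "P \<in> carrier_mat d d" "P\<^sup>T = P" "P * P = P" and Y: "Y \<in> carrier_mat d n"
  shows "(frob_norm (P * Y))\<^sup>2 \<le> (frob_norm Y)\<^sup>2"
proof -
  have expand: "(a - b) \<bullet> (a - b) = a \<bullet> a - b \<bullet> a - b \<bullet> a + b \<bullet> b"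
    if "a \<in> carrier_vec d" "b \<in> carrier_vec d" for a b :: "real vec"
    using that by (simp add: scalar_prod_def algebra_simps sum_subtractf sum.distrib sum_distrib_left)
  have contr: "(P *\<^sub>v y) \<bullet> (P *\<^sub>v y) \<le> y \<bullet> y" if y: "y \<in> carrier_vec d" for y
  proof -
    have Py: "P *\<^sub>v y \<in> carrier_vec d" using P y by simp
    have "(P *\<^sub>v y) \<bullet> (P *\<^sub>v y) = (P *\<^sub>v (P *\<^sub>v y)) \<bullet> y"
      using scalar_prod_mat_mult[OF P(1) Py y] P(2) by simp
    also have "P *\<^sub>v (P *\<^sub>v y) = P *\<^sub>v y" using assoc_mult_mat_vec[OF P(1) P(1) y] P(3) by simp
    finally have 1: "(P *\<^sub>v y) \<bullet> (P *\<^sub>v y) = (P *\<^sub>v y) \<bullet> y" .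
    have "0 \<le> (y - P *\<^sub>v y) \<bullet> (y - P *\<^sub>v y)" by (simp add: scalar_prod_def sum_nonneg)
    also have "\<dots> = y \<bullet> y - (P *\<^sub>v y) \<bullet> y - (P *\<^sub>v y) \<bullet> y + (P *\<^sub>v y) \<bullet> (P *\<^sub>v y)"
      by (rule expand[OF y Py])
    finally show ?thesis using 1 by simp
  qed
  have "(frob_norm (P * Y))\<^sup>2 = (\<Sum>j<n. (P *\<^sub>v col Y j) \<bullet> (P *\<^sub>v col Y j))"
    unfolding frob_norm_eq_cols using P Y by (auto intro!: sum.cong simp: col_mult2[of _ d d _ n] mult_mat_vec_def)
  also have "\<dots> \<le> (\<Sum>j<n. col Y j \<bullet> col Y j)"
    using Y by (intro sum_mono contr) auto
  finally show ?thesis unfolding frob_norm_eq_cols using Y by simp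
qed

text \<open>If \<open>P' Q = 0\<close>, then \<open>P' = P' P = P P'\<close> for the complementary projector \<open>P\<close> of \<open>Q\<close>, so that
  \<open>P' X P' = P' (P X P) P'\<close>.\<close>
lemma frob_norm_residual_mono:
  assumes Q: "Q \<in> carrier_mat d k" and Q': "Q' \<in> carrier_mat d k'" "orthonormal_cols Q'"
    and 0: "proj_compl Q' * Q = 0\<^sub>m d k" and X: "X \<in> carrier_mat d d"
  shows "(frob_norm (proj_compl Q' * X * proj_compl Q'))\<^sup>2 \<le> (frob_norm (proj_compl Q * X * proj_compl Q))\<^sup>2"
proof -
  let ?P = "proj_compl Q" and ?P' = "proj_compl Q'"
  note P = proj_compl_carrier[OF Q] and P' = proj_compl_carrier[OF Q'(1)]
  note T = proj_compl_transpose[OF Q] and T' = proj_compl_transpose[OF Q'(1)]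
  have 1: "?P' * ?P = ?P'" by (rule mult_proj_compl[OF P' Q 0])
  have 2: "?P * ?P' = ?P'" using arg_cong[OF 1, of transpose_mat] transpose_mult[OF P' P] T T' by simp
  define Y where "Y = ?P * X * ?P"
  have Y: "Y \<in> carrier_mat d d" unfolding Y_def using P X by (auto intro!: mult_carrier_mat)
  have YP: "Y * ?P' \<in> carrier_mat d d" using Y P' by (auto intro!: mult_carrier_mat)
  have PX: "?P * X \<in> carrier_mat d d" "?P' * X \<in> carrier_mat d d" using P P' X by (auto intro!: mult_carrier_mat)
  have "Y * ?P' = ?P * X * ?P'" unfolding Y_def assoc_mult_mat[OF PX(1) P P'] 2 ..
  then have "?P' * (Y * ?P') = ?P' * (?P * X * ?P')" by simp
  also have "\<dots> = ?P' * (?P * X) * ?P'" by (rule assoc_mult_mat[OF P' PX(1) P', symmetric])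
  also have "?P' * (?P * X) = ?P' * X" using assoc_mult_mat[OF P' P X] 1 by simp
  finally have "(frob_norm (?P' * X * ?P'))\<^sup>2 = (frob_norm (?P' * (Y * ?P')))\<^sup>2" by simp
  also have "\<dots> \<le> (frob_norm (Y * ?P'))\<^sup>2"
    by (rule frob_norm_projection_le[OF P' T' proj_compl_idem[OF Q'] YP])
  \<comment> \<open>Transposing turns the right factor into a left one.\<close>
  also have "\<dots> = (frob_norm (?P' * Y\<^sup>T))\<^sup>2"
    using frob_norm_transpose[of "Y * ?P'"] transpose_mult[OF Y P'] T' by simp
  also have "\<dots> \<le> (frob_norm Y\<^sup>T)\<^sup>2"
    using Y by (intro frob_norm_projection_le[OF P' T' proj_compl_idem[OF Q']]) simp
  finally show ?thesis unfolding frob_norm_transpose Y_def .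
qed

section \<open>The two trace estimators\<close>

lemma mult_mat_unit_vec:
  fixes B :: "real mat"
  assumes "B \<in> carrier_mat n k" "j < k"
  shows "B *\<^sub>v unit_vec k j = col B j"
  using assms by (intro eq_vecI) auto

locale trace_setting =
  fixes A :: "real mat" and f :: "real \<Rightarrow> real" and d b q m n :: nat
    and qr :: "real mat \<Rightarrow> real mat \<times> real mat" and orth :: "real mat \<Rightarrow> real mat"
  assumes A: "A \<in> carrier_mat d d" "A\<^sup>T = A"
    and pos: "b \<ge> 1" "q \<ge> 1" "m \<ge> 1" "n \<ge> 1"
    and qr: "qr_routine qr" and orth: "orth_routine orth"
begin

abbreviation X :: "real mat" where "X \<equiv> mat_fun f A"

lemma X: "X \<in> carrier_mat d d" "X\<^sup>T = X"
  by (rule mat_fun_symmetric[OF A])+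

abbreviation runs where "runs p \<equiv> terminates p qr orth f A q n"
abbreviation Qh where "Qh p \<equiv> Q_hat p qr orth f A q"
abbreviation bh where "bh p \<equiv> b_hat p b q"

lemma lanczos_run_aware:
  assumes "Om \<in> carrier_mat d b" "runs Krylov_Aware Om Ps"
  shows "lanczos_run A Om d b (q + n) qr"
  using assms A qr pos by unfold_locales (auto simp: Let_def)

lemma Qbar_carrier: "Om \<in> carrier_mat d b \<Longrightarrow> lanczos_Qbar qr A Om j \<in> carrier_mat d (j * b)"
  by (simp add: lanczos_Qbar_def)

text \<open>The third claim holds because the Lanczos run from \<open>y\<close> succeeds: for
  \<open>y = 0\<close> the Krylov space would have dimension 0, contradicting
  \<open>n \<ge> 1\<close>.\<close>

lemma Q_hat_facts:
  assumes Om: "Om \<in> carrier_mat d b" and Ps: "Ps \<in> carrier_mat d m" and t: "runs p Om Ps"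
  shows "Qh p Om \<in> carrier_mat d (bh p)" "orthonormal_cols (Qh p Om)"
    "\<And>i. i < m \<Longrightarrow> y_vec (Qh p Om) Ps i \<bullet> y_vec (Qh p Om) Ps i \<noteq> 0"
proof -
  have Q: "Qh p Om \<in> carrier_mat d (bh p) \<and> orthonormal_cols (Qh p Om)"
  proof (cases p)
    case Simple
    have "is_orth B (orth B)" for B using orth by (simp add: orth_routine_def)
    then have "dim_row (Qh Simple Om) = dim_row (lanczos_Qbar qr A Om q)" "orthonormal_cols (Qh Simple Om)"
      by (simp_all add: is_orth_def)
    moreover have "dim_col (Qh Simple Om) = b" using t Om Simple by (simp add: Let_def del: Q_hat.simps)
    ultimately show ?thesis using Qbar_carrier[OF Om, of q] Simple by (auto intro!: carrier_matI simp del: Q_hat.simps)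
  next
    case Krylov_Aware
    interpret lanczos_run A Om d b "q + n" qr
      by (rule lanczos_run_aware[OF Om, of Ps]) (use t Krylov_Aware in simp)
    show ?thesis
      \<comment> \<open>The first \<open>q + 1\<close> blocks belong to the run of
        \<open>q + n\<close> steps because \<open>n \<ge> 1\<close>.\<close>
      using Qbar_orthonormal[of "q + 1"] Qbar_carrier[OF Om, of "q + 1"] pos Krylov_Aware
      by (simp add: orthonormal_cols_def)
  qed
  then show "Qh p Om \<in> carrier_mat d (bh p)" "orthonormal_cols (Qh p Om)" by auto
  fix i assume i: "i < m"
  let ?y = "y_vec (Qh p Om) Ps i"
  let ?Z = "y_mat (Qh p Om) Ps i"
  have y: "?y \<in> carrier_vec d"
    unfolding y_vec_def using Q proj_compl_carrier[of "Qh p Om" d "bh p"] Ps i by auto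
  have Z: "?Z \<in> carrier_mat d 1" unfolding y_mat_def using Q by (intro carrier_matI) auto
  have s: "lanczos_success A ?Z n" using t i Ps by (cases p) (auto simp: Let_def)
  interpret krylov A ?Z d 1 n by unfold_locales (fact A(1), fact Z, fact s)
  show "?y \<bullet> ?y \<noteq> 0"
  proof
    assume "?y \<bullet> ?y = 0"
    then have y0: "?y = 0\<^sub>v d" by (rule vec_norm_eq_0[OF y])
    have "?Z *\<^sub>v unit_vec 1 0 = col ?Z 0" by (rule mult_mat_unit_vec[OF Z]) simp
    also have "col ?Z 0 = 0\<^sub>v d"
      unfolding y_mat_def using y y0 Q by (subst col_mat_of_cols) auto
    finally have "(A ^\<^sub>m 0 * ?Z) *\<^sub>v unit_vec 1 0 = 0\<^sub>v d" using Z A(1) by simp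
    then have "unit_vec 1 0 = (0\<^sub>v 1 :: real vec)"
      using K_independent[of 0 "unit_vec 1 0"] K_0[of 0] pos by simp
    then have "unit_vec 1 0 $ 0 = (0\<^sub>v 1 :: real vec) $ 0" by metis
    then show False by simp
  qed
qed

text \<open>Each column of \<open>Q\<close> is a combination \<open>B x\<close> of the columns that
  were orthogonalized, and \<open>B\<close> has \<open>lanczos_Qbar\<close> as its left factor,
  which the projector annihilates. Only \<open>\<Omega>\<close> is shared; the two runs may use
  different \<open>\<Psi>\<close>.\<close>

lemma aware_kills_simple:
  assumes Om: "Om \<in> carrier_mat d b" and Ps: "Ps \<in> carrier_mat d m" "Ps' \<in> carrier_mat d m"
    and t: "runs Simple Om Ps" "runs Krylov_Aware Om Ps'"
  shows "proj_compl (Qh Krylov_Aware Om) * Qh Simple Om = 0\<^sub>m d b"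
proof -
  let ?Q1 = "lanczos_Qbar qr A Om (q + 1)" and ?Q0 = "lanczos_Qbar qr A Om q"
  interpret lanczos_run A Om d b "q + n" qr by (rule lanczos_run_aware[OF Om t(2)])
  note KA = Q_hat_facts[OF Om Ps(2) t(2), unfolded Q_hat.simps b_hat.simps]
  note S = Q_hat_facts[OF Om Ps(1) t(1)]
  define P where "P = proj_compl ?Q1"
  have P: "P \<in> carrier_mat d d" unfolding P_def by (rule proj_compl_carrier[OF KA(1)])
  have PQ1: "P * ?Q1 = 0\<^sub>m d ((q + 1) * b)" unfolding P_def by (rule proj_compl_mult[OF KA(1,2)])
  have Q0: "?Q0 \<in> carrier_mat d (q * b)" by (rule Qbar_carrier[OF Om])
  have PQ0: "P * ?Q0 = 0\<^sub>m d (q * b)"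
  proof (rule eq_matI)
    fix i c assume "i < dim_row (0\<^sub>m d (q * b))" "c < dim_col (0\<^sub>m d (q * b))"
    then have ic: "i < d" "c < q * b" "c < (q + 1) * b" by auto
    \<comment> \<open>Blocks do not depend on how many are collected, so \<open>?Q0\<close> consists
      of the leading columns of \<open>?Q1\<close>.\<close>
    have "col ?Q0 c = col ?Q1 c"
      using ic Om by (intro eq_vecI) (auto simp: lanczos_Qbar_def)
    then have "(P * ?Q0) $$ (i, c) = (P * ?Q1) $$ (i, c)"
      using P Q0 KA(1) ic by simp
    then show "(P * ?Q0) $$ (i, c) = 0\<^sub>m d (q * b) $$ (i, c)" unfolding PQ1 using ic by simp
  qed (use P Q0 in auto)
  define L where "L = leading (q * dim_col Om) (dim_col Om) (mat_fun f (lanczos_T qr A Om q))"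
  have L: "L \<in> carrier_mat (q * b) b" using Om by (simp add: L_def leading_def)
  define B where "B = ?Q0 * L * lanczos_R qr A Om 1"
  have Q0L: "?Q0 * L \<in> carrier_mat d b" using Q0 L by (rule mult_carrier_mat)
  have B: "B \<in> carrier_mat d b" unfolding B_def by (rule mult_carrier_mat[OF Q0L R])
  have PB: "P * B = 0\<^sub>m d b"
  proof -
    have "P * B = P * (?Q0 * L) * lanczos_R qr A Om 1"
      unfolding B_def by (rule assoc_mult_mat[OF P Q0L R, symmetric])
    also have "P * (?Q0 * L) = P * ?Q0 * L" by (rule assoc_mult_mat[OF P Q0 L, symmetric])
    also have "\<dots> = 0\<^sub>m d b" unfolding PQ0 using left_mult_zero_mat[OF L] by simp
    also have "0\<^sub>m d b * lanczos_R qr A Om 1 = 0\<^sub>m d b" by (rule left_mult_zero_mat[OF R])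
    finally show ?thesis .
  qed
  have QB: "Qh Simple Om = orth B" by (simp add: B_def L_def)
  have cs: "vec_space.col_space d (Qh Simple Om) = vec_space.col_space d B"
    using orth B unfolding orth_routine_def is_orth_def QB by auto
  have QS: "Qh Simple Om \<in> carrier_mat d b" using S(1) by simp
  show ?thesis
  proof (rule eq_matI)
    fix i j assume "i < dim_row (0\<^sub>m d b)" "j < dim_col (0\<^sub>m d b)"
    then have ij: "i < d" "j < b" by auto
    have "col (Qh Simple Om) j \<in> vec_space.col_space d (Qh Simple Om)"
      unfolding vec_space.col_space_eq[OF QS]
      using mult_mat_unit_vec[OF QS ij(2)] QS ij by (auto intro!: bexI[of _ "unit_vec b j"])
    then obtain x where x: "x \<in> carrier_vec b" "B *\<^sub>v x = col (Qh Simple Om) j"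
      unfolding cs vec_space.col_space_eq[OF B] using B by auto
    have "(P * Qh Simple Om) $$ (i, j) = (P *\<^sub>v col (Qh Simple Om) j) $ i"
      using P QS ij by simp
    also have "P *\<^sub>v col (Qh Simple Om) j = (P * B) *\<^sub>v x"
      unfolding x(2)[symmetric] by (rule assoc_mult_mat_vec[OF P B x(1), symmetric])
    also have "\<dots> $ i = 0" unfolding PB using x(1) ij by simp
    finally show "(proj_compl (Qh Krylov_Aware Om) * Qh Simple Om) $$ (i, j) = 0\<^sub>m d b $$ (i, j)"
      using ij by (simp add: P_def del: Q_hat.simps(1))
  qed (use P QS in \<open>auto simp: P_def simp del: Q_hat.simps(1)\<close>)
qed

lemma residual_frob_mono:
  assumes Om: "Om \<in> carrier_mat d b" and Ps: "Ps \<in> carrier_mat d m" "Ps' \<in> carrier_mat d m"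
    and t: "runs Simple Om Ps" "runs Krylov_Aware Om Ps'"
  shows "(frob_norm (residual Krylov_Aware qr orth f A q Om))\<^sup>2 \<le> (frob_norm (residual Simple qr orth f A q Om))\<^sup>2"
  unfolding residual_def Let_def
  using frob_norm_residual_mono[OF Q_hat_facts(1)[OF Om Ps(1) t(1)] Q_hat_facts(1,2)[OF Om Ps(2) t(2)] _ X(1)]
    aware_kills_simple[OF Om Ps t] by (simp del: Q_hat.simps)

text \<open>The factor \<open>d - bh p\<close> undoes the normalization of \<open>y\<close>: a
  Rayleigh quotient on the range of the projector averages to
  \<open>tr F / (d - bh p)\<close>.\<close>

definition t_star :: "procedure \<Rightarrow> real mat \<Rightarrow> real mat \<Rightarrow> real" where
  "t_star p Om Ps = trace ((Qh p Om)\<^sup>T * X * Qh p Om) + (real d - real (bh p)) / real m *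
     (\<Sum>i<m. (y_vec (Qh p Om) Ps i \<bullet> (X *\<^sub>v y_vec (Qh p Om) Ps i)) / (y_vec (Qh p Om) Ps i \<bullet> y_vec (Qh p Om) Ps i))"

lemma t_out_error:
  assumes Om: "Om \<in> carrier_mat d b" and Ps: "Ps \<in> carrier_mat d m" and t: "runs p Om Ps"
    and k: "bh p \<le> d"
  shows "\<bar>t_out p qr orth f A q n Om Ps - t_star p Om Ps\<bar> \<le> real d * Delta p qr orth f A q n Om Ps"
proof -
  define Q where "Q = Qh p Om"
  note facts = Q_hat_facts[OF Om Ps t, folded Q_def]
  define D where "D = Delta p qr orth f A q n Om Ps"
  have bh0: "bh p > 0" using pos by (cases p) auto
  have dims: "dim_col Om = b" "dim_col Ps = m" using Om Ps by auto
  define T where "T = leading (bh p) (bh p) (mat_fun f (T_hat p qr orth f A q n Om))"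
  have T: "T \<in> carrier_mat (bh p) (bh p)" by (simp add: T_def leading_def)
  have QXQ: "Q\<^sup>T * X * Q \<in> carrier_mat (bh p) (bh p)" using facts(1) X by (auto intro!: mult_carrier_mat)
  have "Delta_defl p qr orth f A q n Om \<le> D"
    unfolding D_def Delta_def by (intro Max_ge) auto
  then have defl: "op_norm (Q\<^sup>T * X * Q - T) \<le> D"
    unfolding Delta_defl_def Let_def dims T_def[symmetric] Q_def[symmetric]
      op_norm_orthonormal[OF facts(1,2) bh0] by simp
  have 1: "\<bar>trace T - trace (Q\<^sup>T * X * Q)\<bar> \<le> real (bh p) * D"
    using abs_trace_diff_le[OF QXQ T] mult_left_mono[OF defl, of "real (bh p)"] by linarith
  let ?y = "y_vec Q Ps"
  let ?e = "y_lanczos_entry qr f A Q n Ps"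
  have 2: "\<bar>?e i - (?y i \<bullet> (X *\<^sub>v ?y i)) / (?y i \<bullet> ?y i)\<bar> \<le> D" if i: "i < m" for i
  proof -
    have y: "?y i \<bullet> ?y i > 0"
      using facts(3)[OF i] sum_nonneg[of "{0..<dim_vec (?y i)}" "\<lambda>j. ?y i $ j * ?y i $ j"]
      by (simp add: scalar_prod_def)
    have "Delta_rem p qr orth f A q n Om Ps i \<le> D"
      unfolding D_def Delta_def using i dims by (intro Max_ge) auto
    moreover have "Delta_rem p qr orth f A q n Om Ps i = \<bar>(?y i \<bullet> (X *\<^sub>v ?y i)) / (?y i \<bullet> ?y i) - ?e i\<bar>"
    proof -
      have "(?y i \<bullet> (X *\<^sub>v ?y i)) / (?y i \<bullet> ?y i) - ?e i = (?y i \<bullet> (X *\<^sub>v ?y i) - (?y i \<bullet> ?y i) * ?e i) / (?y i \<bullet> ?y i)"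
        using y by (simp add: diff_divide_distrib)
      then show ?thesis
        unfolding Delta_rem_def Let_def Q_def[symmetric] vec_norm_square using y by (simp add: abs_divide)
    qed
    ultimately show ?thesis by (simp add: abs_minus_commute)
  qed
  let ?k = "real d - real (bh p)"
  have k0: "?k / real m \<ge> 0" using k by simp
  have "\<bar>(\<Sum>i<m. ?e i) - (\<Sum>i<m. (?y i \<bullet> (X *\<^sub>v ?y i)) / (?y i \<bullet> ?y i))\<bar> \<le> (\<Sum>i<m. D)"
    unfolding sum_subtractf[symmetric] by (intro order_trans[OF sum_abs] sum_mono) (use 2 in auto)
  then have "?k / real m * \<bar>(\<Sum>i<m. ?e i) - (\<Sum>i<m. (?y i \<bullet> (X *\<^sub>v ?y i)) / (?y i \<bullet> ?y i))\<bar> \<le> ?k / real m * (real m * D)"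
    by (intro mult_left_mono[OF _ k0]) simp
  also have "\<dots> = ?k * D" using pos by simp
  finally have 3: "\<bar>?k / real m * (\<Sum>i<m. ?e i) - ?k / real m * (\<Sum>i<m. (?y i \<bullet> (X *\<^sub>v ?y i)) / (?y i \<bullet> ?y i))\<bar> \<le> ?k * D"
    unfolding right_diff_distrib[symmetric] abs_mult abs_of_nonneg[OF k0] .
  have t_out: "t_out p qr orth f A q n Om Ps = trace T + ?k / real m * (\<Sum>i<m. ?e i)"
    unfolding t_out_def t_defl_def t_rem_def Let_def dims T_def Q_def using A(1) by simp
  have t_star: "t_star p Om Ps = trace (Q\<^sup>T * X * Q) + ?k / real m * (\<Sum>i<m. (?y i \<bullet> (X *\<^sub>v ?y i)) / (?y i \<bullet> ?y i))"
    unfolding t_star_def Q_def ..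
  have "\<bar>(a + e) - (a' + e')\<bar> \<le> x + y" if "\<bar>a - a'\<bar> \<le> x" "\<bar>e - e'\<bar> \<le> y" for a a' e e' x y :: real
    using that by linarith
  from this[OF 1 3] have "\<bar>t_out p qr orth f A q n Om Ps - t_star p Om Ps\<bar> \<le> real (bh p) * D + ?k * D"
    unfolding t_out t_star .
  then show ?thesis unfolding D_def by (simp add: algebra_simps)
qed

end

section \<open>Mean and variance for a fixed starting block\<close>

context trace_setting
begin

text \<open>The quantity \<open>V\<close> with its expectations removed. It is linear in the squared
  Frobenius norm and the squared trace, so its expectation over \<open>\<Omega>\<close> is
  \<open>V\<close>.\<close>

definition cond_var :: "procedure \<Rightarrow> real mat \<Rightarrow> real" where
  "cond_var p Om = 2 / real m * ((real d - real (bh p)) / (real d - real (bh p) + 2)) *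
     ((frob_norm (residual p qr orth f A q Om))\<^sup>2 - (trace (residual p qr orth f A q Om))\<^sup>2 / (real d - real (bh p)))"

lemma prob_space_gauss_entries: "prob_space (gauss_entries r c)"
  unfolding gauss_entries_def by (intro prob_space_PiM prob_space_std_gauss)

text \<open>Diagonalize the projector and \<open>F\<close> simultaneously; then every sample of the Hutchinson part is
  a weighted mean of the squared coordinates of a Gaussian vector.\<close>
lemma conditional_moments:
  assumes Om: "Om \<in> carrier_mat d b"
    and ae: "AE ps in gauss_entries d m. runs p Om (mat d m ps)"
  defines "G \<equiv> gauss_entries d m" and "T \<equiv> \<lambda>ps. t_star p Om (mat d m ps)"
  shows "bh p \<le> d" "integrable G T" "(\<integral>ps. T ps \<partial>G) = trace X"
    "integrable G (\<lambda>ps. (T ps - trace X)\<^sup>2)" "(\<integral>ps. (T ps - trace X)\<^sup>2 \<partial>G) = cond_var p Om"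
proof -
  interpret G: prob_space G unfolding G_def by (rule prob_space_gauss_entries)
  define Q where "Q = Qh p Om"
  define P where "P = proj_compl Q"
  define F where "F = P * X * P"
  have Ps: "mat d m ps \<in> carrier_mat d m" for ps :: "nat \<times> nat \<Rightarrow> real" by simp
  \<comment> \<open>One successful sample is enough for the facts about \<open>Q\<close>, which
    depends on \<open>\<Omega>\<close> alone.\<close>
  have "\<exists>ps. runs p Om (mat d m ps)"
  proof (rule ccontr)
    assume "\<not> ?thesis"
    with ae have "AE ps in G. False" unfolding G_def by simp
    then show False by simp
  qed
  then obtain ps0 where ps0: "runs p Om (mat d m ps0)" by blast
  note facts = Q_hat_facts[OF Om Ps, where p = p, folded Q_def]
  have Q: "Q \<in> carrier_mat d (bh p)" "orthonormal_cols Q" using facts(1,2)[OF ps0] .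
  have P: "P \<in> carrier_mat d d" "P\<^sup>T = P" "P * P = P"
    unfolding P_def using proj_compl_carrier[OF Q(1)] proj_compl_transpose[OF Q(1)] proj_compl_idem[OF Q] .
  have PX: "P * X \<in> carrier_mat d d" using P X by (auto intro!: mult_carrier_mat)
  have F: "F \<in> carrier_mat d d" unfolding F_def by (rule mult_carrier_mat[OF PX P(1)])
  have XP: "X * P \<in> carrier_mat d d" using P X by (auto intro!: mult_carrier_mat)
  have F2: "F = P * (X * P)" unfolding F_def by (rule assoc_mult_mat[OF P(1) X(1) P(1)])
  have FT: "F\<^sup>T = F"
    unfolding F_def transpose_mult[OF PX P(1)] transpose_mult[OF P(1) X(1)] P(2) X(2)
    by (rule F2[unfolded F_def, symmetric])
  have PF: "P * F = F" unfolding F2 assoc_mult_mat[OF P(1) P(1) XP, symmetric] P(3) ..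
  have FP: "F * P = F" unfolding F_def assoc_mult_mat[OF PX P(1) P(1)] P(3) ..
  obtain U l J where U: "U \<in> carrier_mat d d" "U\<^sup>T * U = 1\<^sub>m d" and J: "J \<subseteq> {..<d}"
    and PU: "P = U * mat_diag d (\<lambda>a. of_bool (a \<in> J)) * U\<^sup>T" and FU: "F = U * mat_diag d l * U\<^sup>T"
    and l0: "\<And>a. a < d \<Longrightarrow> a \<notin> J \<Longrightarrow> l a = 0"
    using projection_simultaneous_diagonalization[OF P F FT PF FP] by blast
  have sumJ: "(\<Sum>a<d. g a) = (\<Sum>a\<in>J. g a)" if "\<And>a. a < d \<Longrightarrow> a \<notin> J \<Longrightarrow> g a = 0" for g :: "nat \<Rightarrow> real"
    using J that by (intro sum.mono_neutral_right) auto
  \<comment> \<open>The trace of the projector counts the eigenvectors in \<open>J\<close>, so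
    \<open>card J\<close> is the dimension of the complement; in particular
    \<open>bh p \<le> d\<close>.\<close>
  have "real d - real (bh p) = trace P" unfolding P_def using trace_proj_compl[OF Q] by simp
  also have "\<dots> = (\<Sum>a<d. of_bool (a \<in> J))" unfolding PU by (rule trace_orth_diag[OF U])
  also have "\<dots> = (\<Sum>a\<in>J. of_bool (a \<in> J))" by (rule sumJ) simp
  finally have k: "real d - real (bh p) = real (card J)" by simp
  then show bd: "bh p \<le> d" by linarith
  have trF: "trace F = (\<Sum>a\<in>J. l a)" unfolding FU trace_orth_diag[OF U] by (rule sumJ) (simp add: l0)
  have frF: "(frob_norm F)\<^sup>2 = (\<Sum>a\<in>J. (l a)\<^sup>2)" unfolding FU frob_norm_orth_diag[OF U] by (rule sumJ) (simp add: l0)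
  define z :: "nat \<Rightarrow> nat \<Rightarrow> (nat \<times> nat \<Rightarrow> real) \<Rightarrow> real" where "z = (\<lambda>i a w. \<Sum>j<d. U $$ (j, a) * w (j, i))"
  define s where "s = (\<lambda>i w. (\<Sum>a\<in>J. l a * (z i a w)\<^sup>2) / (\<Sum>a\<in>J. (z i a w)\<^sup>2))"
  define \<mu> where "\<mu> = (\<Sum>a\<in>J. l a) / real (card J)"
  \<comment> \<open>By \<open>P^2 = P\<close> and \<open>P X P = F\<close> both forms in
    \<open>y = P x\<close> become forms in the Gaussian column \<open>x\<close>, and the eigenbasis
    leaves only the coordinates in \<open>J\<close>.\<close>
  have y: "y_vec Q (mat d m ps) i \<bullet> y_vec Q (mat d m ps) i = (\<Sum>a\<in>J. (z i a ps)\<^sup>2)"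
    "y_vec Q (mat d m ps) i \<bullet> (X *\<^sub>v y_vec Q (mat d m ps) i) = (\<Sum>a\<in>J. l a * (z i a ps)\<^sup>2)"
    if i: "i < m" for i and ps :: "nat \<times> nat \<Rightarrow> real"
  proof -
    let ?x = "col (mat d m ps) i"
    have x: "?x \<in> carrier_vec d" by (rule carrier_vecI) simp
    have zx: "(\<Sum>j<d. U $$ (j, a) * ?x $ j) = z i a ps" for a
      unfolding z_def using i by (intro sum.cong) auto
    have yv: "y_vec Q (mat d m ps) i = P *\<^sub>v ?x" by (simp add: y_vec_def P_def)
    have Px: "P *\<^sub>v ?x \<in> carrier_vec d" using P(1) x by (rule mult_mat_vec_carrier)
    have XPx: "X *\<^sub>v (P *\<^sub>v ?x) \<in> carrier_vec d" using X(1) Px by (rule mult_mat_vec_carrier)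
    have "(P *\<^sub>v ?x) \<bullet> (P *\<^sub>v ?x) = ?x \<bullet> (P *\<^sub>v (P *\<^sub>v ?x))"
      using scalar_prod_mat_mult[OF P(1) x Px] P(2) by simp
    also have "P *\<^sub>v (P *\<^sub>v ?x) = P *\<^sub>v ?x" using assoc_mult_mat_vec[OF P(1) P(1) x] P(3) by simp
    also have "?x \<bullet> (P *\<^sub>v ?x) = (\<Sum>a<d. of_bool (a \<in> J) * (\<Sum>j<d. U $$ (j, a) * ?x $ j)\<^sup>2)"
      unfolding PU by (rule orth_diag_quadratic[OF U(1) x])
    also have "\<dots> = (\<Sum>a\<in>J. of_bool (a \<in> J) * (z i a ps)\<^sup>2)" unfolding zx by (rule sumJ) simp
    finally show "y_vec Q (mat d m ps) i \<bullet> y_vec Q (mat d m ps) i = (\<Sum>a\<in>J. (z i a ps)\<^sup>2)"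
      unfolding yv by simp
    have "(P *\<^sub>v ?x) \<bullet> (X *\<^sub>v (P *\<^sub>v ?x)) = ?x \<bullet> (P *\<^sub>v (X *\<^sub>v (P *\<^sub>v ?x)))"
      using scalar_prod_mat_mult[OF P(1) x XPx] P(2) by simp
    also have "P *\<^sub>v (X *\<^sub>v (P *\<^sub>v ?x)) = F *\<^sub>v ?x"
      unfolding F_def using assoc_mult_mat_vec[OF PX P(1) x] assoc_mult_mat_vec[OF P(1) X(1) Px] by simp
    also have "?x \<bullet> (F *\<^sub>v ?x) = (\<Sum>a<d. l a * (\<Sum>j<d. U $$ (j, a) * ?x $ j)\<^sup>2)"
      unfolding FU by (rule orth_diag_quadratic[OF U(1) x])
    also have "\<dots> = (\<Sum>a\<in>J. l a * (z i a ps)\<^sup>2)" unfolding zx by (rule sumJ) (simp add: l0)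
    finally show "y_vec Q (mat d m ps) i \<bullet> (X *\<^sub>v y_vec Q (mat d m ps) i) = (\<Sum>a\<in>J. l a * (z i a ps)\<^sup>2)"
      unfolding yv .
  qed
  \<comment> \<open>The denominator is \<open>y \<bullet> y\<close>, nonzero whenever the run
    succeeds, which here is almost surely.\<close>
  have nz: "AE ps in gauss_entries d m. (\<Sum>a\<in>J. (\<Sum>j<d. U $$ (j, a) * ps (j, i))\<^sup>2) \<noteq> 0" if i: "i < m" for i
    using ae
  proof eventually_elim
    case (elim ps)
    then show ?case using facts(3)[OF elim i] unfolding y(1)[OF i] z_def by blast
  qed
  have J0: "J \<noteq> {}"
    using facts(3)[OF ps0, of 0] y(1)[of 0 ps0] pos by auto
  have orthU: "(\<Sum>j<d. U $$ (j, a) * U $$ (j, e)) = of_bool (a = e)" if "a < d" "e < d" for a e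
    by (rule orth_cols_sum[OF U that])
  have s_int: "integrable G (s i)" if "i < m" for i
    unfolding s_def z_def G_def
    by (rule gauss_columns_moments(1)[OF _ J J0 _ that]) (erule (1) orthU | erule nz)+
  have s_mean: "(\<integral>w. s i w \<partial>G) = \<mu>" if "i < m" for i
    unfolding s_def z_def G_def \<mu>_def
    by (rule gauss_columns_moments(2)[OF _ J J0 _ that]) (erule (1) orthU | erule nz)+
  have dev_int: "integrable G (\<lambda>w. (\<Sum>i<m. s i w - \<mu>)\<^sup>2)"
    unfolding s_def z_def G_def \<mu>_def
    by (rule gauss_columns_moments(3)[OF _ J J0]) (erule (1) orthU | erule nz)+
  have dev_mean: "(\<integral>w. (\<Sum>i<m. s i w - \<mu>)\<^sup>2 \<partial>G) = real m *
      (2 / (real (card J) * (real (card J) + 2)) * ((\<Sum>a\<in>J. (l a)\<^sup>2) - (\<Sum>a\<in>J. l a)\<^sup>2 / real (card J)))"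
    unfolding s_def z_def G_def \<mu>_def
    by (rule gauss_columns_moments(4)[OF _ J J0]) (erule (1) orthU | erule nz)+
  have c0: "real (card J) > 0" using J0 finite_subset[OF J] by (simp add: card_gt_0_iff)
  define C where "C = trace (Q\<^sup>T * X * Q)"
  \<comment> \<open>The mean \<open>\<mu>\<close> of a sample is \<open>tr F / card J\<close>, so
    scaling by \<open>card J\<close> restores \<open>tr F\<close>.\<close>
  have trX: "trace X = C + real (card J) * \<mu>"
    using trace_split[OF Q X(1)] trF c0 by (simp add: C_def \<mu>_def F_def P_def)
  have T: "T ps = C + real (card J) / real m * (\<Sum>i<m. s i ps)" for ps
    unfolding T_def t_star_def k Q_def[symmetric] C_def
    by (simp add: y s_def)
  have m0: "real m > 0" using pos by simp
  have sum_int: "integrable G (\<lambda>ps. \<Sum>i<m. s i ps)"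
    by (rule Bochner_Integration.integrable_sum) (simp add: s_int)
  have sum_mean: "(\<integral>ps. (\<Sum>i<m. s i ps) \<partial>G) = real m * \<mu>"
    by (subst Bochner_Integration.integral_sum) (simp_all add: s_int s_mean)
  show "integrable G T" unfolding T using sum_int by auto
  have "(\<integral>ps. T ps \<partial>G) = C + real (card J) / real m * (real m * \<mu>)"
    unfolding T using sum_int sum_mean G.prob_space by simp
  then show "(\<integral>ps. T ps \<partial>G) = trace X" unfolding trX using m0 by simp
  have dev: "(T ps - trace X)\<^sup>2 = (real (card J) / real m)\<^sup>2 * (\<Sum>i<m. s i ps - \<mu>)\<^sup>2" for ps
  proof -
    have "T ps - trace X = real (card J) / real m * (\<Sum>i<m. s i ps - \<mu>)"
      unfolding T trX using m0 by (simp add: sum_subtractf field_simps)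
    then show ?thesis by (simp add: power_mult_distrib power_divide)
  qed
  show "integrable G (\<lambda>ps. (T ps - trace X)\<^sup>2)" unfolding dev using dev_int by auto
  have "(\<integral>ps. (T ps - trace X)\<^sup>2 \<partial>G) = (real (card J) / real m)\<^sup>2 *
      (real m * (2 / (real (card J) * (real (card J) + 2)) * ((frob_norm F)\<^sup>2 - (trace F)\<^sup>2 / real (card J))))"
    unfolding dev frF trF by (simp add: dev_mean)
  also have "\<dots> = 2 / real m * (real (card J) / (real (card J) + 2)) * ((frob_norm F)\<^sup>2 - (trace F)\<^sup>2 / real (card J))"
    using c0 m0 by (simp add: power2_eq_square divide_simps)
  finally show "(\<integral>ps. (T ps - trace X)\<^sup>2 \<partial>G) = cond_var p Om"
    unfolding cond_var_def k residual_def Let_def F_def P_def Q_def .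
qed

end

section \<open>Combining the conditional moments with the Lanczos errors\<close>

theorem theorem3p2:
  fixes A :: "real mat" and f :: "real \<Rightarrow> real" and d b q m n :: nat
    and qr :: "real mat \<Rightarrow> real mat \<times> real mat" and orth :: "real mat \<Rightarrow> real mat"
  assumes "A \<in> carrier_mat d d" and "A\<^sup>T = A"
    and "b \<ge> 1" and "q \<ge> 1" and "m \<ge> 1" and "n \<ge> 1"
    and "qr_routine qr" and "orth_routine orth"
    and "\<And>p. AE w in sample_space d b m.
               terminates p qr orth f A q n (Omega d b w) (Psi d m w)"
  shows
    "(\<forall>p.
       let S = sample_space d b m;
           E = (\<lambda>X. prob_space.expectation S X);
           t = (\<lambda>w. t_out p qr orth f A q n (Omega d b w) (Psi d m w));
           D = (\<lambda>w. Delta p qr orth f A q n (Omega d b w) (Psi d m w));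
           F = (\<lambda>w. residual p qr orth f A q (Omega d b w));
           k = real d - real (b_hat p b q);
           V = 2 / real m * (k / (k + 2)) *
                 (E (\<lambda>w. (frob_norm (F w))\<^sup>2) - E (\<lambda>w. (trace (F w))\<^sup>2) / k)
       in (integrable S t \<longrightarrow> integrable S D
             \<longrightarrow> \<bar>trace (mat_fun f A) - E t\<bar> \<le> real d * E D)
        \<and> (integrable S t \<longrightarrow> integrable S (\<lambda>w. (t w)\<^sup>2) \<longrightarrow> integrable S (\<lambda>w. (D w)\<^sup>2)
             \<longrightarrow> integrable S (\<lambda>w. (frob_norm (F w))\<^sup>2) \<longrightarrow> integrable S (\<lambda>w. (trace (F w))\<^sup>2)
             \<longrightarrow> prob_space.variance S t \<le> (sqrt V + real d * sqrt (E (\<lambda>w. (D w)\<^sup>2)))\<^sup>2))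
     \<and> (\<forall>Om \<in> carrier_mat d b. \<forall>Ps \<in> carrier_mat d m. \<forall>Ps' \<in> carrier_mat d m.
          terminates Simple qr orth f A q n Om Ps
          \<longrightarrow> terminates Krylov_Aware qr orth f A q n Om Ps'
          \<longrightarrow> (frob_norm (residual Krylov_Aware qr orth f A q Om))\<^sup>2
              \<le> (frob_norm (residual Simple qr orth f A q Om))\<^sup>2)
     \<and> (let S = sample_space d b m;
            G = (\<lambda>p w. (frob_norm (residual p qr orth f A q (Omega d b w)))\<^sup>2)
        in integrable S (G Krylov_Aware) \<longrightarrow> integrable S (G Simple)
             \<longrightarrow> prob_space.expectation S (G Krylov_Aware) \<le> prob_space.expectation S (G Simple))"
proof -
  interpret trace_setting A f d b q m n qr orth by unfold_locales (fact assms)+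
  let ?M1 = "gauss_entries d b" and ?M2 = "gauss_entries d m"
  let ?S = "sample_space d b m"
  have M: "prob_space ?M1" "prob_space ?M2" by (rule prob_space_gauss_entries)+
  interpret M1: prob_space ?M1 by (rule M(1))
  interpret M2: prob_space ?M2 by (rule M(2))
  interpret pair_sigma_finite ?M1 ?M2 ..
  have S: "?S = completion (?M1 \<Otimes>\<^sub>M ?M2)" by (simp add: sample_space_def)
  have Om: "Omega d b w \<in> carrier_mat d b" and Ps: "Psi d m w \<in> carrier_mat d m" for w
    by (simp_all add: Omega_def Psi_def)
  \<comment> \<open>Null sets of the completion are those of the product measure up to measurable
    supersets, so almost sure success passes to almost every section.\<close>
  have good: "AE x in ?M1. AE y in ?M2. runs p (mat d b x) (mat d m y)" for p
  proof -
    have "AE w in ?M1 \<Otimes>\<^sub>M ?M2. runs p (Omega d b w) (Psi d m w)"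
      using assms(9)[of p] unfolding S AE_completion_iff .
    from AE_pair[OF this] show ?thesis by (simp add: Omega_def Psi_def)
  qed
  show ?thesis
  proof (intro conjI, goal_cases)
    case 1
    show ?case
      unfolding Let_def
    proof (intro allI conjI impI)
      fix p
      let ?t = "\<lambda>w. t_out p qr orth f A q n (Omega d b w) (Psi d m w)"
      let ?D = "\<lambda>w. Delta p qr orth f A q n (Omega d b w) (Psi d m w)"
      let ?F = "\<lambda>w. residual p qr orth f A q (Omega d b w)"
      let ?k = "real d - real (bh p)"
      \<comment> \<open>For almost every \<open>\<Omega>\<close> one function \<open>T\<close> of
        \<open>\<Psi>\<close> serves both the bias and the variance estimate.\<close>
      have approx: "AE x in ?M1. \<exists>T. T \<in> borel_measurable ?M2 \<and> integrable ?M2 T \<and> (\<integral>y. T y \<partial>?M2) = trace X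
          \<and> integrable ?M2 (\<lambda>y. (T y - trace X)\<^sup>2) \<and> (\<integral>y. (T y - trace X)\<^sup>2 \<partial>?M2) = cond_var p (mat d b x)
          \<and> (AE y in ?M2. \<bar>?t (x, y) - T y\<bar> \<le> real d * ?D (x, y))"
        using good[of p]
      proof eventually_elim
        case (elim x)
        have Omx: "mat d b x \<in> carrier_mat d b" by simp
        note cm = conditional_moments[OF Omx elim]
        show ?case
        proof (intro exI conjI)
          show "integrable ?M2 (\<lambda>ps. t_star p (mat d b x) (mat d m ps))" by (rule cm(2))
          then show "(\<lambda>ps. t_star p (mat d b x) (mat d m ps)) \<in> borel_measurable ?M2" by (rule borel_measurable_integrable)
          show "AE y in ?M2. \<bar>?t (x, y) - t_star p (mat d b x) (mat d m y)\<bar> \<le> real d * ?D (x, y)"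
            using elim
          proof eventually_elim
            case (elim y)
            then show ?case using t_out_error[OF Omx _ elim cm(1)] by (simp add: Omega_def Psi_def)
          qed
        qed (rule cm)+
      qed
      show "\<bar>trace X - prob_space.expectation ?S ?t\<bar> \<le> real d * prob_space.expectation ?S ?D"
        if "integrable ?S ?t" "integrable ?S ?D"
        unfolding S
      proof (rule mean_error_completion[OF M])
        show "AE x in ?M1. \<exists>T. integrable ?M2 T \<and> (\<integral>y. T y \<partial>?M2) = trace X
            \<and> (AE y in ?M2. \<bar>?t (x, y) - T y\<bar> \<le> real d * ?D (x, y))"
          using approx by eventually_elim blast
      qed (use that S in auto)
      assume int: "integrable ?S ?t" "integrable ?S (\<lambda>w. (?t w)\<^sup>2)" "integrable ?S (\<lambda>w. (?D w)\<^sup>2)"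
        "integrable ?S (\<lambda>w. (frob_norm (?F w))\<^sup>2)" "integrable ?S (\<lambda>w. (trace (?F w))\<^sup>2)"
      have cv: "cond_var p (mat d b (fst w)) = 2 / real m * (?k / (?k + 2)) * ((frob_norm (?F w))\<^sup>2 - (trace (?F w))\<^sup>2 / ?k)" for w
        by (simp add: cond_var_def Omega_def)
      have cv_int: "integrable ?S (\<lambda>w. cond_var p (mat d b (fst w)))"
        unfolding cv using int(4,5) by auto
      have cv_eq: "prob_space.expectation ?S (\<lambda>w. cond_var p (mat d b (fst w)))
          = 2 / real m * (?k / (?k + 2)) * (prob_space.expectation ?S (\<lambda>w. (frob_norm (?F w))\<^sup>2)
              - prob_space.expectation ?S (\<lambda>w. (trace (?F w))\<^sup>2) / ?k)"
        unfolding cv using int(4,5) by simp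
      have "prob_space.variance ?S ?t \<le> (sqrt (prob_space.expectation ?S (\<lambda>w. cond_var p (mat d b (fst w))))
          + real d * sqrt (prob_space.expectation ?S (\<lambda>w. (?D w)\<^sup>2)))\<^sup>2"
        unfolding S
      proof (rule variance_completion_le[OF M, where c = "trace X"])
        show "AE x in ?M1. \<exists>T. T \<in> borel_measurable ?M2 \<and> integrable ?M2 (\<lambda>y. (T y - trace X)\<^sup>2)
            \<and> (\<integral>y. (T y - trace X)\<^sup>2 \<partial>?M2) = cond_var p (mat d b x)
            \<and> (AE y in ?M2. \<bar>?t (x, y) - T y\<bar> \<le> real d * ?D (x, y))"
          using approx by eventually_elim blast
      qed (use int cv_int S in auto)
      then show "prob_space.variance ?S ?t \<le> (sqrt (2 / real m * (?k / (?k + 2)) *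
            (prob_space.expectation ?S (\<lambda>w. (frob_norm (?F w))\<^sup>2) - prob_space.expectation ?S (\<lambda>w. (trace (?F w))\<^sup>2) / ?k))
          + real d * sqrt (prob_space.expectation ?S (\<lambda>w. (?D w)\<^sup>2)))\<^sup>2"
        unfolding cv_eq .
    qed
  next
    case 2
    show ?case
    proof (intro ballI impI)
      fix Om Ps Ps' :: "real mat"
      assume "Om \<in> carrier_mat d b" "Ps \<in> carrier_mat d m" "Ps' \<in> carrier_mat d m"
        "runs Simple Om Ps" "runs Krylov_Aware Om Ps'"
      then show "(frob_norm (residual Krylov_Aware qr orth f A q Om))\<^sup>2 \<le> (frob_norm (residual Simple qr orth f A q Om))\<^sup>2"
        by (rule residual_frob_mono)
    qed
  next
    case 3
    show ?case
      unfolding Let_def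
    proof (intro impI integral_mono_AE)
      show "AE w in ?S. (frob_norm (residual Krylov_Aware qr orth f A q (Omega d b w)))\<^sup>2
          \<le> (frob_norm (residual Simple qr orth f A q (Omega d b w)))\<^sup>2"
        \<comment> \<open>Almost surely both procedures succeed on one and the same sample, so the
          pointwise comparison applies with a common \<open>\<Omega>\<close>.\<close>
        using assms(9)[of Simple] assms(9)[of Krylov_Aware]
        by eventually_elim (rule residual_frob_mono[OF Om Ps Ps])
    qed
  qed
qed

end
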